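(* Let $T>0$, $\alpha\in(0,1)$, $s\in(0,1)$, $H\in(0,1)$, and let $D$ be a bounded domain with Lipschitz boundary. Let $f,g\in L^{2}(D)$ and $h\in L^{\infty}([0,T])$, and let $u$ be the (mild) solution of $$\partial_{t}u(x,t)+\partial^{1-\alpha}_{t}A^{s}u(x,t)=f(x)h(t)+g(x)\dot{W}^{H}(t)\ \text{ in } D\times(0,T],\qquad u(x,0)=0\ \text{ in } D,\qquad u=0\ \text{ on }\partial D\times(0,T].$$ Then $$\mathbb{E}\|u\|^{2}_{L^{2}(D\times[0,T])}\le C\|h\|_{L^{\infty}([0,T])}^{2}\|f\|_{L^{2}(D)}^{2}+CT^{2H+1}\|g\|_{L^{2}(D)}^{2},$$ and for $t\in(0,T]$ and $\sigma\in[0,\min(1,\frac{H}{\alpha}-\epsilon)]$, with $\epsilon>0$ arbitrarily small, $$\mathbb{E}\|A^{\sigma s}u(t)\|^{2}_{L^{2}(D)}\le C\|h\|_{L^{\infty}([0,T])}^{2}\|f\|_{L^{2}(D)}^{2}+Ct^{2H-2\sigma\alpha}\|g\|_{L^{2}(D)}^{2}.$$ Here $C>0$ denotes constants independent of $f,g,h$ and $t$.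
   Context: $\{\lambda_{k},\phi_{k}\}_{k\ge1}$ are the nondecreasing eigenvalues and $L^{2}(D)$-normalized (orthonormal) eigenfunctions of $A=-\Delta$ on $D$ with zero Dirichlet boundary condition. For $\rho\ge0$, $A^{\rho}v=\sum_{k\ge1}\lambda_{k}^{\rho}(v,\phi_{k})\phi_{k}$, where $(\cdot,\cdot)$ is the $L^2(D)$ inner product. The Riemann–Liouville derivative is $\partial^{1-\alpha}_{t}u(t)=\frac{1}{\Gamma(\alpha)}\frac{\partial}{\partial t}\int_{0}^{t}(t-r)^{\alpha-1}u(r)\,dr$. $W^{H}$ is a one-dimensional fractional Brownian motion with Hurst index $H$ on a complete probability space (centered Gaussian, $\mathbb{E}[W^{H}(t)W^{H}(r)]=\frac12(t^{2H}+r^{2H}-|t-r|^{2H})$); integrals of deterministic functions against $W^{H}$ are Wiener integrals. With the Mittag-Leffler function $E_{\alpha,\beta}(z)=\sum_{k=0}^{\infty}\frac{z^{k}}{\Gamma(k\alpha+\beta)}$, set $E(t)v=\sum_{k\ge1}E_{\alpha,1}(-\lambda_{k}^{s}t^{\alpha})(v,\phi_{k})\phi_{k}$. The solution of the equation is $$u(x,t)=\int_{0}^{t}E(t-r)h(r)\,dr\,f(x)+\int_{0}^{t}E(t-r)\,dW^{H}(r)\,g(x),$$ i.e. $(u(t),\phi_k)=(f,\phi_k)\int_0^tE_{\alpha,1}(-\lambda_k^s(t-r)^\alpha)h(r)dr+(g,\phi_k)\int_0^tE_{\alpha,1}(-\lambda_k^s(t-r)^\alpha)dW^H(r)$ for all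 $k\ge1$. *)

theory Defs
  imports "HOL-Probability.Probability"
begin

section \<open>Function spaces\<close>

text \<open>Elements of \<open>L\<^sup>2\<close> are represented by functions rather than by classes modulo null sets;
  \<open>L2_norm\<close> and \<open>L2_inner\<close> are only meaningful on \<open>L2\<close>.\<close>

definition L2 :: "'x measure \<Rightarrow> ('x \<Rightarrow> 'b::euclidean_space) set" where
  "L2 \<mu> = {v \<in> borel_measurable \<mu>. integrable \<mu> (\<lambda>x. (norm (v x))\<^sup>2)}"

definition L2_inner :: "'x measure \<Rightarrow> ('x \<Rightarrow> 'b::euclidean_space) \<Rightarrow> ('x \<Rightarrow> 'b) \<Rightarrow> real" where
  "L2_inner \<mu> v w = (\<integral>x. v x \<bullet> w x \<partial>\<mu>)"

definition L2_norm :: "'x measure \<Rightarrow> ('x \<Rightarrow> 'b::euclidean_space) \<Rightarrow> real" where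
  "L2_norm \<mu> v = sqrt (\<integral>x. (norm (v x))\<^sup>2 \<partial>\<mu>)"

definition Linf :: "'x measure \<Rightarrow> ('x \<Rightarrow> real) set" where
  "Linf \<mu> = {h \<in> borel_measurable \<mu>. esssup \<mu> (\<lambda>x. ereal \<bar>h x\<bar>) < \<infinity>}"

definition Linf_norm :: "'x measure \<Rightarrow> ('x \<Rightarrow> real) \<Rightarrow> real" where
  "Linf_norm \<mu> h = real_of_ereal (esssup \<mu> (\<lambda>x. ereal \<bar>h x\<bar>))"


section \<open>The domain and the Dirichlet Laplacian\<close>

text \<open>Near every boundary point, \<open>D\<close> is the part of a ball lying strictly above the graph of a
  Lipschitz function over the hyperplane orthogonal to some unit vector \<open>e\<close>.\<close>

definition bounded_lipschitz_domain :: "'a::euclidean_space set \<Rightarrow> bool" where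
  "bounded_lipschitz_domain D \<longleftrightarrow>
     open D \<and> connected D \<and> D \<noteq> {} \<and> bounded D \<and>
     (\<forall>p\<in>frontier D. \<exists>r>0. \<exists>e. \<exists>\<gamma>. \<exists>L. norm e = 1 \<and> L-lipschitz_on {y. y \<bullet> e = 0} \<gamma> \<and>
        D \<inter> ball p r = {x \<in> ball p r. \<gamma> (x - (x \<bullet> e) *\<^sub>R e) < x \<bullet> e})"

primrec C_k :: "nat \<Rightarrow> ('a::euclidean_space \<Rightarrow> real) \<Rightarrow> bool" where
  "C_k 0 v \<longleftrightarrow> continuous_on UNIV v"
| "C_k (Suc n) v \<longleftrightarrow> (\<forall>x. v differentiable (at x)) \<and>
     (\<forall>b\<in>Basis. C_k n (\<lambda>x. frechet_derivative v (at x) b))"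

definition test_functions :: "'a::euclidean_space set \<Rightarrow> ('a \<Rightarrow> real) set" where
  "test_functions D = {\<psi>. (\<forall>n. C_k n \<psi>) \<and> (\<exists>K. compact K \<and> K \<subseteq> D \<and> (\<forall>x. x \<notin> K \<longrightarrow> \<psi> x = 0))}"

definition grad :: "('a::euclidean_space \<Rightarrow> real) \<Rightarrow> 'a \<Rightarrow> 'a" where
  "grad v x = (\<Sum>b\<in>Basis. frechet_derivative v (at x) b *\<^sub>R b)"

text \<open>\<open>H10_with_grad D v G\<close>: \<open>v\<close> belongs to the closure of the test functions in the Sobolev space
  \<open>H\<^sup>1(D)\<close>, and \<open>G\<close> is its weak gradient.\<close>

definition H10_with_grad ::
    "'a::euclidean_space set \<Rightarrow> ('a \<Rightarrow> real) \<Rightarrow> ('a \<Rightarrow> 'a) \<Rightarrow> bool" where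
  "H10_with_grad D v G \<longleftrightarrow> v \<in> L2 (lebesgue_on D) \<and> G \<in> L2 (lebesgue_on D) \<and>
     (\<exists>\<psi>. (\<forall>n::nat. \<psi> n \<in> test_functions D) \<and>
        (\<lambda>n. L2_norm (lebesgue_on D) (\<lambda>x. \<psi> n x - v x)) \<longlonglongrightarrow> 0 \<and>
        (\<lambda>n. L2_norm (lebesgue_on D) (\<lambda>x. grad (\<psi> n) x - G x)) \<longlonglongrightarrow> 0)"

text \<open>Eigenpairs of \<open>-\<Delta>\<close> with zero Dirichlet boundary condition, in the weak sense.\<close>

definition dirichlet_eigenpair ::
    "'a::euclidean_space set \<Rightarrow> real \<Rightarrow> ('a \<Rightarrow> real) \<Rightarrow> bool" where
  "dirichlet_eigenpair D \<mu> v \<longleftrightarrow> \<not> (AE x in lebesgue_on D. v x = 0) \<and>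
     (\<exists>G. H10_with_grad D v G \<and>
        (\<forall>\<psi>\<in>test_functions D.
           L2_inner (lebesgue_on D) G (grad \<psi>) = \<mu> * L2_inner (lebesgue_on D) v \<psi>))"

text \<open>The last conjunct (completeness in \<open>L\<^sup>2(D)\<close>) says that the sequence exhausts the spectrum,
  eigenvalues being repeated according to multiplicity. Indices start at \<open>0\<close>.\<close>

definition dirichlet_eigensystem ::
    "'a::euclidean_space set \<Rightarrow> (nat \<Rightarrow> real) \<Rightarrow> (nat \<Rightarrow> 'a \<Rightarrow> real) \<Rightarrow> bool" where
  "dirichlet_eigensystem D lam \<phi> \<longleftrightarrow>
     mono lam \<and> (\<forall>k. dirichlet_eigenpair D (lam k) (\<phi> k)) \<and>
     (\<forall>j k. L2_inner (lebesgue_on D) (\<phi> j) (\<phi> k) = (if j = k then 1 else 0)) \<and>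
     (\<forall>v\<in>L2 (lebesgue_on D). (\<forall>k. L2_inner (lebesgue_on D) v (\<phi> k) = 0) \<longrightarrow>
        (AE x in lebesgue_on D. v x = 0))"

text \<open>\<open>has_frac_power D lam \<phi> \<rho> v w\<close>: \<open>v\<close> lies in the domain of \<open>A\<^sup>\<rho>\<close> and \<open>A\<^sup>\<rho> v = w\<close>, the defining
  series being convergent in \<open>L\<^sup>2(D)\<close>. The function \<open>frac_power\<close> is meaningful on that domain only.\<close>

definition has_frac_power :: "'a::euclidean_space set \<Rightarrow> (nat \<Rightarrow> real) \<Rightarrow> (nat \<Rightarrow> 'a \<Rightarrow> real) \<Rightarrow>
    real \<Rightarrow> ('a \<Rightarrow> real) \<Rightarrow> ('a \<Rightarrow> real) \<Rightarrow> bool" where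
  "has_frac_power D lam \<phi> \<rho> v w \<longleftrightarrow> v \<in> L2 (lebesgue_on D) \<and> w \<in> L2 (lebesgue_on D) \<and>
     (\<lambda>n. L2_norm (lebesgue_on D)
        (\<lambda>x. (\<Sum>k<n. lam k powr \<rho> * L2_inner (lebesgue_on D) v (\<phi> k) * \<phi> k x) - w x)) \<longlonglongrightarrow> 0"

definition frac_power_domain :: "'a::euclidean_space set \<Rightarrow> (nat \<Rightarrow> real) \<Rightarrow> (nat \<Rightarrow> 'a \<Rightarrow> real) \<Rightarrow>
    real \<Rightarrow> ('a \<Rightarrow> real) set" where
  "frac_power_domain D lam \<phi> \<rho> = {v. \<exists>w. has_frac_power D lam \<phi> \<rho> v w}"

definition frac_power :: "'a::euclidean_space set \<Rightarrow> (nat \<Rightarrow> real) \<Rightarrow> (nat \<Rightarrow> 'a \<Rightarrow> real) \<Rightarrow>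
    real \<Rightarrow> ('a \<Rightarrow> real) \<Rightarrow> 'a \<Rightarrow> real" where
  "frac_power D lam \<phi> \<rho> v = (SOME w. has_frac_power D lam \<phi> \<rho> v w)"


section \<open>Fractional Brownian motion and Wiener integrals\<close>

definition centered_gaussian :: "'w measure \<Rightarrow> ('w \<Rightarrow> real) \<Rightarrow> bool" where
  "centered_gaussian M X \<longleftrightarrow> X \<in> borel_measurable M \<and>
     ((AE \<omega> in M. X \<omega> = 0) \<or> (\<exists>\<sigma>>0. distributed M lborel X (normal_density 0 \<sigma>)))"

definition fractional_brownian_motion ::
    "'w measure \<Rightarrow> real \<Rightarrow> (real \<Rightarrow> 'w \<Rightarrow> real) \<Rightarrow> bool" where
  "fractional_brownian_motion M H W \<longleftrightarrow>
     (\<forall>F c. finite F \<and> F \<subseteq> {0..} \<longrightarrow> centered_gaussian M (\<lambda>\<omega>. \<Sum>t\<in>F. c t * W t \<omega>)) \<and>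
     (\<forall>t\<ge>0. \<forall>r\<ge>0. (\<integral>\<omega>. W t \<omega> * W r \<omega> \<partial>M) =
        (t powr (2 * H) + r powr (2 * H) - \<bar>t - r\<bar> powr (2 * H)) / 2)"

text \<open>A list entry \<open>(c, a, b)\<close> stands for the summand \<open>c \<cdot> 1\<^bsub>(a, b]\<^esub>\<close> of a step function.\<close>

definition step_fun :: "(real \<times> real \<times> real) list \<Rightarrow> real \<Rightarrow> real" where
  "step_fun ps r = (\<Sum>(c, a, b)\<leftarrow>ps. c * indicator {a<..b} r)"

definition step_integral ::
    "(real \<Rightarrow> 'w \<Rightarrow> real) \<Rightarrow> (real \<times> real \<times> real) list \<Rightarrow> 'w \<Rightarrow> real" where
  "step_integral W ps \<omega> = (\<Sum>(c, a, b)\<leftarrow>ps. c * (W b \<omega> - W a \<omega>))"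

text \<open>The squared norm on deterministic integrands with respect to which step functions are
  completed. For \<open>H \<le> 1/2\<close> it equals the second moment of the Wiener integral. For \<open>H > 1/2\<close> it
  dominates that second moment, \<open>H (2H - 1) \<integral>\<integral> f(x) f(y) |x - y|\<^bsup>2H - 2\<^esup> dx dy\<close>; this is the usual
  norm turning the admissible functions into a Banach space. Integrands on \<open>[0, t]\<close> are extended
  by zero to the whole line, which matters in the case \<open>H < 1/2\<close>.\<close>

definition fbm_norm_sq :: "real \<Rightarrow> (real \<Rightarrow> real) \<Rightarrow> ennreal" where
  "fbm_norm_sq H f =
     (if H < 1/2 then
        ennreal (H * (1 - 2 * H) / 2) *
          (\<integral>\<^sup>+x. \<integral>\<^sup>+y. ennreal ((f x - f y)\<^sup>2 * \<bar>x - y\<bar> powr (2 * H - 2)) \<partial>lborel \<partial>lborel)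
      else if H = 1/2 then (\<integral>\<^sup>+x. ennreal ((f x)\<^sup>2) \<partial>lborel)
      else
        ennreal (H * (2 * H - 1)) *
          (\<integral>\<^sup>+x. \<integral>\<^sup>+y. ennreal (\<bar>f x\<bar> * \<bar>f y\<bar> * \<bar>x - y\<bar> powr (2 * H - 2)) \<partial>lborel \<partial>lborel))"

text \<open>\<open>has_wiener_integral M H W t f Z\<close>: the random variable \<open>Z\<close> is (a version of) the Wiener
  integral \<open>\<integral>\<^sub>0\<^sup>t f(r) dW\<^sup>H(r)\<close>.\<close>

definition has_wiener_integral :: "'w measure \<Rightarrow> real \<Rightarrow> (real \<Rightarrow> 'w \<Rightarrow> real) \<Rightarrow> real \<Rightarrow>
    (real \<Rightarrow> real) \<Rightarrow> ('w \<Rightarrow> real) \<Rightarrow> bool" where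
  "has_wiener_integral M H W t f Z \<longleftrightarrow>
     set_borel_measurable borel {0..t} f \<and> Z \<in> L2 M \<and>
     (\<exists>ps. (\<forall>n::nat. \<forall>(c, a, b)\<in>set (ps n). 0 \<le> a \<and> a \<le> b \<and> b \<le> t) \<and>
        (\<lambda>n. fbm_norm_sq H (\<lambda>r. step_fun (ps n) r - indicator {0..t} r * f r)) \<longlonglongrightarrow> 0 \<and>
        (\<lambda>n. L2_norm M (\<lambda>\<omega>. step_integral W (ps n) \<omega> - Z \<omega>)) \<longlonglongrightarrow> 0)"


section \<open>The mild solution\<close>

definition mittag_leffler :: "real \<Rightarrow> real \<Rightarrow> real \<Rightarrow> real" where
  "mittag_leffler \<alpha> \<beta> z = (\<Sum>k. z ^ k / Gamma (real k * \<alpha> + \<beta>))"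

text \<open>The solution is an \<open>L\<^sup>2(D)\<close>-valued process, \<open>u t \<omega> x\<close> being its value at the time \<open>t\<close> and the
  point \<open>x\<close>, determined by its coefficients with respect to the eigenfunctions.\<close>

definition mild_solution :: "'w measure \<Rightarrow> real \<Rightarrow> (real \<Rightarrow> 'w \<Rightarrow> real) \<Rightarrow>
    'a::euclidean_space set \<Rightarrow> (nat \<Rightarrow> real) \<Rightarrow> (nat \<Rightarrow> 'a \<Rightarrow> real) \<Rightarrow> real \<Rightarrow> real \<Rightarrow> real \<Rightarrow>
    ('a \<Rightarrow> real) \<Rightarrow> ('a \<Rightarrow> real) \<Rightarrow> (real \<Rightarrow> real) \<Rightarrow> (real \<Rightarrow> 'w \<Rightarrow> 'a \<Rightarrow> real) \<Rightarrow> bool" where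
  "mild_solution M H W D lam \<phi> T \<alpha> s f g h u \<longleftrightarrow>
     (\<lambda>(\<omega>, x, t). u t \<omega> x)
        \<in> borel_measurable (M \<Otimes>\<^sub>M (lebesgue_on D \<Otimes>\<^sub>M lebesgue_on {0..T})) \<and>
     (\<forall>t\<in>{0..T}. AE \<omega> in M. u t \<omega> \<in> L2 (lebesgue_on D)) \<and>
     (\<forall>t\<in>{0..T}. \<forall>k. \<exists>Z.
        has_wiener_integral M H W t
          (\<lambda>r. mittag_leffler \<alpha> 1 (- (lam k powr s) * (t - r) powr \<alpha>)) Z \<and>
        (AE \<omega> in M. L2_inner (lebesgue_on D) (u t \<omega>) (\<phi> k) =
           L2_inner (lebesgue_on D) f (\<phi> k) *
             (\<integral>r. mittag_leffler \<alpha> 1 (- (lam k powr s) * (t - r) powr \<alpha>) * h r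
                \<partial>lebesgue_on {0..t}) +
           L2_inner (lebesgue_on D) g (\<phi> k) * Z \<omega>))"

end

theory Submission
  imports Defs
begin

text \<open>The eigenfunctions decouple the equation. The coefficient \<open>u\<^sub>k(t)\<close> of the mild solution is
\<open>f\<^sub>k \<integral>\<^sub>0\<^sup>t e\<^sub>k(t - r) h(r) dr + g\<^sub>k \<integral>\<^sub>0\<^sup>t e\<^sub>k(t - r) dW\<^sup>H(r)\<close>, where
\<open>e\<^sub>k(r) = E\<^sub>\<alpha>(- \<lambda>\<^sub>k\<^sup>s r\<^sup>\<alpha>)\<close> is the relaxation function of the \<open>k\<close>-th mode and \<open>E\<^sub>\<alpha>\<close> stands for the
Mittag-Leffler function with second parameter one. By Parseval's identity, applied to \<open>f\<close> and \<open>g\<close>,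
both estimates follow from bounds, uniform in \<open>k\<close>, for the two integrals weighted by
\<open>\<lambda>\<^sub>k\<^bsup>\<sigma>s\<^esup>\<close>. The uniformity has one source: the weighted function \<open>p = \<lambda>\<^sub>k\<^bsup>\<sigma>s\<^esup> e\<^sub>k\<close> satisfies
\<open>p(r) \<le> K r\<^bsup>-\<sigma>\<alpha>\<^esup>\<close> and \<open>0 \<le> p(y) - p(x) \<le> K y\<^bsup>-\<sigma>\<alpha>\<^esup> (x - y) / y\<close> for \<open>y < x\<close>, with the same \<open>K\<close> for
all eigenvalues (\<open>weighted_relax_bounds\<close>).

These two bounds express that \<open>x \<mapsto> E\<^sub>\<alpha>(- x)\<close> is nonnegative and decreasing, that it is
\<open>O(1 / (1 + x))\<close>, and that it varies slowly on the scale of its argument. None of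
this is visible in the alternating power series. It is read off from a representation as a limit of Laplace transforms: if \<open>K\<^sub>n\<close> is the number of tables in a Chinese
restaurant process of index \<open>\<alpha>\<close>, its rising factorial moments are explicit products, they scale like
\<open>n\<^bsup>\<alpha>j\<^esup> j! / \<Gamma>(\<alpha>j + 1)\<close>, and therefore the expectation of \<open>(1 + x / n\<^sup>\<alpha>)\<^bsup>-K\<^sub>n\<^esup>\<close> converges to
\<open>E\<^sub>\<alpha>(- x)\<close> (\<open>crp_laplace_limit\<close>). Inequalities for the functions \<open>y \<mapsto> (1 + y)\<^bsup>-k\<^esup>\<close> whose
constants do not depend on \<open>k\<close> pass to the limit. The decay is then a consequence of monotonicity and
of the integral equation of fractional relaxation (\<open>mittag_leffler_neg_decay\<close>).

On the stochastic side, the second moment of the Wiener integral of a function bounded by one is at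
most four times \<open>fbm_norm_sq\<close> of that function (\<open>wiener_integral_second_moment\<close>). For step functions this is a
comparison of two quadratic forms; by polarisation it is enough to know both on single intervals,
where each equals \<open>(b - a)\<^bsup>2H\<^esup>\<close>. What remains is to estimate \<open>fbm_norm_sq\<close> of a kernel that obeys the
two bounds above (\<open>fbm_norm_sq_singular\<close>). Scaling gives the power \<open>t\<^bsup>2H - 2\<sigma>\<alpha>\<^esup>\<close>, and the integrals
converge at the origin because \<open>\<sigma>\<alpha> < H\<close>, which is what the condition \<open>\<sigma> \<le> H / \<alpha> - \<epsilon>\<close> is for. For
\<open>H < 1/2\<close> the increment bound is what makes the integral converge on the diagonal.

Finally, the summability of the weighted squared coefficients is turned into membership in the
domain of \<open>A\<^bsup>\<sigma>s\<^esup>\<close> by the Riesz-Fischer theorem, and the space-time estimate is the case of weight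
one integrated over time by Tonelli's theorem.\<close>


section \<open>The Mittag-Leffler function on the negative half-line\<close>

text \<open>The Chinese restaurant process of index \<open>\<alpha>\<close>: when \<open>n + 1\<close> customers occupy \<open>k\<close> tables, the next
one opens a new table with probability \<open>\<alpha> k / (n + 1)\<close>. The value is the expectation of \<open>\<psi>(K)\<close>
for the number \<open>K\<close> of tables of \<open>n + 1\<close> customers. The recursion is the backward equation; it
presents the law of \<open>K\<close> as a positive functional, so that no probability space has to be built.\<close>

primrec crp_expectation :: "real \<Rightarrow> nat \<Rightarrow> (nat \<Rightarrow> real) \<Rightarrow> real" where
  "crp_expectation \<alpha> 0 \<psi> = \<psi> 1"
| "crp_expectation \<alpha> (Suc n) \<psi> =
     crp_expectation \<alpha> n (\<lambda>k. \<psi> k + \<alpha> * real k / real (Suc n) * (\<psi> (Suc k) - \<psi> k))"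

lemma crp_expectation_linear:
  "crp_expectation \<alpha> n (\<lambda>k. a * \<psi> k + b * \<eta> k) = a * crp_expectation \<alpha> n \<psi> + b * crp_expectation \<alpha> n \<eta>"
proof (induction n arbitrary: \<psi> \<eta>)
  case (Suc n)
  have mix: "(a * x + b * y) + q * ((a * x' + b * y') - (a * x + b * y)) =
      a * (x + q * (x' - x)) + b * (y + q * (y' - y))" for q x y x' y' :: real
    by (simp add: algebra_simps)
  have step: "(\<lambda>k. (a * \<psi> k + b * \<eta> k) + \<alpha> * real k / real (Suc n) * ((a * \<psi> (Suc k) + b * \<eta> (Suc k)) - (a * \<psi> k + b * \<eta> k))) =
      (\<lambda>k. a * (\<psi> k + \<alpha> * real k / real (Suc n) * (\<psi> (Suc k) - \<psi> k))
         + b * (\<eta> k + \<alpha> * real k / real (Suc n) * (\<eta> (Suc k) - \<eta> k)))"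
    by (simp only: mix)
  show ?case
    unfolding crp_expectation.simps(2) step by (rule Suc.IH)
qed simp

lemma crp_expectation_sum:
  fixes J :: nat
  shows "crp_expectation \<alpha> n (\<lambda>k. \<Sum>j<J. c j * \<psi> j k) = (\<Sum>j<J. c j * crp_expectation \<alpha> n (\<psi> j))"
proof (induction J)
  case 0
  show ?case using crp_expectation_linear[of \<alpha> n 0 "\<lambda>_. 0" 0 "\<lambda>_. 0"] by simp
next
  case (Suc J)
  show ?case using crp_expectation_linear[of \<alpha> n 1 "\<lambda>k. \<Sum>j<J. c j * \<psi> j k" "c J" "\<psi> J"] Suc by simp
qed

text \<open>At most \<open>n + 1\<close> tables are occupied, and it is in this range that \<open>\<alpha> k / (n + 1)\<close> is a
probability. This is why positivity of \<open>\<psi>\<close> is asked for there only: the function passed to the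
induction hypothesis is positive only there.\<close>

lemma crp_expectation_nonneg:
  assumes "0 \<le> \<alpha>" "\<alpha> \<le> 1" and "\<And>k. 1 \<le> k \<Longrightarrow> k \<le> Suc n \<Longrightarrow> 0 \<le> \<psi> k"
  shows "0 \<le> crp_expectation \<alpha> n \<psi>"
  using assms(3)
proof (induction n arbitrary: \<psi>)
  case (Suc n)
  have "0 \<le> \<psi> k + \<alpha> * real k / real (Suc n) * (\<psi> (Suc k) - \<psi> k)" if k: "1 \<le> k" "k \<le> Suc n" for k
  proof -
    define q where "q = \<alpha> * real k / real (Suc n)"
    have "\<alpha> * real k \<le> 1 * real (Suc n)"
      using assms k by (intro mult_mono) auto
    then have q: "0 \<le> q" "q \<le> 1"
      using assms by (auto simp: q_def divide_simps)
    have "0 \<le> (1 - q) * \<psi> k + q * \<psi> (Suc k)"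
      using q Suc.prems k by (intro add_nonneg_nonneg mult_nonneg_nonneg) auto
    then show ?thesis unfolding q_def[symmetric] by (simp add: algebra_simps)
  qed
  then show ?case by (auto intro: Suc.IH)
qed simp

lemma crp_expectation_mono:
  assumes "0 \<le> \<alpha>" "\<alpha> \<le> 1" and "\<And>k. 1 \<le> k \<Longrightarrow> \<psi> k \<le> \<eta> k"
  shows "crp_expectation \<alpha> n \<psi> \<le> crp_expectation \<alpha> n \<eta>"
proof -
  have "0 \<le> crp_expectation \<alpha> n (\<lambda>k. 1 * \<eta> k + (-1) * \<psi> k)"
    using assms by (intro crp_expectation_nonneg) auto
  then show ?thesis by (simp only: crp_expectation_linear)
qed

text \<open>With \<open>\<phi>(k) = k (k + 1) \<cdots> (k + j - 1)\<close> one has \<open>k (\<phi>(k + 1) - \<phi>(k)) = j \<phi>(k)\<close>. Rising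
factorials are thus eigenfunctions of every step of the process, and each step multiplies the
moment by \<open>1 + \<alpha> j / (n + 1)\<close>.\<close>

lemma crp_expectation_rising_factorial:
  "crp_expectation \<alpha> n (\<lambda>k. pochhammer (real k) j / fact j) = pochhammer (1 + \<alpha> * real j) n / fact n"
proof (induction n)
  case 0
  then show ?case by (simp add: pochhammer_fact[symmetric])
next
  case (Suc n)
  have rise: "real k * (pochhammer (real (Suc k)) j - pochhammer (real k) j) = real j * pochhammer (real k) j" for k
    using pochhammer_rec[of "real k" j] pochhammer_rec'[of "real k" j] by (simp add: algebra_simps)
  have "(\<lambda>k. pochhammer (real k) j / fact j + \<alpha> * real k / real (Suc n) *
          (pochhammer (real (Suc k)) j / fact j - pochhammer (real k) j / fact j)) =
        (\<lambda>k. (1 + \<alpha> * real j / real (Suc n)) * (pochhammer (real k) j / fact j) + 0 * 0)"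
  proof
    fix k
    have "\<alpha> * real k / real (Suc n) * (pochhammer (real (Suc k)) j / fact j - pochhammer (real k) j / fact j)
       = \<alpha> / real (Suc n) * (real k * (pochhammer (real (Suc k)) j - pochhammer (real k) j)) / fact j"
      by (simp add: diff_divide_distrib right_diff_distrib)
    then show "pochhammer (real k) j / fact j + \<alpha> * real k / real (Suc n) *
          (pochhammer (real (Suc k)) j / fact j - pochhammer (real k) j / fact j) =
        (1 + \<alpha> * real j / real (Suc n)) * (pochhammer (real k) j / fact j) + 0 * 0"
      unfolding rise by (simp add: algebra_simps)
  qed
  then have "crp_expectation \<alpha> (Suc n) (\<lambda>k. pochhammer (real k) j / fact j) =
      (1 + \<alpha> * real j / real (Suc n)) * (pochhammer (1 + \<alpha> * real j) n / fact n)"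
    by (simp only: crp_expectation.simps crp_expectation_linear Suc.IH)
  also have "\<dots> = pochhammer (1 + \<alpha> * real j) (Suc n) / fact (Suc n)"
    by (simp add: pochhammer_rec' divide_simps)
  finally show ?case .
qed

text \<open>The remainder of order \<open>J\<close> in the binomial expansion of \<open>(1 + y)\<^bsup>-k\<^esup>\<close>, with the sign for which it is
nonnegative.\<close>

definition neg_binomial_remainder :: "real \<Rightarrow> nat \<Rightarrow> nat \<Rightarrow> real" where
  "neg_binomial_remainder y J k =
     (-1) ^ J * (1 / (1 + y) ^ k - (\<Sum>j<J. (- y) ^ j * (pochhammer (real k) j / fact j)))"

text \<open>Pascal's rule for the coefficients, together with \<open>(1 + y)\<^bsup>-k-1\<^esup> = (1 + y)\<^bsup>-k\<^esup> - y (1 + y)\<^bsup>-k-1\<^esup>\<close>. All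
coefficients on the right are nonnegative, so positivity propagates in both indices.\<close>

lemma neg_binomial_remainder_Suc:
  assumes "0 \<le> y"
  shows "neg_binomial_remainder y (Suc J) (Suc k) =
    neg_binomial_remainder y (Suc J) k + y * neg_binomial_remainder y J (Suc k)"
proof -
  let ?\<phi> = "\<lambda>j k. pochhammer (real k) j / fact j :: real"
  have pascal: "?\<phi> (Suc j) (Suc k) = ?\<phi> (Suc j) k + ?\<phi> j (Suc k)" for j
  proof -
    have "pochhammer (real (Suc k)) (Suc j) = (real k + real j + 1) * pochhammer (real k + 1) j"
      by (simp add: pochhammer_rec' add_ac)
    moreover have "pochhammer (real k) (Suc j) = real k * pochhammer (real k + 1) j"
      by (simp add: pochhammer_rec)
    ultimately show ?thesis
      by (simp add: divide_simps add_ac) (simp add: algebra_simps)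
  qed
  have "(\<Sum>j<Suc J. (- y) ^ j * ?\<phi> j (Suc k)) = 1 + (\<Sum>j<J. (- y) ^ Suc j * ?\<phi> (Suc j) (Suc k))"
    by (subst sum.lessThan_Suc_shift) simp
  also have "\<dots> = 1 + (\<Sum>j<J. (- y) ^ Suc j * ?\<phi> (Suc j) k) + (\<Sum>j<J. (- y) ^ Suc j * ?\<phi> j (Suc k))"
    unfolding pascal by (simp only: distrib_left sum.distrib)
  also have "1 + (\<Sum>j<J. (- y) ^ Suc j * ?\<phi> (Suc j) k) = (\<Sum>j<Suc J. (- y) ^ j * ?\<phi> j k)"
    by (subst sum.lessThan_Suc_shift) simp
  also have "(\<Sum>j<J. (- y) ^ Suc j * ?\<phi> j (Suc k)) = - y * (\<Sum>j<J. (- y) ^ j * ?\<phi> j (Suc k))"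
    by (simp add: sum_distrib_left mult.assoc sum_negf)
  finally have T: "(\<Sum>j<Suc J. (- y) ^ j * ?\<phi> j (Suc k)) =
      (\<Sum>j<Suc J. (- y) ^ j * ?\<phi> j k) - y * (\<Sum>j<J. (- y) ^ j * ?\<phi> j (Suc k))" by simp
  have f: "1 / (1 + y) ^ Suc k = 1 / (1 + y) ^ k - y * (1 / (1 + y) ^ Suc k)"
  proof -
    have "(1 + y) * (1 / (1 + y) ^ Suc k) = 1 / (1 + y) ^ k" using assms by simp
    then show ?thesis by (simp only: distrib_right mult_1 eq_diff_eq)
  qed
  show ?thesis
    unfolding neg_binomial_remainder_def T
    by (subst f) (simp add: algebra_simps)
qed

lemma neg_binomial_remainder_nonneg:
  assumes "0 \<le> y"
  shows "0 \<le> neg_binomial_remainder y J k"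
proof (induction k arbitrary: J)
  case 0
  show ?case
  proof (cases J)
    case (Suc J')
    have "(\<Sum>j<Suc J'. (- y) ^ j * (pochhammer (real 0) j / fact j)) = 1"
      by (subst sum.lessThan_Suc_shift) (simp add: pochhammer_0_left)
    then show ?thesis by (simp add: neg_binomial_remainder_def Suc del: sum.lessThan_Suc)
  qed (simp add: neg_binomial_remainder_def)
next
  case (Suc k)
  show ?case
  proof (induction J)
    case 0
    show ?case using assms by (simp add: neg_binomial_remainder_def)
  next
    case (Suc J)
    show ?case unfolding neg_binomial_remainder_Suc[OF assms]
      using Suc \<open>\<And>J. 0 \<le> neg_binomial_remainder y J k\<close> assms by simp
  qed
qed

text \<open>Two consecutive remainders add up to the term between them, and both are nonnegative. The bound
holds for all \<open>y \<ge> 0\<close>, also where the binomial series diverges.\<close>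

lemma neg_binomial_taylor_bound:
  assumes "0 \<le> y"
  shows "\<bar>1 / (1 + y) ^ k - (\<Sum>j<J. (- y) ^ j * (pochhammer (real k) j / fact j))\<bar>
    \<le> y ^ J * (pochhammer (real k) J / fact J)"
proof -
  have "neg_binomial_remainder y (Suc J) k =
      y ^ J * (pochhammer (real k) J / fact J) - neg_binomial_remainder y J k"
  proof -
    have "(-1) ^ J * (- y) ^ J = y ^ J" by (simp add: power_mult_distrib[symmetric])
    then have sign: "(-1) ^ J * ((- y) ^ J * p) = y ^ J * p" for p
      by (simp only: mult.assoc[symmetric])
    have "(-1 * s) * (f - (t + a * p)) = s * (a * p) - s * (f - t)" for s f t a p :: real
      by (simp add: algebra_simps)
    then show ?thesis
      unfolding neg_binomial_remainder_def sum.lessThan_Suc power_Suc by (simp only: sign)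
  qed
  then have "neg_binomial_remainder y J k \<le> y ^ J * (pochhammer (real k) J / fact J)"
    using neg_binomial_remainder_nonneg[OF assms, of "Suc J" k] by simp
  moreover have "\<bar>1 / (1 + y) ^ k - (\<Sum>j<J. (- y) ^ j * (pochhammer (real k) j / fact j))\<bar> =
      \<bar>neg_binomial_remainder y J k\<bar>"
    by (simp add: neg_binomial_remainder_def abs_mult power_abs)
  ultimately show ?thesis
    using neg_binomial_remainder_nonneg[OF assms, of J k] by simp
qed

text \<open>The number of tables grows like \<open>n\<^sup>\<alpha>\<close>. The function \<open>(1 + x / n\<^sup>\<alpha>)\<^bsup>-k\<^esup>\<close> plays the part of
\<open>exp(- x k / n\<^sup>\<alpha>)\<close>; unlike the exponential, its expansion contains the rising factorials of \<open>k\<close>,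
whose expectations are known exactly.\<close>

definition crp_laplace :: "real \<Rightarrow> nat \<Rightarrow> real \<Rightarrow> real" where
  "crp_laplace \<alpha> n x = crp_expectation \<alpha> n (\<lambda>k. 1 / (1 + x / real n powr \<alpha>) ^ k)"

lemma crp_laplace_taylor_bound:
  assumes "0 \<le> \<alpha>" "\<alpha> \<le> 1" "0 \<le> x"
  defines "m \<equiv> \<lambda>n j. pochhammer (1 + \<alpha> * real j) n / fact n / real n powr (\<alpha> * real j)"
  assumes "0 < n"
  shows "\<bar>crp_laplace \<alpha> n x - (\<Sum>j<J. (- x) ^ j * m n j)\<bar> \<le> x ^ J * m n J"
proof -
  define y where "y = x / real n powr \<alpha>"
  have y: "0 \<le> y" using assms by (simp add: y_def)
  let ?f = "\<lambda>k. 1 / (1 + y) ^ k" and ?\<phi> = "\<lambda>j k. pochhammer (real k) j / fact j :: real"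
  have pw: "real n powr (\<alpha> * real j) = (real n powr \<alpha>) ^ j" for j
    using assms by (simp add: powr_powr[symmetric] powr_realpow)
  have ym: "y ^ j * (pochhammer (1 + \<alpha> * real j) n / fact n) = x ^ j * m n j" for j
    by (simp add: y_def m_def pw power_divide)
  have ym': "(- y) ^ j * (pochhammer (1 + \<alpha> * real j) n / fact n) = (- x) ^ j * m n j" for j
    by (simp only: power_minus[of y] power_minus[of x] mult.assoc ym)
  have diff: "crp_laplace \<alpha> n x - (\<Sum>j<J. (- x) ^ j * m n j) =
      crp_expectation \<alpha> n (\<lambda>k. 1 * ?f k + (-1) * (\<Sum>j<J. (- y) ^ j * ?\<phi> j k))"
    unfolding crp_expectation_linear crp_expectation_sum crp_expectation_rising_factorial ym' crp_laplace_def y_def[symmetric] by simp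
  have top: "x ^ J * m n J = crp_expectation \<alpha> n (\<lambda>k. y ^ J * ?\<phi> J k + 0 * 0)"
    unfolding crp_expectation_linear crp_expectation_rising_factorial ym by simp
  have "\<bar>1 * ?f k + (-1) * (\<Sum>j<J. (- y) ^ j * ?\<phi> j k)\<bar> \<le> y ^ J * ?\<phi> J k" for k
    using neg_binomial_taylor_bound[OF y, of k J] by simp
  then have b: "- (y ^ J * ?\<phi> J k) \<le> 1 * ?f k + (-1) * (\<Sum>j<J. (- y) ^ j * ?\<phi> j k)"
      "1 * ?f k + (-1) * (\<Sum>j<J. (- y) ^ j * ?\<phi> j k) \<le> y ^ J * ?\<phi> J k" for k
    by (simp_all only: abs_le_iff minus_le_iff)
  have "crp_expectation \<alpha> n (\<lambda>k. 1 * ?f k + (-1) * (\<Sum>j<J. (- y) ^ j * ?\<phi> j k)) \<le> x ^ J * m n J"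
    unfolding top using b(2) assms by (intro crp_expectation_mono) simp_all
  moreover have "- (x ^ J * m n J) = crp_expectation \<alpha> n (\<lambda>k. (- 1) * (y ^ J * ?\<phi> J k + 0 * 0) + 0 * 0)"
    by (simp only: crp_expectation_linear top) simp
  moreover have "\<dots> \<le> crp_expectation \<alpha> n (\<lambda>k. 1 * ?f k + (-1) * (\<Sum>j<J. (- y) ^ j * ?\<phi> j k))"
    using b(1) assms by (intro crp_expectation_mono) simp_all
  ultimately show ?thesis unfolding diff by (simp add: abs_le_iff minus_le_iff)
qed

text \<open>This is Gauss's product formula for \<open>\<Gamma>\<close> at the point \<open>1 + \<alpha> j\<close>.\<close>

lemma crp_moment_limit:
  assumes "0 \<le> \<alpha>"
  shows "(\<lambda>n. pochhammer (1 + \<alpha> * real j) n / fact n / real n powr (\<alpha> * real j))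
    \<longlonglongrightarrow> 1 / Gamma (real j * \<alpha> + 1)"
proof -
  let ?z = "1 + \<alpha> * real j"
  have z: "?z > 0" using assms by (simp add: add_pos_nonneg)
  have "(\<lambda>n. 1 / Gamma_series' ?z n) \<longlonglongrightarrow> 1 / Gamma ?z"
    using Gamma_series'_LIMSEQ[of ?z] Gamma_real_pos[OF z] by (intro tendsto_divide) auto
  moreover have "\<forall>\<^sub>F n in sequentially. 1 / Gamma_series' ?z n =
      pochhammer (1 + \<alpha> * real j) n / fact n / real n powr (\<alpha> * real j)"
    using eventually_gt_at_top[of 0]
  proof eventually_elim
    case (elim n)
    have "exp (?z * ln (real n)) = real n * real n powr (\<alpha> * real j)"
      using elim by (simp add: powr_def exp_add algebra_simps)
    moreover have "fact n = real n * fact (n - 1)"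
      using elim by (simp add: fact_reduce)
    ultimately show ?case by (simp add: Gamma_series'_def)
  qed
  ultimately show ?thesis
    using tendsto_cong[of _ "\<lambda>n. 1 / Gamma_series' ?z n"] by (simp add: tendsto_cong add.commute mult.commute)
qed

text \<open>Euler's integral for \<open>\<Gamma>\<close>, restricted to the interval from \<open>A\<close> to \<open>A + 1\<close>. As \<open>A\<close> is arbitrary, the
coefficients of the Mittag-Leffler series decay faster than any geometric sequence.\<close>

lemma inverse_Gamma_bound:
  assumes "0 < \<alpha>" "0 < A"
  shows "1 / Gamma (real k * \<alpha> + 1) \<le> exp (A + 1) * (1 / A powr \<alpha>) ^ k"
proof -
  let ?z = "real k * \<alpha> + 1"
  have z: "?z > 0" using assms by (simp add: add_nonneg_pos)
  have full: "((\<lambda>t. t powr (?z - 1) / exp t) has_integral Gamma ?z) {0..}"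
    by (rule Gamma_integral_real[OF z])
  have part: "((\<lambda>t. indicator {A..A+1} t * (A powr (?z - 1) / exp (A + 1))) has_integral (A powr (?z - 1) / exp (A + 1))) {0..}"
  proof -
    have "((\<lambda>t. A powr (?z - 1) / exp (A + 1)) has_integral (A powr (?z - 1) / exp (A + 1))) {A..A+1}"
      using has_integral_const_real[of "A powr (?z - 1) / exp (A + 1)" A "A + 1"] by simp
    then have "((\<lambda>t. if t \<in> {A..A+1} then A powr (?z - 1) / exp (A + 1) else 0) has_integral (A powr (?z - 1) / exp (A + 1))) {0..}"
      using assms by (subst has_integral_restrict) auto
    moreover have "(\<lambda>t. if t \<in> {A..A+1} then A powr (?z - 1) / exp (A + 1) else 0) =
        (\<lambda>t. indicator {A..A+1} t * (A powr (?z - 1) / exp (A + 1)))"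
      by (auto simp: fun_eq_iff indicator_def)
    ultimately show ?thesis by simp
  qed
  have le: "indicator {A..A+1} t * (A powr (?z - 1) / exp (A + 1)) \<le> t powr (?z - 1) / exp t" for t
    using assms by (auto simp: indicator_def intro!: frac_le powr_mono2)
  have "A powr (?z - 1) / exp (A + 1) \<le> Gamma ?z"
    by (rule has_integral_le[OF part full le])
  moreover have "A powr (?z - 1) = (A powr \<alpha>) ^ k"
    using assms by (simp add: powr_powr[symmetric] powr_realpow mult.commute[of "real k"])
  ultimately have "(A powr \<alpha>) ^ k / exp (A + 1) \<le> Gamma ?z" by simp
  then have "1 / Gamma ?z \<le> 1 / ((A powr \<alpha>) ^ k / exp (A + 1))"
    using assms by (intro divide_left_mono mult_pos_pos Gamma_real_pos z) auto
  then show ?thesis by (simp add: power_divide)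
qed

lemma mittag_leffler_summable:
  assumes "0 < \<alpha>"
  shows "summable (\<lambda>k. \<bar>x\<bar> ^ k / Gamma (real k * \<alpha> + 1))"
proof -
  \<comment> \<open>chosen such that the ratio of the dominating geometric series is at most \<open>1/2\<close>\<close>
  define A where "A = (2 * (\<bar>x\<bar> + 1)) powr (1 / \<alpha>)"
  have A: "A > 0" "A powr \<alpha> = 2 * (\<bar>x\<bar> + 1)"
    using assms by (auto simp: A_def powr_powr)
  show ?thesis
  proof (rule summable_comparison_test'[where N = 0])
    show "summable (\<lambda>k. exp (A + 1) * (1 / 2 :: real) ^ k)"
      by (intro summable_mult summable_geometric) simp
    fix k :: nat
    have pos: "Gamma (real k * \<alpha> + 1) > 0" using assms by (simp add: add_nonneg_pos)
    have "\<bar>x\<bar> ^ k / Gamma (real k * \<alpha> + 1) \<le> \<bar>x\<bar> ^ k * (exp (A + 1) * (1 / A powr \<alpha>) ^ k)"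
      using mult_left_mono[OF inverse_Gamma_bound[OF assms A(1), of k], of "\<bar>x\<bar> ^ k"] by simp
    also have "\<dots> = exp (A + 1) * (\<bar>x\<bar> * (1 / A powr \<alpha>)) ^ k"
      by (simp add: power_mult_distrib power_divide)
    also have "\<dots> \<le> exp (A + 1) * (1 / 2) ^ k"
      by (intro mult_left_mono power_mono) (auto simp: A(2) divide_simps)
    finally show "norm (\<bar>x\<bar> ^ k / Gamma (real k * \<alpha> + 1)) \<le> exp (A + 1) * (1 / 2) ^ k"
      using pos by simp
  qed
qed

lemma mittag_leffler_sums:
  assumes "0 < \<alpha>"
  shows "(\<lambda>k. x ^ k / Gamma (real k * \<alpha> + 1)) sums mittag_leffler \<alpha> 1 x"
proof -
  have pos: "Gamma (real k * \<alpha> + 1) > 0" for k using assms by (simp add: add_nonneg_pos)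
  have "summable (\<lambda>k. x ^ k / Gamma (real k * \<alpha> + 1))"
    using mittag_leffler_summable[OF assms, of x] pos
    by (intro summable_norm_cancel[where f = "\<lambda>k. x ^ k / Gamma (real k * \<alpha> + 1)"]) (simp add: power_abs less_imp_le)
  then show ?thesis unfolding mittag_leffler_def by (rule summable_sums)
qed

lemma mittag_leffler_0: "mittag_leffler \<alpha> 1 0 = 1"
proof -
  have "(\<lambda>k. 0 ^ k / Gamma (real k * \<alpha> + 1)) sums (0 ^ 0 / Gamma (real 0 * \<alpha> + 1))"
    by (rule sums_If_finite_set[of "{0}", THEN sums_cong[THEN iffD1, rotated], simplified]) auto
  then show ?thesis unfolding mittag_leffler_def by (simp add: sums_iff)
qed

text \<open>The truncation order \<open>J\<close> is fixed before \<open>n\<close> tends to infinity. Then the Taylor sum and its error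
bound both converge, and the limit of the error bound is a term of a convergent series, hence
small if \<open>J\<close> was chosen large.\<close>

lemma crp_laplace_limit:
  assumes "0 < \<alpha>" "\<alpha> \<le> 1" "0 \<le> x"
  shows "(\<lambda>n. crp_laplace \<alpha> n x) \<longlonglongrightarrow> mittag_leffler \<alpha> 1 (- x)"
proof (rule LIMSEQ_I)
  fix \<epsilon> :: real assume "0 < \<epsilon>"
  define e where "e = \<epsilon> / 4"
  have e: "e > 0" using \<open>0 < \<epsilon>\<close> by (simp add: e_def)
  let ?m = "\<lambda>n j. pochhammer (1 + \<alpha> * real j) n / fact n / real n powr (\<alpha> * real j)"
  let ?c = "\<lambda>j. 1 / Gamma (real j * \<alpha> + 1)"
  have lim: "(\<lambda>n. ?m n j) \<longlonglongrightarrow> ?c j" for j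
    using crp_moment_limit[of \<alpha> j] assms by simp
  have "(\<lambda>J. \<Sum>j<J. (- x) ^ j * ?c j) \<longlonglongrightarrow> mittag_leffler \<alpha> 1 (- x)"
    using mittag_leffler_sums[OF assms(1), of "- x"] by (simp add: sums_def)
  moreover have "(\<lambda>J. x ^ J * ?c J) \<longlonglongrightarrow> 0"
    using summable_LIMSEQ_zero[OF mittag_leffler_summable[OF assms(1), of x]] assms by simp
  ultimately have "\<forall>\<^sub>F J in sequentially. \<bar>(\<Sum>j<J. (- x) ^ j * ?c j) - mittag_leffler \<alpha> 1 (- x)\<bar> < e \<and>
      x ^ J * ?c J < e"
    using e order_tendstoD(2)[of "\<lambda>J. x ^ J * ?c J" 0 sequentially e]
    by (intro eventually_conj) (auto simp: tendsto_iff dist_real_def)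
  then obtain J where J: "\<bar>(\<Sum>j<J. (- x) ^ j * ?c j) - mittag_leffler \<alpha> 1 (- x)\<bar> < e" "x ^ J * ?c J < e"
    unfolding eventually_sequentially by blast
  have "(\<lambda>n. \<Sum>j<J. (- x) ^ j * ?m n j) \<longlonglongrightarrow> (\<Sum>j<J. (- x) ^ j * ?c j)"
    by (intro tendsto_intros lim)
  moreover have "(\<lambda>n. x ^ J * ?m n J) \<longlonglongrightarrow> x ^ J * ?c J"
    by (intro tendsto_intros lim)
  ultimately have "\<forall>\<^sub>F n in sequentially. \<bar>(\<Sum>j<J. (- x) ^ j * ?m n j) - (\<Sum>j<J. (- x) ^ j * ?c j)\<bar> < e \<and>
      x ^ J * ?m n J < e \<and> 0 < n"
    using e J(2) order_tendstoD(2)[of "\<lambda>n. x ^ J * ?m n J" "x ^ J * ?c J" sequentially e]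
    by (intro eventually_conj eventually_gt_at_top) (auto simp: tendsto_iff dist_real_def)
  then obtain N where N: "\<And>n. n \<ge> N \<Longrightarrow> \<bar>(\<Sum>j<J. (- x) ^ j * ?m n j) - (\<Sum>j<J. (- x) ^ j * ?c j)\<bar> < e \<and>
      x ^ J * ?m n J < e \<and> 0 < n"
    unfolding eventually_sequentially by blast
  have "\<bar>crp_laplace \<alpha> n x - mittag_leffler \<alpha> 1 (- x)\<bar> < \<epsilon>" if "n \<ge> N" for n
  proof -
    have "\<bar>crp_laplace \<alpha> n x - (\<Sum>j<J. (- x) ^ j * ?m n j)\<bar> \<le> x ^ J * ?m n J"
      using crp_laplace_taylor_bound[of \<alpha> x n J] assms N[OF that] by simp
    then show ?thesis using N[OF that] J(1) unfolding e_def by linarith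
  qed
  then show "\<exists>N. \<forall>n\<ge>N. norm (crp_laplace \<alpha> n x - mittag_leffler \<alpha> 1 (- x)) < \<epsilon>"
    by auto
qed

lemma mittag_leffler_neg_nonneg:
  assumes "0 < \<alpha>" "\<alpha> \<le> 1" "0 \<le> x"
  shows "0 \<le> mittag_leffler \<alpha> 1 (- x)"
  using assms by (intro tendsto_lowerbound[OF crp_laplace_limit[OF assms]])
    (auto simp: crp_laplace_def intro!: always_eventually crp_expectation_nonneg)

lemma mittag_leffler_neg_antimono:
  assumes "0 < \<alpha>" "\<alpha> \<le> 1" "0 \<le> x" "x \<le> y"
  shows "mittag_leffler \<alpha> 1 (- y) \<le> mittag_leffler \<alpha> 1 (- x)"
proof (rule LIMSEQ_le)
  show "(\<lambda>n. crp_laplace \<alpha> n y) \<longlonglongrightarrow> mittag_leffler \<alpha> 1 (- y)"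
    "(\<lambda>n. crp_laplace \<alpha> n x) \<longlonglongrightarrow> mittag_leffler \<alpha> 1 (- x)"
    using assms by (auto intro!: crp_laplace_limit)
  show "\<exists>N. \<forall>n\<ge>N. crp_laplace \<alpha> n y \<le> crp_laplace \<alpha> n x"
    unfolding crp_laplace_def using assms
    by (auto intro!: exI[of _ 0] crp_expectation_mono divide_left_mono power_mono divide_right_mono mult_pos_pos zero_less_power add_pos_nonneg)
qed

text \<open>A form of convexity that is invariant under scaling of the argument and has a constant independent
of \<open>k\<close>. The difference of the powers is at most \<open>(X - Y) k (1 + Y)\<^bsup>-k-1\<^esup>\<close>; passing from
\<open>1 + Y\<close> to \<open>1 + Y / 2\<close> gains a factor that is exponential in \<open>k\<close> and absorbs \<open>k Y\<close> by Bernoulli's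
inequality.\<close>

lemma inverse_power_relative_lipschitz:
  fixes X Y :: real
  assumes "0 \<le> Y" "Y \<le> X"
  shows "Y * (1 / (1 + Y) ^ k - 1 / (1 + X) ^ k) \<le> 2 * (X - Y) * (1 / (1 + Y / 2) ^ k)"
proof (cases k)
  case (Suc n)
  define a b where "a = 1 / (1 + Y)" and "b = 1 / (1 + X)"
  have ab: "0 < a" "0 < b" "b \<le> a" using assms by (auto simp: a_def b_def frac_le)
  have diff: "a - b \<le> (X - Y) * a\<^sup>2"
  proof -
    have "a - b = (X - Y) * (a * b)" using assms by (simp add: a_def b_def divide_simps)
    also have "\<dots> \<le> (X - Y) * (a * a)" using assms ab by (intro mult_left_mono) auto
    finally show ?thesis by (simp add: power2_eq_square)
  qed
  have "a ^ k - b ^ k = (a - b) * (\<Sum>i<k. b ^ (k - Suc i) * a ^ i)"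
    by (rule power_diff_sumr2)
  also have "\<dots> \<le> (a - b) * (\<Sum>i<k. a ^ n)"
  proof (intro mult_left_mono sum_mono)
    fix i assume "i \<in> {..<k}"
    then have "a ^ n = a ^ (k - Suc i) * a ^ i" using Suc by (simp add: power_add[symmetric])
    then show "b ^ (k - Suc i) * a ^ i \<le> a ^ n" using ab by (auto intro!: mult_right_mono power_mono)
  qed (use ab in auto)
  also have "\<dots> \<le> (X - Y) * a\<^sup>2 * (\<Sum>i<k. a ^ n)"
    using diff ab by (intro mult_right_mono) auto
  also have "\<dots> = (X - Y) * (real k * a ^ Suc k)"
    using Suc by (simp add: power2_eq_square)
  finally have "Y * (a ^ k - b ^ k) \<le> Y * ((X - Y) * (real k * a ^ Suc k))"
    by (rule mult_left_mono[OF _ assms(1)])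
  also have "\<dots> = (X - Y) * (real k * Y * a ^ Suc k)"
    by (simp only: mult_ac)
  finally have 1: "Y * (a ^ k - b ^ k) \<le> (X - Y) * (real k * Y * a ^ Suc k)" .
  have "real k * Y * a ^ Suc k \<le> 2 * (1 / (1 + Y / 2) ^ k)"
  proof -
    define c where "c = (Y / 2) / (1 + Y / 2)"
    have c: "0 \<le> c" using assms by (simp add: c_def)
    have "1 + real k * c \<le> (1 + c) ^ k" using c by (intro Bernoulli_inequality) auto
    moreover have "1 + c = (1 + Y) / (1 + Y / 2)" using assms by (simp add: c_def divide_simps)
    ultimately have "real k * c * (1 + Y) \<le> (1 + Y) ^ k / (1 + Y / 2) ^ k * (1 + Y)"
      using assms by (intro mult_right_mono) (auto simp: power_divide)
    moreover have "real k * (Y / 2) \<le> real k * c * (1 + Y)"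
    proof -
      have "Y / 2 \<le> c * (1 + Y)" using assms by (simp add: c_def divide_simps) (simp add: algebra_simps)
      then show ?thesis using mult_left_mono[of "Y/2" "c * (1 + Y)" "real k"] by (simp add: mult.assoc)
    qed
    ultimately have *: "real k * (Y / 2) \<le> (1 + Y) ^ Suc k / (1 + Y / 2) ^ k" by (simp add: mult.commute)
    have "real k * Y * a ^ Suc k = 2 * ((real k * (Y / 2)) / (1 + Y) ^ Suc k)"
      by (simp add: a_def power_divide)
    also have "\<dots> \<le> 2 * (((1 + Y) ^ Suc k / (1 + Y / 2) ^ k) / (1 + Y) ^ Suc k)"
      using * assms by (intro mult_left_mono divide_right_mono) auto
    also have "\<dots> = 2 * (1 / (1 + Y / 2) ^ k)"
    proof -
      have "(1 + Y) ^ Suc k \<noteq> 0" using assms by simp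
      then show ?thesis by (simp only: divide_divide_eq_left' divide_divide_eq_right) (simp del: power_Suc)
    qed
    finally show ?thesis .
  qed
  then have "(X - Y) * (real k * Y * a ^ Suc k) \<le> (X - Y) * (2 * (1 / (1 + Y / 2) ^ k))"
    using assms by (intro mult_left_mono) auto
  with 1 have "Y * (a ^ k - b ^ k) \<le> (X - Y) * (2 * (1 / (1 + Y / 2) ^ k))" by (rule order_trans)
  moreover have "a ^ k = 1 / (1 + Y) ^ k" "b ^ k = 1 / (1 + X) ^ k"
    by (simp_all add: a_def b_def power_one_over)
  ultimately show ?thesis by (simp only: mult_ac)
qed (use assms in auto)

lemma mittag_leffler_neg_relative_lipschitz:
  assumes "0 < \<alpha>" "\<alpha> \<le> 1" "0 \<le> Y" "Y \<le> X"
  shows "Y * (mittag_leffler \<alpha> 1 (- Y) - mittag_leffler \<alpha> 1 (- X)) \<le> 2 * (X - Y) * mittag_leffler \<alpha> 1 (- (Y / 2))"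
proof (rule LIMSEQ_le)
  have l: "(\<lambda>n. crp_laplace \<alpha> n x) \<longlonglongrightarrow> mittag_leffler \<alpha> 1 (- x)" if "0 \<le> x" for x
    using that assms by (auto intro!: crp_laplace_limit)
  show "(\<lambda>n. Y * (crp_laplace \<alpha> n Y - crp_laplace \<alpha> n X)) \<longlonglongrightarrow>
      Y * (mittag_leffler \<alpha> 1 (- Y) - mittag_leffler \<alpha> 1 (- X))"
    using assms by (intro tendsto_intros l) auto
  show "(\<lambda>n. 2 * (X - Y) * crp_laplace \<alpha> n (Y / 2)) \<longlonglongrightarrow> 2 * (X - Y) * mittag_leffler \<alpha> 1 (- (Y / 2))"
    using assms by (intro tendsto_intros l) auto
  have "Y * (crp_laplace \<alpha> n Y - crp_laplace \<alpha> n X) \<le> 2 * (X - Y) * crp_laplace \<alpha> n (Y / 2)" if n: "n \<ge> 1" for n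
  proof -
    define q where "q = real n powr \<alpha>"
    have q: "q > 0" using n by (simp add: q_def)
    let ?f = "\<lambda>x k. 1 / (1 + x / q) ^ k :: real"
    have "Y * (crp_laplace \<alpha> n Y - crp_laplace \<alpha> n X) = crp_expectation \<alpha> n (\<lambda>k. Y * ?f Y k + (- Y) * ?f X k)"
      unfolding crp_expectation_linear crp_laplace_def q_def[symmetric] by (simp add: algebra_simps)
    also have "\<dots> \<le> crp_expectation \<alpha> n (\<lambda>k. 2 * (X - Y) * ?f (Y / 2) k + 0 * 0)"
    proof (intro crp_expectation_mono)
      fix k
      have half: "Y / q / 2 = Y / 2 / q" by simp
      have "(Y / q) * (?f Y k - ?f X k) \<le> 2 * (X / q - Y / q) * ?f (Y / 2) k"
        using inverse_power_relative_lipschitz[of "Y / q" "X / q" k] assms q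
          divide_right_mono[of Y X q] half by (simp only: less_imp_le zero_le_divide_iff simp_thms)
      then have "q * ((Y / q) * (?f Y k - ?f X k)) \<le> q * (2 * (X / q - Y / q) * ?f (Y / 2) k)"
        using q by (intro mult_left_mono) auto
      moreover have "q * ((Y / q) * (?f Y k - ?f X k)) = Y * ?f Y k + (- Y) * ?f X k"
        using q by (simp add: algebra_simps)
      moreover have "q * (2 * (X / q - Y / q) * ?f (Y / 2) k) = 2 * (X - Y) * ?f (Y / 2) k"
      proof -
        have "q * (X / q - Y / q) = X - Y" using q by (simp add: right_diff_distrib)
        then have "2 * (q * (X / q - Y / q)) * ?f (Y / 2) k = 2 * (X - Y) * ?f (Y / 2) k" by (simp only:)
        then show ?thesis by (simp only: mult_ac)
      qed
      ultimately show "Y * ?f Y k + (- Y) * ?f X k \<le> 2 * (X - Y) * ?f (Y / 2) k + 0 * 0"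
        by linarith
    qed (use assms in auto)
    also have "\<dots> = 2 * (X - Y) * crp_laplace \<alpha> n (Y / 2)"
      unfolding crp_expectation_linear crp_laplace_def q_def[symmetric] by simp
    finally show ?thesis .
  qed
  then show "\<exists>N. \<forall>n\<ge>N. Y * (crp_laplace \<alpha> n Y - crp_laplace \<alpha> n X) \<le> 2 * (X - Y) * crp_laplace \<alpha> n (Y / 2)"
    by blast
qed

lemma Beta_nn_integral:
  assumes "0 < a" "0 < b"
  shows "(\<integral>\<^sup>+ r. ennreal (indicator {0..1} r * (r powr (a - 1) * (1 - r) powr (b - 1))) \<partial>lborel) = ennreal (Beta a b)"
  using assms by (intro nn_integral_has_integral_lebesgue has_integral_Beta_real) auto

lemma Beta_bochner_integral:
  fixes a b :: real
  assumes "0 < a" "0 < b"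
  shows "has_bochner_integral lborel (\<lambda>r. indicator {0..1} r * (r powr (a - 1) * (1 - r) powr (b - 1))) (Beta a b)"
proof -
  have nonneg: "0 \<le> Beta a b"
    unfolding Beta_def using assms
    by (intro divide_nonneg_pos mult_nonneg_nonneg Gamma_real_nonneg Gamma_real_pos) auto
  show ?thesis
    by (rule has_bochner_integral_nn_integral[OF _ _ nonneg Beta_nn_integral[OF assms]]) auto
qed

text \<open>The function \<open>e(r) = E\<^sub>\<alpha>(- x r\<^sup>\<alpha>)\<close> solves the relaxation equation \<open>e + x I\<^sup>\<alpha> e = 1\<close> with the
fractional integral \<open>I\<^sup>\<alpha>\<close>; this is the equation at time one. The Beta integral shifts the index of
every term of the series by one.\<close>

lemma mittag_leffler_volterra:
  assumes "0 < \<alpha>"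
  shows "has_bochner_integral lborel
      (\<lambda>r. indicator {0..1} r * (1 - r) powr (\<alpha> - 1) * (x * mittag_leffler \<alpha> 1 (- (x * r powr \<alpha>))))
      (Gamma \<alpha> * (1 - mittag_leffler \<alpha> 1 (- x)))"
proof -
  have G: "Gamma (real k * \<alpha> + 1) > 0" for k using assms by (simp add: add_nonneg_pos)
  define b where "b k r = indicator {0..1} r * (r powr ((real k * \<alpha> + 1) - 1) * (1 - r) powr (\<alpha> - 1))" for k and r :: real
  define f where "f k r = (- x) ^ k / Gamma (real k * \<alpha> + 1) * b k r" for k r
  have b: "has_bochner_integral lborel (b k) (Beta (real k * \<alpha> + 1) \<alpha>)" for k
    unfolding b_def using assms by (intro Beta_bochner_integral) (auto simp: add_nonneg_pos)
  have b_eq: "b k r = indicator {0..1} r * (1 - r) powr (\<alpha> - 1) * (r powr \<alpha>) ^ k" if "r \<noteq> 0" for k r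
    using that by (auto simp: b_def indicator_def powr_powr[symmetric] powr_realpow mult.commute[of "real k"])
  have b_nonneg: "0 \<le> b k r" for k r by (auto simp: b_def indicator_def)
  have f: "has_bochner_integral lborel (f k) ((- x) ^ k * Gamma \<alpha> / Gamma (real (Suc k) * \<alpha> + 1))" for k
  proof -
    have "has_bochner_integral lborel (f k) ((- x) ^ k / Gamma (real k * \<alpha> + 1) * Beta (real k * \<alpha> + 1) \<alpha>)"
      unfolding f_def by (intro has_bochner_integral_mult_right b)
    moreover have "Beta (real k * \<alpha> + 1) \<alpha> = Gamma (real k * \<alpha> + 1) * Gamma \<alpha> / Gamma (real (Suc k) * \<alpha> + 1)"
      by (simp add: Beta_def algebra_simps)
    ultimately show ?thesis using G[of k] by (simp add: less_imp_neq[symmetric])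
  qed
  have norm_f: "has_bochner_integral lborel (\<lambda>r. norm (f k r)) (\<bar>x\<bar> ^ k * Gamma \<alpha> / Gamma (real (Suc k) * \<alpha> + 1))" for k
  proof -
    have "has_bochner_integral lborel (\<lambda>r. \<bar>x\<bar> ^ k / Gamma (real k * \<alpha> + 1) * b k r) (\<bar>x\<bar> ^ k / Gamma (real k * \<alpha> + 1) * Beta (real k * \<alpha> + 1) \<alpha>)"
      by (intro has_bochner_integral_mult_right b)
    moreover have "Beta (real k * \<alpha> + 1) \<alpha> = Gamma (real k * \<alpha> + 1) * Gamma \<alpha> / Gamma (real (Suc k) * \<alpha> + 1)"
      by (simp add: Beta_def algebra_simps)
    moreover have "norm (f k r) = \<bar>x\<bar> ^ k / Gamma (real k * \<alpha> + 1) * b k r" for r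
      using G[of k] b_nonneg[of k r] by (simp add: f_def abs_mult power_abs)
    ultimately show ?thesis using G[of k] by (simp add: less_imp_neq[symmetric])
  qed
  have pointwise: "f k r = indicator {0..1} r * (1 - r) powr (\<alpha> - 1) * ((- (x * r powr \<alpha>)) ^ k / Gamma (real k * \<alpha> + 1))"
    if "r \<noteq> 0" for k r
    using that by (simp add: f_def b_eq power_mult_distrib power_minus[of x] power_minus[of "x * _"])
  have sums: "(\<lambda>k. f k r) sums (indicator {0..1} r * (1 - r) powr (\<alpha> - 1) * mittag_leffler \<alpha> 1 (- (x * r powr \<alpha>)))"
    if "r \<noteq> 0" for r
    unfolding pointwise[OF that] by (intro sums_mult mittag_leffler_sums assms)
  have norm_summable: "summable (\<lambda>k. norm (f k r))" if "r \<noteq> 0" for r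
  proof -
    have "norm (f k r) = indicator {0..1} r * (1 - r) powr (\<alpha> - 1) * (\<bar>x * r powr \<alpha>\<bar> ^ k / Gamma (real k * \<alpha> + 1))" for k
      using G[of k] unfolding pointwise[OF that] by (simp add: abs_mult power_abs indicator_def)
    then show ?thesis by (simp only:) (intro summable_mult mittag_leffler_summable assms)
  qed
  have AE0: "AE r in lborel. r \<noteq> (0::real)" by (rule AE_lborel_singleton)
  have summable_norms: "summable (\<lambda>k. \<bar>x\<bar> ^ k * Gamma \<alpha> / Gamma (real (Suc k) * \<alpha> + 1))"
  proof (cases "x = 0")
    case False
    have "summable (\<lambda>k. Gamma \<alpha> / \<bar>x\<bar> * (\<bar>x\<bar> ^ Suc k / Gamma (real (Suc k) * \<alpha> + 1)))"
      using mittag_leffler_summable[OF assms, of x]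
        summable_Suc_iff[of "\<lambda>k. \<bar>x\<bar> ^ k / Gamma (real k * \<alpha> + 1)"] by (intro summable_mult) blast
    then show ?thesis using False by (simp add: field_simps)
  qed (auto intro!: summable_finite[of "{0}"])
  let ?E = "\<lambda>r. indicator {0..1} r * (1 - r) powr (\<alpha> - 1) * mittag_leffler \<alpha> 1 (- (x * r powr \<alpha>))"
  have int_f: "integrable lborel (f k)" for k using f[of k] by (simp add: has_bochner_integral_iff)
  have [measurable]: "f k \<in> borel_measurable lborel" for k using int_f by auto
  have E_eq: "?E = (\<lambda>r. if r = 0 then mittag_leffler \<alpha> 1 0 else (\<Sum>k. f k r))"
    using assms by (auto simp: fun_eq_iff sums_iff dest!: sums[THEN sums_unique])
  have meas: "?E \<in> borel_measurable lborel" unfolding E_eq by measurable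
  have int_norm: "(\<integral>r. norm (f k r) \<partial>lborel) = \<bar>x\<bar> ^ k * Gamma \<alpha> / Gamma (real (Suc k) * \<alpha> + 1)" for k
    using norm_f by (rule has_bochner_integral_integral_eq)
  have AEs: "AE r in lborel. summable (\<lambda>k. norm (f k r))" using AE0 by eventually_elim (rule norm_summable)
  have "integrable lborel (\<lambda>r. \<Sum>k. f k r)"
    by (rule integrable_suminf[OF int_f AEs]) (simp only: int_norm summable_norms)
  moreover have AE_eq: "AE r in lborel. (\<Sum>k. f k r) = ?E r" using AE0 by eventually_elim (use sums in \<open>simp add: sums_iff\<close>)
  ultimately have int_E: "integrable lborel ?E"
    by (subst (asm) integrable_cong_AE) (use meas in auto)
  have "(\<lambda>k. (\<integral>r. f k r \<partial>lborel)) sums (\<integral>r. (\<Sum>k. f k r) \<partial>lborel)"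
    by (rule sums_integral[OF int_f AEs]) (simp only: int_norm summable_norms)
  also have "(\<integral>r. (\<Sum>k. f k r) \<partial>lborel) = (\<integral>r. ?E r \<partial>lborel)"
    using AE_eq meas by (intro integral_cong_AE) auto
  also have "(\<lambda>k. (\<integral>r. f k r \<partial>lborel)) = (\<lambda>k. (- x) ^ k * Gamma \<alpha> / Gamma (real (Suc k) * \<alpha> + 1))"
    using f by (auto simp: fun_eq_iff intro: has_bochner_integral_integral_eq)
  finally have "(\<lambda>k. (- x) * ((- x) ^ k * Gamma \<alpha> / Gamma (real (Suc k) * \<alpha> + 1))) sums ((- x) * (\<integral>r. ?E r \<partial>lborel))"
    by (rule sums_mult)
  moreover have "(\<lambda>k. (- x) * ((- x) ^ k * Gamma \<alpha> / Gamma (real (Suc k) * \<alpha> + 1))) sums (Gamma \<alpha> * (mittag_leffler \<alpha> 1 (- x) - 1))"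
  proof -
    have "(\<lambda>k. (- x) ^ Suc k / Gamma (real (Suc k) * \<alpha> + 1)) sums (mittag_leffler \<alpha> 1 (- x) - 1)"
      using mittag_leffler_sums[OF assms, of "- x"] by (subst sums_Suc_iff) simp
    then have "(\<lambda>k. Gamma \<alpha> * ((- x) ^ Suc k / Gamma (real (Suc k) * \<alpha> + 1))) sums (Gamma \<alpha> * (mittag_leffler \<alpha> 1 (- x) - 1))"
      by (rule sums_mult)
    then show ?thesis by (simp add: mult_ac)
  qed
  ultimately have eq: "x * (\<integral>r. ?E r \<partial>lborel) = Gamma \<alpha> * (1 - mittag_leffler \<alpha> 1 (- x))"
    using sums_unique2 by (fastforce simp: algebra_simps)
  have "has_bochner_integral lborel (\<lambda>r. x * ?E r) (x * (\<integral>r. ?E r \<partial>lborel))"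
    using int_E by (intro has_bochner_integral_mult_right has_bochner_integral_integrable)
  then show "has_bochner_integral lborel
      (\<lambda>r. indicator {0..1} r * (1 - r) powr (\<alpha> - 1) * (x * mittag_leffler \<alpha> 1 (- (x * r powr \<alpha>))))
      (Gamma \<alpha> * (1 - mittag_leffler \<alpha> 1 (- x)))"
    unfolding eq by (simp add: mult_ac)
qed

text \<open>Since \<open>r \<mapsto> E\<^sub>\<alpha>(- x r\<^sup>\<alpha>)\<close> decreases, replacing it by its value at \<open>r = 1\<close> in the relaxation
equation yields \<open>x E\<^sub>\<alpha>(- x) / \<Gamma>(\<alpha> + 1) \<le> 1 - E\<^sub>\<alpha>(- x)\<close>.\<close>

lemma mittag_leffler_neg_decay:
  assumes "0 < \<alpha>" "\<alpha> \<le> 1" "0 \<le> x"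
  shows "mittag_leffler \<alpha> 1 (- x) \<le> 1 / (1 + x / Gamma (\<alpha> + 1))"
proof -
  let ?g = "mittag_leffler \<alpha> 1 (- x)"
  have beta: "has_bochner_integral lborel
      (\<lambda>r. x * ?g * (indicator {0..1} r * (r powr (1 - 1) * (1 - r) powr (\<alpha> - 1)))) (x * ?g * Beta 1 \<alpha>)"
    using assms by (intro has_bochner_integral_mult_right Beta_bochner_integral) auto
  have "x * ?g * Beta 1 \<alpha> \<le> Gamma \<alpha> * (1 - ?g)"
    unfolding has_bochner_integral_integral_eq[OF beta, symmetric]
      has_bochner_integral_integral_eq[OF mittag_leffler_volterra[OF assms(1), of x], symmetric]
  proof (rule integral_mono_AE)
    show "AE r in lborel. x * ?g * (indicator {0..1} r * (r powr (1 - 1) * (1 - r) powr (\<alpha> - 1)))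
       \<le> indicator {0..1} r * (1 - r) powr (\<alpha> - 1) * (x * mittag_leffler \<alpha> 1 (- (x * r powr \<alpha>)))"
    proof (rule AE_I2)
      fix r :: real
      show "x * ?g * (indicator {0..1} r * (r powr (1 - 1) * (1 - r) powr (\<alpha> - 1)))
       \<le> indicator {0..1} r * (1 - r) powr (\<alpha> - 1) * (x * mittag_leffler \<alpha> 1 (- (x * r powr \<alpha>)))"
      proof (cases "r \<in> {0..1}")
        case True
        have "r powr \<alpha> \<le> 1" using True assms powr_mono2[of \<alpha> r 1] by simp
        then have "x * r powr \<alpha> \<le> x" using assms mult_left_mono[of "r powr \<alpha>" 1 x] by simp
        then have "?g \<le> mittag_leffler \<alpha> 1 (- (x * r powr \<alpha>))"
          using assms by (intro mittag_leffler_neg_antimono) auto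
        then have "(1 - r) powr (\<alpha> - 1) * (x * ?g) \<le> (1 - r) powr (\<alpha> - 1) * (x * mittag_leffler \<alpha> 1 (- (x * r powr \<alpha>)))"
          using assms by (intro mult_left_mono) auto
        moreover have "0 \<le> (1 - r) powr (\<alpha> - 1) * (x * ?g)"
          using assms mittag_leffler_neg_nonneg[of \<alpha> x] by simp
        ultimately show ?thesis using True by (cases "r = 0") (auto simp: mult_ac)
      qed simp
    qed
  qed (use beta mittag_leffler_volterra[OF assms(1), of x] in \<open>auto simp: has_bochner_integral_iff\<close>)
  moreover have "Beta 1 \<alpha> = 1 / \<alpha>"
    using Gamma_plus1[of \<alpha>] assms less_imp_neq[OF Gamma_real_pos[OF assms(1)]] by (simp add: Beta_def add.commute nonpos_Ints_def)
  ultimately have "x * ?g / \<alpha> \<le> Gamma \<alpha> * (1 - ?g)" by simp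
  moreover have "Gamma (\<alpha> + 1) = \<alpha> * Gamma \<alpha>" using assms by (intro Gamma_plus1) (auto elim!: nonpos_Ints_cases)
  ultimately have "x * ?g \<le> Gamma (\<alpha> + 1) * (1 - ?g)"
    using assms by (simp add: field_simps)
  moreover have "Gamma (\<alpha> + 1) > 0" using assms by simp
  ultimately have "?g * (1 + x / Gamma (\<alpha> + 1)) \<le> 1" by (simp add: field_simps)
  moreover have "1 + x / Gamma (\<alpha> + 1) > 0" using assms \<open>Gamma (\<alpha> + 1) > 0\<close> by (simp add: add_pos_nonneg)
  ultimately show ?thesis by (simp add: pos_le_divide_eq)
qed


section \<open>Power integrals and the norm of an interval\<close>

lemma nn_integral_reflect:
  fixes f :: "real \<Rightarrow> ennreal"
  assumes [measurable]: "f \<in> borel_measurable borel"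
  shows "(\<integral>\<^sup>+x. f (t - x) \<partial>lborel) = (\<integral>\<^sup>+x. f x \<partial>lborel)"
  using nn_integral_real_affine[of f "-1" t] by simp

lemma nn_integral_translate:
  fixes f :: "real \<Rightarrow> ennreal"
  assumes [measurable]: "f \<in> borel_measurable borel"
  shows "(\<integral>\<^sup>+x. f (t + x) \<partial>lborel) = (\<integral>\<^sup>+x. f x \<partial>lborel)"
  using nn_integral_real_affine[of f 1 t] by simp

lemma nn_integral_powr_near:
  fixes b t :: real
  assumes "-1 < b" "0 \<le> t"
  shows "(\<integral>\<^sup>+u. ennreal (indicator {0..t} u * u powr b) \<partial>lborel) = ennreal (t powr (b + 1) / (b + 1))"
  using assms by (intro nn_integral_has_integral_lebesgue has_integral_powr_from_0) auto

lemma nn_integral_powr_near_right: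
  fixes b x d :: real
  assumes "-1 < b" "x \<le> d"
  shows "(\<integral>\<^sup>+y. ennreal (indicator {x..d} y * (y - x) powr b) \<partial>lborel) = ennreal ((d - x) powr (b + 1) / (b + 1))"
proof -
  have "(\<integral>\<^sup>+y. ennreal (indicator {x..d} y * (y - x) powr b) \<partial>lborel) =
      (\<integral>\<^sup>+u. ennreal (indicator {x..d} (x + u) * ((x + u) - x) powr b) \<partial>lborel)"
    by (rule nn_integral_translate[symmetric]) measurable
  also have "\<dots> = (\<integral>\<^sup>+u. ennreal (indicator {0..d - x} u * u powr b) \<partial>lborel)"
    by (intro nn_integral_cong) (auto simp: indicator_def)
  finally show ?thesis using nn_integral_powr_near[of b "d - x"] assms by simp
qed

lemma nn_integral_powr_near_left:
  fixes b x c :: real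
  assumes "-1 < b" "c \<le> x"
  shows "(\<integral>\<^sup>+y. ennreal (indicator {c..x} y * (x - y) powr b) \<partial>lborel) = ennreal ((x - c) powr (b + 1) / (b + 1))"
proof -
  have "(\<integral>\<^sup>+y. ennreal (indicator {c..x} y * (x - y) powr b) \<partial>lborel) =
      (\<integral>\<^sup>+u. ennreal (indicator {c..x} (x - u) * (x - (x - u)) powr b) \<partial>lborel)"
    by (rule nn_integral_reflect[symmetric]) measurable
  also have "\<dots> = (\<integral>\<^sup>+u. ennreal (indicator {0..x - c} u * u powr b) \<partial>lborel)"
    by (intro nn_integral_cong) (auto simp: indicator_def)
  finally show ?thesis using nn_integral_powr_near[of b "x - c"] assms by simp
qed

lemma nn_integral_powr_far:
  fixes b c :: real
  assumes "b < -1" "0 < c"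
  shows "(\<integral>\<^sup>+u. ennreal (indicator {c..} u * u powr b) \<partial>lborel) = ennreal (c powr (b + 1) / (- 1 - b))"
proof -
  have "- (c powr (b + 1)) / (b + 1) = c powr (b + 1) / (- 1 - b)"
    using assms by (simp add: field_simps)
  then show ?thesis
    using assms nn_integral_has_integral_lebesgue[OF _ has_integral_powr_to_inf[OF assms]] by simp
qed

lemma nn_integral_powr_far_right:
  fixes b x d :: real
  assumes "b < -1" "x < d"
  shows "(\<integral>\<^sup>+y. ennreal (indicator {d..} y * (y - x) powr b) \<partial>lborel) = ennreal ((d - x) powr (b + 1) / (- 1 - b))"
proof -
  have "(\<integral>\<^sup>+y. ennreal (indicator {d..} y * (y - x) powr b) \<partial>lborel) =
      (\<integral>\<^sup>+u. ennreal (indicator {d..} (x + u) * ((x + u) - x) powr b) \<partial>lborel)"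
    by (rule nn_integral_translate[symmetric]) measurable
  also have "\<dots> = (\<integral>\<^sup>+u. ennreal (indicator {d - x..} u * u powr b) \<partial>lborel)"
    by (intro nn_integral_cong) (auto simp: indicator_def)
  finally show ?thesis using nn_integral_powr_far[of b "d - x"] assms by simp
qed

lemma nn_integral_powr_far_left:
  fixes b x c :: real
  assumes "b < -1" "c < x"
  shows "(\<integral>\<^sup>+y. ennreal (indicator {..c} y * (x - y) powr b) \<partial>lborel) = ennreal ((x - c) powr (b + 1) / (- 1 - b))"
proof -
  have "(\<integral>\<^sup>+y. ennreal (indicator {..c} y * (x - y) powr b) \<partial>lborel) =
      (\<integral>\<^sup>+u. ennreal (indicator {..c} (x - u) * (x - (x - u)) powr b) \<partial>lborel)"
    by (rule nn_integral_reflect[symmetric]) measurable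
  also have "\<dots> = (\<integral>\<^sup>+u. ennreal (indicator {x - c..} u * u powr b) \<partial>lborel)"
    by (intro nn_integral_cong) (auto simp: indicator_def)
  finally show ?thesis using nn_integral_powr_far[of b "x - c"] assms by simp
qed

lemma nn_integral_Beta_scaled:
  fixes b c u :: real
  assumes "0 < b" "0 < c" "0 < u"
  shows "(\<integral>\<^sup>+v. ennreal (indicator {0..u} v * (v powr (b - 1) * (u - v) powr (c - 1))) \<partial>lborel) =
    ennreal (u powr (b + c - 1) * Beta b c)"
proof -
  have "(\<integral>\<^sup>+v. ennreal (indicator {0..u} v * (v powr (b - 1) * (u - v) powr (c - 1))) \<partial>lborel) =
      ennreal u * (\<integral>\<^sup>+r. ennreal (indicator {0..u} (0 + u * r) * ((0 + u * r) powr (b - 1) * (u - (0 + u * r)) powr (c - 1))) \<partial>lborel)"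
    using assms by (subst nn_integral_real_affine[where c = u and t = 0]) auto
  also have "(\<lambda>r. ennreal (indicator {0..u} (0 + u * r) * ((0 + u * r) powr (b - 1) * (u - (0 + u * r)) powr (c - 1)))) =
      (\<lambda>r. ennreal (u powr (b + c - 2)) * ennreal (indicator {0..1} r * (r powr (b - 1) * (1 - r) powr (c - 1))))"
  proof
    fix r :: real
    have "u - u * r = u * (1 - r)" by (simp add: algebra_simps)
    moreover have "u powr (b - 1) * u powr (c - 1) = u powr (b + c - 2)" by (simp add: powr_add[symmetric] algebra_simps)
    ultimately have "indicator {0..u} (0 + u * r) * ((0 + u * r) powr (b - 1) * (u - (0 + u * r)) powr (c - 1)) =
        u powr (b + c - 2) * (indicator {0..1} r * (r powr (b - 1) * (1 - r) powr (c - 1)))"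
      using assms by (auto simp: indicator_def powr_mult mult_le_cancel_left1 zero_le_mult_iff mult_ac)
    then show "ennreal (indicator {0..u} (0 + u * r) * ((0 + u * r) powr (b - 1) * (u - (0 + u * r)) powr (c - 1))) =
       ennreal (u powr (b + c - 2)) * ennreal (indicator {0..1} r * (r powr (b - 1) * (1 - r) powr (c - 1)))"
      by (simp add: ennreal_mult'')
  qed
  also have "ennreal u * (\<integral>\<^sup>+r. ennreal (u powr (b + c - 2)) * ennreal (indicator {0..1} r * (r powr (b - 1) * (1 - r) powr (c - 1))) \<partial>lborel) =
      ennreal u * (ennreal (u powr (b + c - 2)) * ennreal (Beta b c))"
    using assms by (subst nn_integral_cmult) (auto simp: Beta_nn_integral)
  also have "\<dots> = ennreal (u powr (b + c - 1) * Beta b c)"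
  proof -
    have "u * u powr (b + c - 2) = u powr (b + c - 1)"
      using assms powr_add[of u 1 "b + c - 2"] by simp
    then show ?thesis using assms by (simp add: ennreal_mult'[symmetric] mult.assoc[symmetric])
  qed
  finally show ?thesis .
qed

text \<open>A symmetric integrand is split into, or dominated by, a function and its mirror image in the
diagonal. By Tonelli's theorem both contribute the same.\<close>

lemma nn_integral_symmetrize:
  fixes f :: "real \<Rightarrow> real \<Rightarrow> ennreal"
  assumes [measurable]: "(\<lambda>(x, y). f x y) \<in> borel_measurable (borel \<Otimes>\<^sub>M borel)"
  shows "(\<integral>\<^sup>+x. \<integral>\<^sup>+y. f x y + f y x \<partial>lborel \<partial>lborel) = 2 * (\<integral>\<^sup>+x. \<integral>\<^sup>+y. f x y \<partial>lborel \<partial>lborel)"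
proof -
  have "(\<integral>\<^sup>+x. \<integral>\<^sup>+y. f x y + f y x \<partial>lborel \<partial>lborel) =
      (\<integral>\<^sup>+x. \<integral>\<^sup>+y. f x y \<partial>lborel \<partial>lborel) + (\<integral>\<^sup>+x. \<integral>\<^sup>+y. f y x \<partial>lborel \<partial>lborel)"
    by (subst nn_integral_add[symmetric]) (auto intro!: nn_integral_cong nn_integral_add)
  also have "(\<integral>\<^sup>+x. \<integral>\<^sup>+y. f y x \<partial>lborel \<partial>lborel) = (\<integral>\<^sup>+y. \<integral>\<^sup>+x. f y x \<partial>lborel \<partial>lborel)"
    by (rule lborel_pair.Fubini') measurable
  finally show ?thesis by (simp add: mult_2)
qed

lemma fbm_norm_sq_reflect:
  assumes [measurable]: "f \<in> borel_measurable borel"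
  shows "fbm_norm_sq H (\<lambda>r. f (t - r)) = fbm_norm_sq H f"
proof -
  have dbl: "(\<integral>\<^sup>+x. \<integral>\<^sup>+y. g (t - x) (t - y) \<partial>lborel \<partial>lborel) = (\<integral>\<^sup>+x. \<integral>\<^sup>+y. g x y \<partial>lborel \<partial>lborel)"
    if [measurable]: "(\<lambda>(x, y). g x y) \<in> borel_measurable (borel \<Otimes>\<^sub>M borel)" for g :: "real \<Rightarrow> real \<Rightarrow> ennreal"
  proof -
    have "(\<integral>\<^sup>+y. g (t - x) (t - y) \<partial>lborel) = (\<integral>\<^sup>+y. g (t - x) y \<partial>lborel)" for x
      by (rule nn_integral_reflect) measurable
    then show ?thesis
      using nn_integral_reflect[of "\<lambda>x. \<integral>\<^sup>+y. g x y \<partial>lborel" t] by simp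
  qed
  have 1: "(\<integral>\<^sup>+x. \<integral>\<^sup>+y. ennreal ((f (t - x) - f (t - y))\<^sup>2 * \<bar>x - y\<bar> powr (2 * H - 2)) \<partial>lborel \<partial>lborel) =
      (\<integral>\<^sup>+x. \<integral>\<^sup>+y. ennreal ((f x - f y)\<^sup>2 * \<bar>x - y\<bar> powr (2 * H - 2)) \<partial>lborel \<partial>lborel)"
    by (subst dbl[symmetric]) (auto simp: abs_minus_commute)
  have 2: "(\<integral>\<^sup>+x. \<integral>\<^sup>+y. ennreal (\<bar>f (t - x)\<bar> * \<bar>f (t - y)\<bar> * \<bar>x - y\<bar> powr (2 * H - 2)) \<partial>lborel \<partial>lborel) =
      (\<integral>\<^sup>+x. \<integral>\<^sup>+y. ennreal (\<bar>f x\<bar> * \<bar>f y\<bar> * \<bar>x - y\<bar> powr (2 * H - 2)) \<partial>lborel \<partial>lborel)"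
    by (subst dbl[symmetric]) (auto simp: abs_minus_commute)
  show ?thesis
    unfolding fbm_norm_sq_def 1 2 using nn_integral_reflect[of "\<lambda>x. ennreal ((f x)\<^sup>2)" t] by simp
qed

lemma nn_integral_powr_both_ends:
  fixes c d b :: real
  assumes "c \<le> d" "-1 < b" "0 < q"
  shows "(\<integral>\<^sup>+x. ennreal (indicator {c..d} x * (((x - c) powr b + (d - x) powr b) / q)) \<partial>lborel) =
    ennreal (2 * (d - c) powr (b + 1) / ((b + 1) * q))"
proof -
  have "(\<integral>\<^sup>+x. ennreal (indicator {c..d} x * (((x - c) powr b + (d - x) powr b) / q)) \<partial>lborel) =
     (\<integral>\<^sup>+x. ennreal (1 / q) * (ennreal (indicator {c..d} x * (x - c) powr b) + ennreal (indicator {c..d} x * (d - x) powr b)) \<partial>lborel)"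
  proof (intro nn_integral_cong)
    fix x
    have "indicator {c..d} x * (((x - c) powr b + (d - x) powr b) / q) =
        1 / q * (indicator {c..d} x * (x - c) powr b + indicator {c..d} x * (d - x) powr b)"
      by (simp add: algebra_simps add_divide_distrib)
    then show "ennreal (indicator {c..d} x * (((x - c) powr b + (d - x) powr b) / q)) =
      ennreal (1 / q) * (ennreal (indicator {c..d} x * (x - c) powr b) + ennreal (indicator {c..d} x * (d - x) powr b))"
      using assms by (simp add: ennreal_mult'[symmetric] ennreal_plus[symmetric] del: ennreal_plus)
  qed
  also have "\<dots> = ennreal (1 / q) * (ennreal ((d - c) powr (b + 1) / (b + 1)) + ennreal ((d - c) powr (b + 1) / (b + 1)))"
    using assms by (simp add: nn_integral_cmult nn_integral_add nn_integral_powr_near_left nn_integral_powr_near_right)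
  also have "\<dots> = ennreal (1 / q * ((d - c) powr (b + 1) / (b + 1) + (d - c) powr (b + 1) / (b + 1)))"
    using assms by (simp add: ennreal_mult'[symmetric] ennreal_plus[symmetric] del: ennreal_plus)
  also have "1 / q * ((d - c) powr (b + 1) / (b + 1) + (d - c) powr (b + 1) / (b + 1)) = 2 * (d - c) powr (b + 1) / ((b + 1) * q)"
    using assms by (simp add: divide_simps)
  finally show ?thesis .
qed

lemma nn_integral_interval_inside:
  fixes c d H :: real
  assumes "c \<le> d" "1/2 < H" "H < 1"
  shows "(\<integral>\<^sup>+x. \<integral>\<^sup>+y. ennreal (indicator {c<..d} x * indicator {c<..d} y * \<bar>x - y\<bar> powr (2 * H - 2)) \<partial>lborel \<partial>lborel) =
    ennreal ((d - c) powr (2 * H) / (H * (2 * H - 1)))"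
proof -
  have "(\<integral>\<^sup>+y. ennreal (indicator {c<..d} x * indicator {c<..d} y * \<bar>x - y\<bar> powr (2 * H - 2)) \<partial>lborel) =
      ennreal (indicator {c..d} x * (((x - c) powr (2 * H - 1) + (d - x) powr (2 * H - 1)) / (2 * H - 1)))"
    if "x \<noteq> c" for x
  proof (cases "x \<in> {c..d}")
    case True
    have "(\<integral>\<^sup>+y. ennreal (indicator {c<..d} x * indicator {c<..d} y * \<bar>x - y\<bar> powr (2 * H - 2)) \<partial>lborel) =
       (\<integral>\<^sup>+y. ennreal (indicator {c..x} y * (x - y) powr (2 * H - 2)) + ennreal (indicator {x..d} y * (y - x) powr (2 * H - 2)) \<partial>lborel)"
      by (intro nn_integral_cong_AE eventually_mono[OF AE_lborel_singleton[of c]])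
        (use True that in \<open>auto simp: indicator_def\<close>)
    also have "\<dots> = ennreal ((x - c) powr (2 * H - 2 + 1) / (2 * H - 2 + 1)) + ennreal ((d - x) powr (2 * H - 2 + 1) / (2 * H - 2 + 1))"
      using True assms by (subst nn_integral_add) (auto simp: nn_integral_powr_near_left nn_integral_powr_near_right)
    finally show ?thesis using True assms
      by (simp add: ennreal_plus[symmetric] add_divide_distrib[symmetric] del: ennreal_plus)
  qed (auto simp: indicator_def)
  then have "(\<integral>\<^sup>+x. \<integral>\<^sup>+y. ennreal (indicator {c<..d} x * indicator {c<..d} y * \<bar>x - y\<bar> powr (2 * H - 2)) \<partial>lborel \<partial>lborel) =
    (\<integral>\<^sup>+x. ennreal (indicator {c..d} x * (((x - c) powr (2 * H - 1) + (d - x) powr (2 * H - 1)) / (2 * H - 1))) \<partial>lborel)"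
    using AE_lborel_singleton[of c] by (intro nn_integral_cong_AE) (auto elim!: eventually_mono)
  then show ?thesis
    using nn_integral_powr_both_ends[of c d "2 * H - 1" "2 * H - 1"] assms by simp
qed

lemma nn_integral_interval_across:
  fixes c d H :: real
  assumes "c \<le> d" "0 < H" "H < 1/2"
  shows "(\<integral>\<^sup>+x. \<integral>\<^sup>+y. ennreal ((indicator {c<..d} x - indicator {c<..d} y)\<^sup>2 * \<bar>x - y\<bar> powr (2 * H - 2)) \<partial>lborel \<partial>lborel) =
    ennreal (2 * (d - c) powr (2 * H) / (H * (1 - 2 * H)))"
proof -
  let ?A = "\<lambda>x y. ennreal (indicator {c<..d} x * (1 - indicator {c<..d} y) * \<bar>x - y\<bar> powr (2 * H - 2))"
  have "(\<integral>\<^sup>+y. ?A x y \<partial>lborel) =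
      ennreal (indicator {c..d} x * (((x - c) powr (2 * H - 1) + (d - x) powr (2 * H - 1)) / (1 - 2 * H)))"
    if "x \<noteq> c" "x \<noteq> d" for x
  proof (cases "x \<in> {c..d}")
    case True
    have "(\<integral>\<^sup>+y. ?A x y \<partial>lborel) =
       (\<integral>\<^sup>+y. ennreal (indicator {..c} y * (x - y) powr (2 * H - 2)) + ennreal (indicator {d..} y * (y - x) powr (2 * H - 2)) \<partial>lborel)"
      by (intro nn_integral_cong_AE eventually_mono[OF AE_lborel_singleton[of d]])
        (use True that in \<open>auto simp: indicator_def\<close>)
    also have "\<dots> = ennreal ((x - c) powr (2 * H - 2 + 1) / (- 1 - (2 * H - 2))) + ennreal ((d - x) powr (2 * H - 2 + 1) / (- 1 - (2 * H - 2)))"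
      using True that assms by (subst nn_integral_add) (auto simp: nn_integral_powr_far_left nn_integral_powr_far_right)
    finally show ?thesis using True assms
      by (simp add: ennreal_plus[symmetric] add_divide_distrib[symmetric] del: ennreal_plus)
  qed (auto simp: indicator_def)
  then have "AE x in lborel. (\<integral>\<^sup>+y. ?A x y \<partial>lborel) =
      ennreal (indicator {c..d} x * (((x - c) powr (2 * H - 1) + (d - x) powr (2 * H - 1)) / (1 - 2 * H)))"
    by (intro AE_mp[OF AE_lborel_singleton[of c] AE_mp[OF AE_lborel_singleton[of d] AE_I2]]) blast
  then have "(\<integral>\<^sup>+x. \<integral>\<^sup>+y. ?A x y \<partial>lborel \<partial>lborel) =
    (\<integral>\<^sup>+x. ennreal (indicator {c..d} x * (((x - c) powr (2 * H - 1) + (d - x) powr (2 * H - 1)) / (1 - 2 * H))) \<partial>lborel)"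
    by (rule nn_integral_cong_AE)
  then have A: "(\<integral>\<^sup>+x. \<integral>\<^sup>+y. ?A x y \<partial>lborel \<partial>lborel) = ennreal ((d - c) powr (2 * H) / (H * (1 - 2 * H)))"
    using nn_integral_powr_both_ends[of c d "2 * H - 1" "1 - 2 * H"] assms by simp
  have "ennreal ((indicator {c<..d} x - indicator {c<..d} y)\<^sup>2 * \<bar>x - y\<bar> powr (2 * H - 2)) = ?A x y + ?A y x" for x y
    by (auto simp: indicator_def abs_minus_commute)
  then have "(\<integral>\<^sup>+x. \<integral>\<^sup>+y. ennreal ((indicator {c<..d} x - indicator {c<..d} y)\<^sup>2 * \<bar>x - y\<bar> powr (2 * H - 2)) \<partial>lborel \<partial>lborel) =
      2 * (\<integral>\<^sup>+x. \<integral>\<^sup>+y. ?A x y \<partial>lborel \<partial>lborel)"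
    using nn_integral_symmetrize[of ?A] by simp
  then show ?thesis
    unfolding A using assms by (simp add: ennreal_mult'[symmetric] ennreal_numeral[symmetric] del: ennreal_numeral)
qed

text \<open>The normalising constants in \<open>fbm_norm_sq\<close> are those for which an interval has the variance of the
increment of the motion over it. By polarisation this determines the quadratic form on all step
functions.\<close>

lemma fbm_norm_sq_interval:
  assumes "c \<le> d" "0 < H" "H < 1"
  shows "fbm_norm_sq H (indicator {c<..d}) = ennreal ((d - c) powr (2 * H))"
proof (cases H "1/2 :: real" rule: linorder_cases)
  case less
  then show ?thesis
    using assms by (simp add: fbm_norm_sq_def nn_integral_interval_across ennreal_mult'[symmetric])
next
  case equal
  have "(\<lambda>x. ennreal ((indicator {c<..d} x)\<^sup>2)) = indicator {c<..d}"
    by (auto simp: indicator_def)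
  then have "fbm_norm_sq H (indicator {c<..d}) = ennreal (d - c)"
    using equal assms by (simp add: fbm_norm_sq_def)
  moreover have "(d - c) powr (2 * H) = d - c"
    unfolding equal using assms by simp
  ultimately show ?thesis by (simp only:)
next
  case greater
  then show ?thesis
    using assms nn_integral_interval_inside[of c d H] by (simp add: fbm_norm_sq_def ennreal_mult'[symmetric])
qed


section \<open>Second moments of step integrals\<close>

text \<open>Polarisation of a product of two linear combinations of increments: only products of two increments
over one and the same interval appear on the right. The term for \<open>(i, j)\<close> on the right is the
symmetrisation of the product of the \<open>i\<close>-th and \<open>j\<close>-th summands on the left.\<close>

lemma product_of_increments:
  fixes c :: "nat \<Rightarrow> real" and x y :: "'i \<Rightarrow> real"
  shows "(\<Sum>i<n. c i * (x (q i) - x (p i))) * (\<Sum>i<n. c i * (y (q i) - y (p i))) =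
    (\<Sum>i<n. \<Sum>j<n. c i * c j / 2 *
      ((x (q i) - x (p j)) * (y (q i) - y (p j)) + (x (p i) - x (q j)) * (y (p i) - y (q j))
       - (x (q i) - x (q j)) * (y (q i) - y (q j)) - (x (p i) - x (p j)) * (y (p i) - y (p j))))"
proof -
  define X where "X i = c i * (x (q i) - x (p i))" for i
  define Y where "Y i = c i * (y (q i) - y (p i))" for i
  have "c i * c j / 2 *
      ((x (q i) - x (p j)) * (y (q i) - y (p j)) + (x (p i) - x (q j)) * (y (p i) - y (q j))
       - (x (q i) - x (q j)) * (y (q i) - y (q j)) - (x (p i) - x (p j)) * (y (p i) - y (p j))) =
     X i * Y j / 2 + X j * Y i / 2" for i j
    by (simp add: X_def Y_def field_simps)
  then have "(\<Sum>i<n. \<Sum>j<n. c i * c j / 2 *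
      ((x (q i) - x (p j)) * (y (q i) - y (p j)) + (x (p i) - x (q j)) * (y (p i) - y (q j))
       - (x (q i) - x (q j)) * (y (q i) - y (q j)) - (x (p i) - x (p j)) * (y (p i) - y (p j)))) =
     (\<Sum>i<n. \<Sum>j<n. X i * Y j / 2) + (\<Sum>i<n. \<Sum>j<n. X j * Y i / 2)"
    by (simp only: sum.distrib)
  also have "(\<Sum>i<n. \<Sum>j<n. X j * Y i / 2) = (\<Sum>i<n. \<Sum>j<n. X i * Y j / 2)"
    by (rule sum.swap)
  also have "(\<Sum>i<n. \<Sum>j<n. X i * Y j / 2) + (\<Sum>i<n. \<Sum>j<n. X i * Y j / 2) = (\<Sum>i<n. X i) * (\<Sum>j<n. Y j)"
    by (simp add: sum_product sum_divide_distrib[symmetric])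
  finally show ?thesis by (simp add: X_def Y_def)
qed

text \<open>The variance of \<open>step_integral W ps\<close>, written in terms of the covariance of the motion.\<close>

definition increment_form :: "real \<Rightarrow> (real \<times> real \<times> real) list \<Rightarrow> real" where
  "increment_form H ps = (\<Sum>i<length ps. \<Sum>j<length ps. case (ps ! i, ps ! j) of ((c, p, q), (c', p', q')) \<Rightarrow>
     c * c' / 2 * (\<bar>q - p'\<bar> powr (2 * H) + \<bar>p - q'\<bar> powr (2 * H) - \<bar>q - q'\<bar> powr (2 * H) - \<bar>p - p'\<bar> powr (2 * H)))"

text \<open>A bilinear form is determined on step functions by its values on single increments, if these are
\<open>\<bar>q - p\<bar>\<^bsup>2H\<^esup>\<close>. The expectation of a product of increments of the motion is of this kind, and so are,
without the absolute values, the integrals that define \<open>fbm_norm_sq\<close>; hence they agree on step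
functions. The two families \<open>x\<close>
and \<open>y\<close> differ for \<open>H > 1/2\<close>, where they are indicators in the two variables of a double
integral.\<close>

lemma has_bochner_integral_increment_form:
  fixes x y :: "real \<Rightarrow> 'z \<Rightarrow> real" and k :: "'z \<Rightarrow> real"
  assumes incr: "\<And>p q. 0 \<le> p \<Longrightarrow> 0 \<le> q \<Longrightarrow>
      has_bochner_integral N (\<lambda>z. k z * ((x q z - x p z) * (y q z - y p z))) (\<bar>q - p\<bar> powr (2 * H))"
    and ps: "\<forall>(c, a, b)\<in>set ps. 0 \<le> a \<and> 0 \<le> b"
  shows "has_bochner_integral N
    (\<lambda>z. k z * ((\<Sum>(c, a, b)\<leftarrow>ps. c * (x b z - x a z)) * (\<Sum>(c, a, b)\<leftarrow>ps. c * (y b z - y a z))))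
    (increment_form H ps)"
proof -
  define c p q where "c i = fst (ps ! i)" and "p i = fst (snd (ps ! i))" and "q i = snd (snd (ps ! i))" for i
  have nonneg: "0 \<le> p i" "0 \<le> q i" if "i < length ps" for i
  proof -
    have "case ps ! i of (c, a, b) \<Rightarrow> 0 \<le> a \<and> 0 \<le> b" by (rule bspec[OF ps nth_mem[OF that]])
    then show "0 \<le> p i" "0 \<le> q i" by (simp_all add: p_def q_def split_beta)
  qed
  have list: "(\<Sum>(c, a, b)\<leftarrow>ps. c * (w b - w a)) = (\<Sum>i<length ps. c i * (w (q i) - w (p i)))" for w :: "real \<Rightarrow> real"
    by (simp add: sum_list_sum_nth c_def p_def q_def atLeast0LessThan split_beta)
  let ?D = "\<lambda>s t z. k z * ((x s z - x t z) * (y s z - y t z))"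
  have D: "has_bochner_integral N (?D s t) (\<bar>s - t\<bar> powr (2 * H))" if "0 \<le> s" "0 \<le> t" for s t
    using incr[OF that(2) that(1)] by simp
  have "has_bochner_integral N
     (\<lambda>z. \<Sum>i<length ps. \<Sum>j<length ps. c i * c j / 2 *
        (?D (q i) (p j) z + ?D (p i) (q j) z - ?D (q i) (q j) z - ?D (p i) (p j) z))
     (\<Sum>i<length ps. \<Sum>j<length ps. c i * c j / 2 *
        (\<bar>q i - p j\<bar> powr (2 * H) + \<bar>p i - q j\<bar> powr (2 * H) - \<bar>q i - q j\<bar> powr (2 * H) - \<bar>p i - p j\<bar> powr (2 * H)))"
    by (intro has_bochner_integral_sum has_bochner_integral_mult_right has_bochner_integral_diff
        has_bochner_integral_add D nonneg) auto
  moreover have "k z * ((\<Sum>(c, a, b)\<leftarrow>ps. c * (x b z - x a z)) * (\<Sum>(c, a, b)\<leftarrow>ps. c * (y b z - y a z))) =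
      (\<Sum>i<length ps. \<Sum>j<length ps. c i * c j / 2 *
        (?D (q i) (p j) z + ?D (p i) (q j) z - ?D (q i) (q j) z - ?D (p i) (p j) z))" for z
    unfolding list[of "\<lambda>t. x t z"] list[of "\<lambda>t. y t z"] product_of_increments[where x = "\<lambda>t. x t z" and y = "\<lambda>t. y t z"]
    unfolding sum_distrib_left by (intro sum.cong refl) (simp add: algebra_simps)
  moreover have "increment_form H ps = (\<Sum>i<length ps. \<Sum>j<length ps. c i * c j / 2 *
        (\<bar>q i - p j\<bar> powr (2 * H) + \<bar>p i - q j\<bar> powr (2 * H) - \<bar>q i - q j\<bar> powr (2 * H) - \<bar>p i - p j\<bar> powr (2 * H)))"
    by (simp add: increment_form_def c_def p_def q_def split_beta)
  ultimately show ?thesis by simp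
qed

lemma centered_gaussian_zero_second_moment:
  assumes "centered_gaussian M X" "(\<integral>\<omega>. X \<omega> * X \<omega> \<partial>M) = 0"
  shows "AE \<omega> in M. X \<omega> = 0"
proof (rule ccontr)
  assume "\<not> (AE \<omega> in M. X \<omega> = 0)"
  then obtain \<sigma> where \<sigma>: "\<sigma> > 0" "distributed M lborel X (normal_density 0 \<sigma>)"
    using assms by (auto simp: centered_gaussian_def)
  have [measurable]: "X \<in> borel_measurable M" using assms by (simp add: centered_gaussian_def)
  have "(\<integral>\<omega>. X \<omega> * X \<omega> \<partial>M) = (\<integral>x. normal_density 0 \<sigma> x * (x * x) \<partial>lborel)"
    using \<sigma>(2) by (subst distributed_integral[symmetric]) auto
  also have "\<dots> = \<sigma>\<^sup>2"
    using has_bochner_integral_integral_eq[OF normal_moment_even[OF \<sigma>(1), of 0 1]]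
    by (simp add: power2_eq_square)
  finally show False using assms \<sigma> by simp
qed

lemma fbm_centered_gaussian:
  assumes "fractional_brownian_motion M H W" "0 \<le> t"
  shows "centered_gaussian M (W t)"
proof -
  have "\<forall>F c. finite F \<and> F \<subseteq> {0..} \<longrightarrow> centered_gaussian M (\<lambda>\<omega>. \<Sum>t\<in>F. c t * W t \<omega>)"
    using assms by (simp add: fractional_brownian_motion_def)
  from this[rule_format, of "{t}" "\<lambda>_. 1"] show ?thesis using assms by simp
qed

text \<open>For \<open>t > 0\<close> the second moment of \<open>W t\<close> is nonzero, and a nonzero Bochner integral exists as a
genuine integral. At \<open>t = 0\<close> the integral is zero, and square integrability follows from the
Gaussian law instead.\<close>

lemma fbm_increment_second_moment:
  assumes fbm: "fractional_brownian_motion M H W" and "0 \<le> p" "0 \<le> q" and H: "0 < H"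
  shows "has_bochner_integral M (\<lambda>\<omega>. (W q \<omega> - W p \<omega>) * (W q \<omega> - W p \<omega>)) (\<bar>q - p\<bar> powr (2 * H))"
proof -
  note gauss = fbm_centered_gaussian[OF fbm]
  have cov: "(\<integral>\<omega>. W t \<omega> * W r \<omega> \<partial>M) = (t powr (2 * H) + r powr (2 * H) - \<bar>t - r\<bar> powr (2 * H)) / 2"
    if "0 \<le> t" "0 \<le> r" for t r
    using fbm that by (simp add: fractional_brownian_motion_def)
  have meas: "W t \<in> borel_measurable M" if "0 \<le> t" for t
    using gauss[OF that] by (simp add: centered_gaussian_def)
  have sq: "integrable M (\<lambda>\<omega>. W t \<omega> * W t \<omega>)" if "0 \<le> t" for t
  proof (cases "t = 0")
    case True
    have "AE \<omega> in M. W t \<omega> = 0"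
      using True H by (intro centered_gaussian_zero_second_moment gauss) (auto simp: cov)
    then have "integrable M (\<lambda>\<omega>. W t \<omega> * W t \<omega>) \<longleftrightarrow> integrable M (\<lambda>\<omega>. 0 :: real)"
      using meas[OF that] by (intro integrable_cong_AE) auto
    then show ?thesis by simp
  next
    case False
    then have "(\<integral>\<omega>. W t \<omega> * W t \<omega> \<partial>M) \<noteq> 0" using that by (simp add: cov)
    then show ?thesis using not_integrable_integral_eq by blast
  qed
  have prod: "integrable M (\<lambda>\<omega>. W t \<omega> * W r \<omega>)" if "0 \<le> t" "0 \<le> r" for t r
  proof (rule Bochner_Integration.integrable_bound)
    show "integrable M (\<lambda>\<omega>. W t \<omega> * W t \<omega> + W r \<omega> * W r \<omega>)" using sq that by auto
    show "(\<lambda>\<omega>. W t \<omega> * W r \<omega>) \<in> borel_measurable M" using meas that by auto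
    have "norm (u * v) \<le> norm (u * u + v * v)" for u v :: real
    proof -
      have "2 * (\<bar>u\<bar> * \<bar>v\<bar>) \<le> u * u + v * v"
        using sum_squares_bound[of "\<bar>u\<bar>" "\<bar>v\<bar>"] by (simp add: power2_eq_square mult.assoc)
      moreover have "0 \<le> \<bar>u\<bar> * \<bar>v\<bar>" by simp
      ultimately show ?thesis unfolding real_norm_def abs_mult by linarith
    qed
    then show "AE \<omega> in M. norm (W t \<omega> * W r \<omega>) \<le> norm (W t \<omega> * W t \<omega> + W r \<omega> * W r \<omega>)"
      by (intro AE_I2)
  qed
  have hb: "has_bochner_integral M (\<lambda>\<omega>. W t \<omega> * W r \<omega>) ((t powr (2 * H) + r powr (2 * H) - \<bar>t - r\<bar> powr (2 * H)) / 2)"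
    if "0 \<le> t" "0 \<le> r" for t r
    using prod[OF that] cov[OF that] by (simp add: has_bochner_integral_iff)
  have "has_bochner_integral M (\<lambda>\<omega>. W q \<omega> * W q \<omega> + W p \<omega> * W p \<omega> - 2 * (W q \<omega> * W p \<omega>))
    ((q powr (2 * H) + q powr (2 * H) - \<bar>q - q\<bar> powr (2 * H)) / 2 + (p powr (2 * H) + p powr (2 * H) - \<bar>p - p\<bar> powr (2 * H)) / 2
     - 2 * ((q powr (2 * H) + p powr (2 * H) - \<bar>q - p\<bar> powr (2 * H)) / 2))"
    using assms by (intro has_bochner_integral_add has_bochner_integral_diff has_bochner_integral_mult_right hb)
  moreover have "(q powr (2 * H) + q powr (2 * H) - \<bar>q - q\<bar> powr (2 * H)) / 2 + (p powr (2 * H) + p powr (2 * H) - \<bar>p - p\<bar> powr (2 * H)) / 2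
     - 2 * ((q powr (2 * H) + p powr (2 * H) - \<bar>q - p\<bar> powr (2 * H)) / 2) = \<bar>q - p\<bar> powr (2 * H)"
    by (simp add: field_simps)
  ultimately show ?thesis by (simp add: algebra_simps)
qed

lemma step_integral_second_moment:
  assumes "fractional_brownian_motion M H W" "0 < H" "\<forall>(c, a, b)\<in>set ps. 0 \<le> a \<and> a \<le> b"
  shows "has_bochner_integral M (\<lambda>\<omega>. (step_integral W ps \<omega>)\<^sup>2) (increment_form H ps)"
proof -
  have "has_bochner_integral M (\<lambda>\<omega>. 1 * ((\<Sum>(c, a, b)\<leftarrow>ps. c * (W b \<omega> - W a \<omega>)) * (\<Sum>(c, a, b)\<leftarrow>ps. c * (W b \<omega> - W a \<omega>))))
    (increment_form H ps)"
    using assms fbm_increment_second_moment[OF assms(1) _ _ assms(2)]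
    by (intro has_bochner_integral_increment_form) force+
  then show ?thesis by (simp add: step_integral_def power2_eq_square)
qed

lemma step_fun_measurable [measurable]: "step_fun ps \<in> borel_measurable borel"
proof (induction ps)
  case Nil
  have "step_fun [] = (\<lambda>r. 0)" by (simp add: step_fun_def fun_eq_iff)
  then show ?case by simp
next
  case (Cons x ps)
  obtain c a b where x: "x = (c, a, b)" by (cases x)
  have "step_fun (x # ps) = (\<lambda>r. c * indicator {a<..b} r + step_fun ps r)" by (simp add: step_fun_def x fun_eq_iff)
  then show ?case using Cons by simp
qed

lemma step_fun_increments:
  assumes "\<forall>(c, a, b)\<in>set ps. 0 \<le> a \<and> a \<le> b"
  shows "step_fun ps r = (\<Sum>(c, a, b)\<leftarrow>ps. c * (indicator {0<..b} r - indicator {0<..a} r))"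
  unfolding step_fun_def using assms
  by (intro arg_cong[where f = sum_list] map_cong refl) (auto simp: indicator_def split: prod.splits)

text \<open>For \<open>H \<le> 1/2\<close> this is an isometry. For \<open>H > 1/2\<close> absolute values inside \<open>fbm_norm_sq\<close> leave an
inequality.\<close>

lemma increment_form_le_fbm_norm_sq:
  assumes H: "0 < H" "H < 1" and ps: "\<forall>(c, a, b)\<in>set ps. 0 \<le> a \<and> a \<le> b"
  shows "ennreal (increment_form H ps) \<le> fbm_norm_sq H (step_fun ps)"
proof -
  have ps': "\<forall>(c, a, b)\<in>set ps. 0 \<le> a \<and> 0 \<le> b" using ps by force
  let ?I = "\<lambda>t r. indicator {0<..t} r :: real"
  \<comment> \<open>up to sign, an increment of the family \<open>?I\<close> is the indicator of an interval\<close>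
  have incr: "?I q r - ?I p r = sgn (q - p) * indicator {min p q<..max p q} r" if "0 \<le> p" "0 \<le> q" for p q r
    using that by (auto simp: indicator_def sgn_if min_def max_def)
  have sgn2: "sgn (q - p) * u * (sgn (q - p) * v) = u * v" if "p \<noteq> q" for p q u v :: real
    using that by (auto simp: sgn_if)
  have interval: "fbm_norm_sq H (indicator {min p q<..max p q}) = ennreal (\<bar>q - p\<bar> powr (2 * H))" for p q
    using fbm_norm_sq_interval[of "min p q" "max p q" H] H by (simp add: max_def min_def abs_if)
  show ?thesis
  proof (cases H "1/2 :: real" rule: linorder_cases)
    case less
    let ?c = "H * (1 - 2 * H) / 2" and ?N = "lborel \<Otimes>\<^sub>M lborel :: (real \<times> real) measure"
    define k where "k z = ?c * \<bar>fst z - snd z\<bar> powr (2 * H - 2)" for z :: "real \<times> real"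
    have k: "k \<in> borel_measurable ?N" "\<And>z. 0 \<le> k z" using less H unfolding k_def by auto
    note [measurable] = k(1)
    have norm_eq: "fbm_norm_sq H f = (\<integral>\<^sup>+z. ennreal (k z * ((f (fst z) - f (snd z)) * (f (fst z) - f (snd z)))) \<partial>?N)"
      if [measurable]: "f \<in> borel_measurable borel" for f
    proof -
      have "fbm_norm_sq H f = ennreal ?c * (\<integral>\<^sup>+z. ennreal ((f (fst z) - f (snd z))\<^sup>2 * \<bar>fst z - snd z\<bar> powr (2 * H - 2)) \<partial>?N)"
        using less by (simp add: fbm_norm_sq_def lborel.nn_integral_fst[symmetric])
      also have "\<dots> = (\<integral>\<^sup>+z. ennreal ?c * ennreal ((f (fst z) - f (snd z))\<^sup>2 * \<bar>fst z - snd z\<bar> powr (2 * H - 2)) \<partial>?N)"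
        by (rule nn_integral_cmult[symmetric]) measurable
      also have "\<dots> = (\<integral>\<^sup>+z. ennreal (k z * ((f (fst z) - f (snd z)) * (f (fst z) - f (snd z)))) \<partial>?N)"
        using less H by (intro nn_integral_cong) (simp add: ennreal_mult'[symmetric] k_def power2_eq_square mult_ac)
      finally show ?thesis .
    qed
    let ?x = "\<lambda>t z. ?I t (fst z) - ?I t (snd z)"
    have "has_bochner_integral ?N (\<lambda>z. k z * ((?x q z - ?x p z) * (?x q z - ?x p z))) (\<bar>q - p\<bar> powr (2 * H))"
      if pq: "0 \<le> p" "0 \<le> q" for p q
    proof (cases "p = q")
      case False
      let ?J = "indicator {min p q<..max p q} :: real \<Rightarrow> real"
      have "?x q z - ?x p z = sgn (q - p) * (?J (fst z) - ?J (snd z))" for z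
        using incr[OF pq, of "fst z"] incr[OF pq, of "snd z"] by (simp add: algebra_simps)
      then have "(?x q z - ?x p z) * (?x q z - ?x p z) = (?J (fst z) - ?J (snd z)) * (?J (fst z) - ?J (snd z))" for z
        by (simp only: sgn2[OF False])
      moreover have "has_bochner_integral ?N (\<lambda>z. k z * ((?J (fst z) - ?J (snd z)) * (?J (fst z) - ?J (snd z)))) (\<bar>q - p\<bar> powr (2 * H))"
        using interval[of p q] k(2)
        by (intro has_bochner_integral_nn_integral) (auto simp: norm_eq)
      ultimately show ?thesis by simp
    qed (simp add: has_bochner_integral_zero)
    note form = has_bochner_integral_increment_form[of ?N k ?x ?x H, OF this ps']
    have "has_bochner_integral ?N (\<lambda>z. k z * ((step_fun ps (fst z) - step_fun ps (snd z)) * (step_fun ps (fst z) - step_fun ps (snd z)))) (increment_form H ps)"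
    proof -
      have "(\<Sum>(c, a, b)\<leftarrow>ps. c * (?x b z - ?x a z)) = step_fun ps (fst z) - step_fun ps (snd z)" for z
        unfolding step_fun_increments[OF ps] sum_list_subtractf[symmetric]
        by (intro arg_cong[where f = sum_list] map_cong refl) (auto simp: algebra_simps)
      then show ?thesis using form by simp
    qed
    then have "(\<integral>\<^sup>+z. ennreal (k z * ((step_fun ps (fst z) - step_fun ps (snd z)) * (step_fun ps (fst z) - step_fun ps (snd z)))) \<partial>?N)
        = ennreal (increment_form H ps)"
      using k(2) by (subst nn_integral_eq_integral) (auto simp: has_bochner_integral_iff)
    then show ?thesis by (simp add: norm_eq)
  next
    case equal
    have norm_eq: "fbm_norm_sq H f = (\<integral>\<^sup>+z. ennreal (1 * (f z * f z)) \<partial>lborel)" for f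
      using equal by (simp add: fbm_norm_sq_def power2_eq_square)
    have "has_bochner_integral lborel (\<lambda>z. 1 * ((?I q z - ?I p z) * (?I q z - ?I p z))) (\<bar>q - p\<bar> powr (2 * H))"
      if pq: "0 \<le> p" "0 \<le> q" for p q
    proof (cases "p = q")
      case False
      let ?J = "indicator {min p q<..max p q} :: real \<Rightarrow> real"
      have "(?I q z - ?I p z) * (?I q z - ?I p z) = ?J z * ?J z" for z
        by (simp only: incr[OF pq] sgn2[OF False])
      moreover have "has_bochner_integral lborel (\<lambda>z. 1 * (?J z * ?J z)) (\<bar>q - p\<bar> powr (2 * H))"
        using interval[of p q] by (intro has_bochner_integral_nn_integral) (auto simp: norm_eq)
      ultimately show ?thesis by simp
    qed (simp add: has_bochner_integral_zero)
    from has_bochner_integral_increment_form[of lborel "\<lambda>_. 1" ?I ?I H, OF this ps']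
    have "has_bochner_integral lborel (\<lambda>z. 1 * (step_fun ps z * step_fun ps z)) (increment_form H ps)"
      by (simp only: step_fun_increments[OF ps])
    then have "(\<integral>\<^sup>+z. ennreal (1 * (step_fun ps z * step_fun ps z)) \<partial>lborel) = ennreal (increment_form H ps)"
      by (subst nn_integral_eq_integral) (auto simp: has_bochner_integral_iff)
    then show ?thesis by (simp add: norm_eq)
  next
    case greater
    let ?c = "H * (2 * H - 1)" and ?N = "lborel \<Otimes>\<^sub>M lborel :: (real \<times> real) measure"
    define k where "k z = ?c * \<bar>fst z - snd z\<bar> powr (2 * H - 2)" for z :: "real \<times> real"
    have k: "k \<in> borel_measurable ?N" "\<And>z. 0 \<le> k z" using greater H unfolding k_def by auto
    note [measurable] = k(1)
    have norm_eq: "fbm_norm_sq H f = (\<integral>\<^sup>+z. ennreal (k z * (\<bar>f (fst z)\<bar> * \<bar>f (snd z)\<bar>)) \<partial>?N)"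
      if [measurable]: "f \<in> borel_measurable borel" for f
    proof -
      have "fbm_norm_sq H f = ennreal ?c * (\<integral>\<^sup>+z. ennreal (\<bar>f (fst z)\<bar> * \<bar>f (snd z)\<bar> * \<bar>fst z - snd z\<bar> powr (2 * H - 2)) \<partial>?N)"
        using greater by (simp add: fbm_norm_sq_def lborel.nn_integral_fst[symmetric])
      also have "\<dots> = (\<integral>\<^sup>+z. ennreal ?c * ennreal (\<bar>f (fst z)\<bar> * \<bar>f (snd z)\<bar> * \<bar>fst z - snd z\<bar> powr (2 * H - 2)) \<partial>?N)"
        by (rule nn_integral_cmult[symmetric]) measurable
      also have "\<dots> = (\<integral>\<^sup>+z. ennreal (k z * (\<bar>f (fst z)\<bar> * \<bar>f (snd z)\<bar>)) \<partial>?N)"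
        using greater H by (intro nn_integral_cong) (simp add: ennreal_mult'[symmetric] k_def mult_ac)
      finally show ?thesis .
    qed
    let ?x = "\<lambda>t z. ?I t (fst z)" and ?y = "\<lambda>t z. ?I t (snd z)"
    have "has_bochner_integral ?N (\<lambda>z. k z * ((?x q z - ?x p z) * (?y q z - ?y p z))) (\<bar>q - p\<bar> powr (2 * H))"
      if pq: "0 \<le> p" "0 \<le> q" for p q
    proof (cases "p = q")
      case False
      let ?J = "indicator {min p q<..max p q} :: real \<Rightarrow> real"
      have "(?x q z - ?x p z) * (?y q z - ?y p z) = ?J (fst z) * ?J (snd z)" for z
        by (simp only: incr[OF pq] sgn2[OF False])
      moreover have "has_bochner_integral ?N (\<lambda>z. k z * (?J (fst z) * ?J (snd z))) (\<bar>q - p\<bar> powr (2 * H))"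
        using interval[of p q] k(2)
        by (intro has_bochner_integral_nn_integral) (auto simp: norm_eq)
      ultimately show ?thesis by simp
    qed (simp add: has_bochner_integral_zero)
    from has_bochner_integral_increment_form[of ?N k ?x ?y H, OF this ps']
    have int: "has_bochner_integral ?N (\<lambda>z. k z * (step_fun ps (fst z) * step_fun ps (snd z))) (increment_form H ps)"
      by (simp only: step_fun_increments[OF ps])
    have "ennreal (increment_form H ps) \<le> ennreal (\<integral>z. norm (k z * (step_fun ps (fst z) * step_fun ps (snd z))) \<partial>?N)"
      using has_bochner_integral_integral_eq[OF int] integral_abs_bound[of ?N "\<lambda>z. k z * (step_fun ps (fst z) * step_fun ps (snd z))"]
      by (intro ennreal_leI) simp
    also have "\<dots> = (\<integral>\<^sup>+z. ennreal (norm (k z * (step_fun ps (fst z) * step_fun ps (snd z)))) \<partial>?N)"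
      using int by (subst nn_integral_eq_integral) (auto simp: has_bochner_integral_iff)
    also have "\<dots> = fbm_norm_sq H (step_fun ps)"
      using k(2) by (simp add: norm_eq abs_mult)
    finally show ?thesis .
  qed
qed


section \<open>Second moments of Wiener integrals\<close>

lemma ennreal_tendsto_0_of_square:
  fixes e :: "nat \<Rightarrow> ennreal"
  assumes "(\<lambda>n. e n * e n) \<longlonglongrightarrow> 0"
  shows "e \<longlonglongrightarrow> 0"
proof (rule order_tendstoI)
  fix b :: ennreal assume b: "0 < b"
  then have "0 < b * b" by (simp add: ennreal_zero_less_mult_iff)
  then have "\<forall>\<^sub>F n in sequentially. e n * e n < b * b" by (rule order_tendstoD(2)[OF assms])
  then show "\<forall>\<^sub>F n in sequentially. e n < b"
    by (rule eventually_mono) (meson mult_mono' not_le zero_le)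
qed simp

lemma fbm_norm_sq_plus_le:
  assumes "H \<le> 1/2" "0 < H" and [measurable]: "f \<in> borel_measurable borel" "g \<in> borel_measurable borel"
  shows "fbm_norm_sq H (\<lambda>r. f r + g r) \<le> 2 * fbm_norm_sq H f + 2 * fbm_norm_sq H g"
proof -
  have sq: "(u + v)\<^sup>2 \<le> 2 * u\<^sup>2 + 2 * v\<^sup>2" for u v :: real
    using zero_le_power2[of "u - v"] by (simp add: power2_sum power2_diff)
  have sqk: "ennreal ((u + v)\<^sup>2 * k) \<le> 2 * ennreal (u\<^sup>2 * k) + 2 * ennreal (v\<^sup>2 * k)" if "0 \<le> k" for u v k :: real
  proof -
    have "(u + v)\<^sup>2 * k \<le> 2 * (u\<^sup>2 * k) + 2 * (v\<^sup>2 * k)"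
      using mult_right_mono[OF sq that, of u v] by (simp add: algebra_simps)
    then have "ennreal ((u + v)\<^sup>2 * k) \<le> ennreal (2 * (u\<^sup>2 * k) + 2 * (v\<^sup>2 * k))" by (rule ennreal_leI)
    then show ?thesis using that by (simp add: ennreal_plus ennreal_mult'')
  qed
  show ?thesis
  proof (cases "H = 1/2")
    case True
    have "(\<integral>\<^sup>+x. ennreal ((f x + g x)\<^sup>2) \<partial>lborel) \<le> (\<integral>\<^sup>+x. 2 * ennreal ((f x)\<^sup>2) + 2 * ennreal ((g x)\<^sup>2) \<partial>lborel)"
      using sqk[of 1] by (intro nn_integral_mono) simp
    also have "\<dots> = 2 * (\<integral>\<^sup>+x. ennreal ((f x)\<^sup>2) \<partial>lborel) + 2 * (\<integral>\<^sup>+x. ennreal ((g x)\<^sup>2) \<partial>lborel)"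
      by (simp add: nn_integral_add nn_integral_cmult)
    finally show ?thesis using True by (simp add: fbm_norm_sq_def)
  next
    case False
    let ?k = "\<lambda>x y :: real. \<bar>x - y\<bar> powr (2 * H - 2)"
    have "(\<integral>\<^sup>+x. \<integral>\<^sup>+y. ennreal ((f x + g x - (f y + g y))\<^sup>2 * ?k x y) \<partial>lborel \<partial>lborel) \<le>
        (\<integral>\<^sup>+x. \<integral>\<^sup>+y. 2 * ennreal ((f x - f y)\<^sup>2 * ?k x y) + 2 * ennreal ((g x - g y)\<^sup>2 * ?k x y) \<partial>lborel \<partial>lborel)"
    proof (intro nn_integral_mono)
      fix x y
      show "ennreal ((f x + g x - (f y + g y))\<^sup>2 * ?k x y) \<le> 2 * ennreal ((f x - f y)\<^sup>2 * ?k x y) + 2 * ennreal ((g x - g y)\<^sup>2 * ?k x y)"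
        using sqk[of "?k x y" "f x - f y" "g x - g y"] by (simp add: algebra_simps)
    qed
    also have "\<dots> = 2 * (\<integral>\<^sup>+x. \<integral>\<^sup>+y. ennreal ((f x - f y)\<^sup>2 * ?k x y) \<partial>lborel \<partial>lborel)
        + 2 * (\<integral>\<^sup>+x. \<integral>\<^sup>+y. ennreal ((g x - g y)\<^sup>2 * ?k x y) \<partial>lborel \<partial>lborel)"
      by (simp add: nn_integral_add nn_integral_cmult)
    finally have "ennreal (H * (1 - 2 * H) / 2) * (\<integral>\<^sup>+x. \<integral>\<^sup>+y. ennreal ((f x + g x - (f y + g y))\<^sup>2 * ?k x y) \<partial>lborel \<partial>lborel) \<le>
        ennreal (H * (1 - 2 * H) / 2) * (2 * (\<integral>\<^sup>+x. \<integral>\<^sup>+y. ennreal ((f x - f y)\<^sup>2 * ?k x y) \<partial>lborel \<partial>lborel)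
        + 2 * (\<integral>\<^sup>+x. \<integral>\<^sup>+y. ennreal ((g x - g y)\<^sup>2 * ?k x y) \<partial>lborel \<partial>lborel))"
      by (rule mult_left_mono) simp
    then show ?thesis using False assms(1) by (simp add: fbm_norm_sq_def distrib_left mult.left_commute)
  qed
qed

text \<open>For \<open>H > 1/2\<close> the squared norm is a double integral against a kernel. The mixed terms of a sum
\<open>f + d\<close> are controlled by the boundedness of \<open>f\<close>, since the integral of \<open>\<bar>x - y\<bar>\<^bsup>2H - 2\<^esup>\<close> over
\<open>0 \<le> y \<le> t\<close> is bounded in \<open>x\<close>.\<close>

lemma fbm_norm_sq_plus_le_bounded:
  assumes H: "1/2 < H" "H < 1" and [measurable]: "f \<in> borel_measurable borel" "d \<in> borel_measurable borel"
    and f: "\<And>r. \<bar>f r\<bar> \<le> indicator {0..t} r" and d: "\<And>r. r \<notin> {0..t} \<Longrightarrow> d r = 0"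
  shows "fbm_norm_sq H (\<lambda>r. f r + d r) \<le>
    fbm_norm_sq H f + ennreal (4 * H * t powr (2 * H - 1)) * (\<integral>\<^sup>+r. ennreal \<bar>d r\<bar> \<partial>lborel) + fbm_norm_sq H d"
proof -
  let ?k = "\<lambda>x y :: real. \<bar>x - y\<bar> powr (2 * H - 2)" and ?c = "H * (2 * H - 1)"
  have c: "0 < ?c" using H by simp
  let ?m = "\<lambda>x y. ennreal (\<bar>d x\<bar> * indicator {0..t} y * ?k x y)"
  have cross: "(\<integral>\<^sup>+x. \<integral>\<^sup>+y. ?m x y \<partial>lborel \<partial>lborel) \<le> ennreal (2 * t powr (2 * H - 1) / (2 * H - 1)) * (\<integral>\<^sup>+r. ennreal \<bar>d r\<bar> \<partial>lborel)"
  proof -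
    have "(\<integral>\<^sup>+y. ?m x y \<partial>lborel) \<le> ennreal (2 * t powr (2 * H - 1) / (2 * H - 1)) * ennreal \<bar>d x\<bar>" for x
    proof (cases "x \<in> {0..t}")
      case True
      have "(\<integral>\<^sup>+y. ennreal (indicator {0..t} y * ?k x y) \<partial>lborel) \<le>
        (\<integral>\<^sup>+y. ennreal (indicator {0..x} y * (x - y) powr (2 * H - 2)) + ennreal (indicator {x..t} y * (y - x) powr (2 * H - 2)) \<partial>lborel)"
        using True by (intro nn_integral_mono) (auto simp: indicator_def)
      also have "\<dots> = ennreal ((x - 0) powr (2 * H - 2 + 1) / (2 * H - 2 + 1)) + ennreal ((t - x) powr (2 * H - 2 + 1) / (2 * H - 2 + 1))"
        using True H by (subst nn_integral_add) (auto simp: nn_integral_powr_near_left nn_integral_powr_near_right)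
      also have "\<dots> \<le> ennreal (t powr (2 * H - 1) / (2 * H - 1)) + ennreal (t powr (2 * H - 1) / (2 * H - 1))"
        using True H by (intro add_mono ennreal_leI) (auto intro!: divide_right_mono powr_mono2)
      also have "\<dots> = ennreal (2 * t powr (2 * H - 1) / (2 * H - 1))"
        using H by (simp add: ennreal_plus[symmetric] del: ennreal_plus)
      finally have "ennreal \<bar>d x\<bar> * (\<integral>\<^sup>+y. ennreal (indicator {0..t} y * ?k x y) \<partial>lborel) \<le>
          ennreal \<bar>d x\<bar> * ennreal (2 * t powr (2 * H - 1) / (2 * H - 1))"
        by (rule mult_left_mono) simp
      moreover have "(\<integral>\<^sup>+y. ?m x y \<partial>lborel) = ennreal \<bar>d x\<bar> * (\<integral>\<^sup>+y. ennreal (indicator {0..t} y * ?k x y) \<partial>lborel)"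
        by (subst nn_integral_cmult[symmetric]) (auto intro!: nn_integral_cong simp: ennreal_mult'[symmetric] mult_ac)
      ultimately show ?thesis by (simp add: mult.commute)
    next
      case False
      then show ?thesis using d by simp
    qed
    then have "(\<integral>\<^sup>+x. \<integral>\<^sup>+y. ?m x y \<partial>lborel \<partial>lborel) \<le> (\<integral>\<^sup>+x. ennreal (2 * t powr (2 * H - 1) / (2 * H - 1)) * ennreal \<bar>d x\<bar> \<partial>lborel)"
      by (intro nn_integral_mono)
    then show ?thesis by (subst (asm) nn_integral_cmult) auto
  qed
  have pw: "ennreal (\<bar>f x + d x\<bar> * \<bar>f y + d y\<bar> * ?k x y) \<le>
      ennreal (\<bar>f x\<bar> * \<bar>f y\<bar> * ?k x y) + (?m x y + ?m y x) + ennreal (\<bar>d x\<bar> * \<bar>d y\<bar> * ?k x y)" for x y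
  proof -
    have "\<bar>f x + d x\<bar> * \<bar>f y + d y\<bar> \<le> (\<bar>f x\<bar> + \<bar>d x\<bar>) * (\<bar>f y\<bar> + \<bar>d y\<bar>)"
      by (intro mult_mono abs_triangle_ineq) auto
    also have "\<dots> = \<bar>f x\<bar> * \<bar>f y\<bar> + (\<bar>d x\<bar> * \<bar>f y\<bar> + \<bar>d y\<bar> * \<bar>f x\<bar>) + \<bar>d x\<bar> * \<bar>d y\<bar>"
      by (simp add: algebra_simps)
    also have "\<dots> \<le> \<bar>f x\<bar> * \<bar>f y\<bar> + (\<bar>d x\<bar> * indicator {0..t} y + \<bar>d y\<bar> * indicator {0..t} x) + \<bar>d x\<bar> * \<bar>d y\<bar>"
      by (intro add_mono mult_left_mono f order_refl abs_ge_zero)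
    finally have "\<bar>f x + d x\<bar> * \<bar>f y + d y\<bar> * ?k x y \<le>
        (\<bar>f x\<bar> * \<bar>f y\<bar> + (\<bar>d x\<bar> * indicator {0..t} y + \<bar>d y\<bar> * indicator {0..t} x) + \<bar>d x\<bar> * \<bar>d y\<bar>) * ?k x y"
      by (rule mult_right_mono) simp
    then have "ennreal (\<bar>f x + d x\<bar> * \<bar>f y + d y\<bar> * ?k x y) \<le>
        ennreal (\<bar>f x\<bar> * \<bar>f y\<bar> * ?k x y + (\<bar>d x\<bar> * indicator {0..t} y * ?k x y + \<bar>d y\<bar> * indicator {0..t} x * ?k y x) + \<bar>d x\<bar> * \<bar>d y\<bar> * ?k x y)"
      by (intro ennreal_leI) (simp add: algebra_simps abs_minus_commute)
    then show ?thesis by (simp add: ennreal_plus)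
  qed
  have "(\<integral>\<^sup>+x. \<integral>\<^sup>+y. ennreal (\<bar>f x + d x\<bar> * \<bar>f y + d y\<bar> * ?k x y) \<partial>lborel \<partial>lborel) \<le>
     (\<integral>\<^sup>+x. \<integral>\<^sup>+y. ennreal (\<bar>f x\<bar> * \<bar>f y\<bar> * ?k x y) + (?m x y + ?m y x) + ennreal (\<bar>d x\<bar> * \<bar>d y\<bar> * ?k x y) \<partial>lborel \<partial>lborel)"
    by (intro nn_integral_mono pw)
  also have "\<dots> = (\<integral>\<^sup>+x. \<integral>\<^sup>+y. ennreal (\<bar>f x\<bar> * \<bar>f y\<bar> * ?k x y) \<partial>lborel \<partial>lborel)
     + (\<integral>\<^sup>+x. \<integral>\<^sup>+y. ?m x y + ?m y x \<partial>lborel \<partial>lborel)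
     + (\<integral>\<^sup>+x. \<integral>\<^sup>+y. ennreal (\<bar>d x\<bar> * \<bar>d y\<bar> * ?k x y) \<partial>lborel \<partial>lborel)"
    by (simp add: nn_integral_add)
  also have "(\<integral>\<^sup>+x. \<integral>\<^sup>+y. ?m x y + ?m y x \<partial>lborel \<partial>lborel) = 2 * (\<integral>\<^sup>+x. \<integral>\<^sup>+y. ?m x y \<partial>lborel \<partial>lborel)"
    by (rule nn_integral_symmetrize) measurable
  finally have "ennreal ?c * (\<integral>\<^sup>+x. \<integral>\<^sup>+y. ennreal (\<bar>f x + d x\<bar> * \<bar>f y + d y\<bar> * ?k x y) \<partial>lborel \<partial>lborel) \<le>
     ennreal ?c * ((\<integral>\<^sup>+x. \<integral>\<^sup>+y. ennreal (\<bar>f x\<bar> * \<bar>f y\<bar> * ?k x y) \<partial>lborel \<partial>lborel)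
     + 2 * (ennreal (2 * t powr (2 * H - 1) / (2 * H - 1)) * (\<integral>\<^sup>+r. ennreal \<bar>d r\<bar> \<partial>lborel))
     + (\<integral>\<^sup>+x. \<integral>\<^sup>+y. ennreal (\<bar>d x\<bar> * \<bar>d y\<bar> * ?k x y) \<partial>lborel \<partial>lborel))"
    by (intro mult_left_mono order_trans[OF _ add_mono[OF add_mono[OF order_refl mult_left_mono[OF cross]] order_refl]]) auto
  moreover have "ennreal ?c * (2 * (ennreal (2 * t powr (2 * H - 1) / (2 * H - 1)) * X)) = ennreal (4 * H * t powr (2 * H - 1)) * X" for X
  proof -
    have prod: "ennreal a * (2 * ennreal b) = ennreal (a * (2 * b))" if "0 \<le> a" "0 \<le> b" for a b :: real
      using that by (simp add: ennreal_mult)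
    have "ennreal ?c * (2 * ennreal (2 * t powr (2 * H - 1) / (2 * H - 1))) = ennreal (?c * (2 * (2 * t powr (2 * H - 1) / (2 * H - 1))))"
      using c H by (intro prod) auto
    also have "?c * (2 * (2 * t powr (2 * H - 1) / (2 * H - 1))) = 4 * H * t powr (2 * H - 1)"
      using H by (simp add: field_simps)
    finally have "ennreal ?c * (2 * ennreal (2 * t powr (2 * H - 1) / (2 * H - 1))) = ennreal (4 * H * t powr (2 * H - 1))" .
    moreover have "ennreal ?c * (2 * (Y * X)) = ennreal ?c * (2 * Y) * X" for Y by (simp only: mult.assoc)
    ultimately show ?thesis by (simp only:)
  qed
  ultimately show ?thesis using H by (simp add: fbm_norm_sq_def distrib_left)
qed

text \<open>On \<open>[0, t]\<^sup>2\<close> the kernel \<open>\<bar>x - y\<bar>\<^bsup>2H - 2\<^esup>\<close> is at least \<open>t\<^bsup>2H - 2\<^esup>\<close>. Hence an error that is small in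
norm is small in \<open>L\<^sup>1\<close>, and so are the mixed terms in the preceding estimate.\<close>

lemma nn_integral_abs_sq_le_fbm_norm_sq:
  assumes H: "1/2 < H" "H < 1" and [measurable]: "d \<in> borel_measurable borel"
    and d: "\<And>r. r \<notin> {0..t} \<Longrightarrow> d r = 0" and t: "0 < t"
  shows "ennreal (H * (2 * H - 1) * t powr (2 * H - 2)) * ((\<integral>\<^sup>+r. ennreal \<bar>d r\<bar> \<partial>lborel) * (\<integral>\<^sup>+r. ennreal \<bar>d r\<bar> \<partial>lborel))
    \<le> fbm_norm_sq H d"
proof -
  let ?k = "\<lambda>x y :: real. \<bar>x - y\<bar> powr (2 * H - 2)" and ?c = "H * (2 * H - 1)" and ?D = "\<integral>\<^sup>+r. ennreal \<bar>d r\<bar> \<partial>lborel"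
  have "ennreal (t powr (2 * H - 2)) * (?D * ?D) = (\<integral>\<^sup>+x. \<integral>\<^sup>+y. ennreal (t powr (2 * H - 2)) * (ennreal \<bar>d x\<bar> * ennreal \<bar>d y\<bar>) \<partial>lborel \<partial>lborel)"
    by (simp add: nn_integral_cmult nn_integral_multc)
  also have "\<dots> \<le> (\<integral>\<^sup>+x. \<integral>\<^sup>+y. ennreal (\<bar>d x\<bar> * \<bar>d y\<bar> * ?k x y) \<partial>lborel \<partial>lborel)"
  proof (rule nn_integral_mono)
    fix x :: real
    show "(\<integral>\<^sup>+y. ennreal (t powr (2 * H - 2)) * (ennreal \<bar>d x\<bar> * ennreal \<bar>d y\<bar>) \<partial>lborel)
       \<le> (\<integral>\<^sup>+y. ennreal (\<bar>d x\<bar> * \<bar>d y\<bar> * ?k x y) \<partial>lborel)"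
    proof (rule nn_integral_mono_AE, rule eventually_mono[OF AE_lborel_singleton[of x]])
      fix y :: real assume neq: "y \<noteq> x"
      have "t powr (2 * H - 2) * (\<bar>d x\<bar> * \<bar>d y\<bar>) \<le> \<bar>d x\<bar> * \<bar>d y\<bar> * ?k x y"
      proof (cases "x \<in> {0..t} \<and> y \<in> {0..t}")
        case True
        then have "t powr (2 * H - 2) \<le> ?k x y" using neq H by (intro powr_mono2') auto
        then show ?thesis by (simp add: mult.commute[of "t powr _"] mult_left_mono)
      next
        case False
        then have "d x = 0 \<or> d y = 0" using d by blast
        then show ?thesis by auto
      qed
      then show "ennreal (t powr (2 * H - 2)) * (ennreal \<bar>d x\<bar> * ennreal \<bar>d y\<bar>) \<le> ennreal (\<bar>d x\<bar> * \<bar>d y\<bar> * ?k x y)"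
        by (simp add: ennreal_mult'[symmetric])
    qed
  qed
  finally have "ennreal ?c * (ennreal (t powr (2 * H - 2)) * (?D * ?D)) \<le> ennreal ?c * (\<integral>\<^sup>+x. \<integral>\<^sup>+y. ennreal (\<bar>d x\<bar> * \<bar>d y\<bar> * ?k x y) \<partial>lborel \<partial>lborel)"
    by (rule mult_left_mono) simp
  then show ?thesis using H by (simp add: fbm_norm_sq_def ennreal_mult'[symmetric] mult.assoc[symmetric])
qed

text \<open>The substitute for continuity of the norm along the approximations that define a Wiener integral:
the factor two is harmless, and its form is the same for all \<open>H\<close>.\<close>

lemma fbm_norm_sq_approximation:
  assumes H: "0 < H" "H < 1" and t: "0 \<le> t"
    and [measurable]: "f \<in> borel_measurable borel" "\<And>n. g n \<in> borel_measurable borel"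
    and f: "\<And>r. \<bar>f r\<bar> \<le> indicator {0..t} r" and g: "\<And>n r. r \<notin> {0..t} \<Longrightarrow> g n r = 0"
    and lim: "(\<lambda>n. fbm_norm_sq H (\<lambda>r. g n r - f r)) \<longlonglongrightarrow> 0"
  shows "\<exists>e. e \<longlonglongrightarrow> 0 \<and> (\<forall>n. fbm_norm_sq H (g n) \<le> 2 * fbm_norm_sq H f + e n)"
proof -
  define d where "d n r = g n r - f r" for n r
  have [measurable]: "d n \<in> borel_measurable borel" for n unfolding d_def by measurable
  have g_eq: "g n = (\<lambda>r. f r + d n r)" for n by (simp add: d_def)
  have lim: "(\<lambda>n. fbm_norm_sq H (d n)) \<longlonglongrightarrow> 0" using lim by (simp add: d_def[abs_def])
  have d: "d n r = 0" if "r \<notin> {0..t}" for n r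
    using f[of r] g[OF that, of n] that by (simp add: d_def)
  show ?thesis
  proof (cases "H \<le> 1/2")
    case True
    have "(\<lambda>n. 2 * fbm_norm_sq H (d n)) \<longlonglongrightarrow> 2 * 0"
      by (rule ennreal_tendsto_cmult[OF _ lim]) simp
    then show ?thesis
      using fbm_norm_sq_plus_le[OF True H(1), of f] unfolding g_eq
      by (intro exI[of _ "\<lambda>n. 2 * fbm_norm_sq H (d n)"]) auto
  next
    case False
    then have H': "1/2 < H" by simp
    let ?D = "\<lambda>n. \<integral>\<^sup>+r. ennreal \<bar>d n r\<bar> \<partial>lborel"
    \<comment> \<open>for \<open>t = 0\<close> the errors vanish off one point; otherwise their \<open>L\<^sup>1\<close> norms are controlled by the norm\<close>
    have D: "?D \<longlonglongrightarrow> 0"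
    proof (cases "t = 0")
      case True
      have "?D n = (\<integral>\<^sup>+r. 0 \<partial>(lborel::real measure))" for n
        by (intro nn_integral_cong_AE eventually_mono[OF AE_lborel_singleton[of 0]]) (use d True in auto)
      then show ?thesis by simp
    next
      case False
      then have t: "0 < t" using t by simp
      let ?q = "H * (2 * H - 1) * t powr (2 * H - 2)"
      have q: "0 < ?q" using H' t by simp
      have "?D n * ?D n \<le> ennreal (1 / ?q) * fbm_norm_sq H (d n)" for n
      proof -
        have "ennreal (1 / ?q) * (ennreal ?q * (?D n * ?D n)) \<le> ennreal (1 / ?q) * fbm_norm_sq H (d n)"
          by (intro mult_left_mono nn_integral_abs_sq_le_fbm_norm_sq H' H t d) auto
        moreover have "ennreal (1 / r) * ennreal r = 1" if "0 < r" for r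
          using that by (simp add: ennreal_mult'[symmetric])
        note this[OF q]
        ultimately show ?thesis by (simp only: mult.assoc[symmetric] mult_1)
      qed
      moreover have "(\<lambda>n. ennreal (1 / ?q) * fbm_norm_sq H (d n)) \<longlonglongrightarrow> ennreal (1 / ?q) * 0"
        by (rule ennreal_tendsto_cmult[OF _ lim]) simp
      ultimately have "(\<lambda>n. ?D n * ?D n) \<longlonglongrightarrow> 0"
        by (intro tendsto_sandwich[of "\<lambda>_. 0" "\<lambda>n. ?D n * ?D n" sequentially "\<lambda>n. ennreal (1 / ?q) * fbm_norm_sq H (d n)"]) auto
      then show ?thesis by (rule ennreal_tendsto_0_of_square)
    qed
    let ?e = "\<lambda>n. ennreal (4 * H * t powr (2 * H - 1)) * ?D n + fbm_norm_sq H (d n)"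
    have "?e \<longlonglongrightarrow> ennreal (4 * H * t powr (2 * H - 1)) * 0 + 0"
      by (intro tendsto_add ennreal_tendsto_cmult D lim) simp
    moreover have "fbm_norm_sq H (g n) \<le> 2 * fbm_norm_sq H f + ?e n" for n
    proof -
      have "fbm_norm_sq H (g n) \<le> fbm_norm_sq H f + ennreal (4 * H * t powr (2 * H - 1)) * ?D n + fbm_norm_sq H (d n)"
        unfolding g_eq by (rule fbm_norm_sq_plus_le_bounded[OF H' H(2) _ _ f d]) auto
      also have "\<dots> = fbm_norm_sq H f + ?e n" by (simp add: add.assoc)
      also have "\<dots> \<le> 2 * fbm_norm_sq H f + ?e n"
        by (intro add_right_mono) (simp add: mult_2)
      finally show ?thesis .
    qed
    ultimately show ?thesis by (intro exI[of _ ?e]) simp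
  qed
qed

text \<open>One factor two comes from comparing \<open>Z\<close> with a step integral, the other from comparing the norm of
the step function with that of \<open>f\<close>.\<close>

lemma wiener_integral_second_moment:
  assumes fbm: "fractional_brownian_motion M H W" and H: "0 < H" "H < 1" and t: "0 \<le> t"
    and wi: "has_wiener_integral M H W t f Z" and f: "\<And>r. r \<in> {0..t} \<Longrightarrow> \<bar>f r\<bar> \<le> 1"
  shows "(\<integral>\<^sup>+\<omega>. ennreal ((Z \<omega>)\<^sup>2) \<partial>M) \<le> 4 * fbm_norm_sq H (\<lambda>r. indicator {0..t} r * f r)"
proof -
  let ?F = "\<lambda>r. indicator {0..t} r * f r"
  have F[measurable]: "?F \<in> borel_measurable borel"
    using wi by (simp add: has_wiener_integral_def set_borel_measurable_def)
  obtain ps where ps: "\<And>n. \<forall>(c, a, b)\<in>set (ps n). 0 \<le> a \<and> a \<le> b \<and> b \<le> t"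
    and lim_f: "(\<lambda>n. fbm_norm_sq H (\<lambda>r. step_fun (ps n) r - ?F r)) \<longlonglongrightarrow> 0"
    and lim_Z: "(\<lambda>n. L2_norm M (\<lambda>\<omega>. step_integral W (ps n) \<omega> - Z \<omega>)) \<longlonglongrightarrow> 0"
    and Z: "Z \<in> L2 M"
    using wi unfolding has_wiener_integral_def by blast
  have ps': "\<forall>(c, a, b)\<in>set (ps n). 0 \<le> a \<and> a \<le> b" for n using ps[of n] by force
  have supp: "step_fun (ps n) r = 0" if "r \<notin> {0..t}" for n r
  proof -
    have "(case z of (c, a, b) \<Rightarrow> c * indicator {a<..b} r) = 0" if "z \<in> set (ps n)" for z
      using bspec[OF ps that] \<open>r \<notin> {0..t}\<close> by (auto simp: indicator_def split: prod.splits)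
    then have zero: "map (\<lambda>(c, a, b). c * indicator {a<..b} r) (ps n) = map (\<lambda>_. 0 :: real) (ps n)"
      by (intro map_cong) auto
    show ?thesis unfolding step_fun_def zero by simp
  qed
  have "\<bar>?F r\<bar> \<le> indicator {0..t} r" for r using f by (auto simp: indicator_def)
  from fbm_norm_sq_approximation[OF H t F step_fun_measurable this supp lim_f]
  obtain e where e: "e \<longlonglongrightarrow> 0" "\<And>n. fbm_norm_sq H (step_fun (ps n)) \<le> 2 * fbm_norm_sq H ?F + e n"
    by auto
  let ?X = "\<lambda>n. step_integral W (ps n)"
  note X = step_integral_second_moment[OF fbm H(1) ps']
  have W: "W p \<in> borel_measurable M" if "0 \<le> p" for p
    using fbm_centered_gaussian[OF fbm that] by (simp add: centered_gaussian_def)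
  have X_meas[measurable]: "?X n \<in> borel_measurable M" for n
  proof -
    have "(\<lambda>\<omega>. \<Sum>(c, a, b)\<leftarrow>xs. c * (W b \<omega> - W a \<omega>)) \<in> borel_measurable M"
      if "\<forall>(c, a, b)\<in>set xs. 0 \<le> a \<and> a \<le> b" for xs
      using that
    proof (induction xs)
      case (Cons x xs)
      obtain c a b where x: "x = (c, a, b)" by (cases x)
      have "0 \<le> a" "0 \<le> b" using Cons.prems by (auto simp: x)
      then show ?case using Cons W by (simp add: x)
    qed simp
    then show ?thesis using ps' by (simp add: step_integral_def[abs_def])
  qed
  have [measurable]: "Z \<in> borel_measurable M" and Z_int: "integrable M (\<lambda>\<omega>. (Z \<omega>)\<^sup>2)"
    using Z by (simp_all add: L2_def)
  have diff_int: "integrable M (\<lambda>\<omega>. (?X n \<omega> - Z \<omega>)\<^sup>2)" for n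
  proof (rule Bochner_Integration.integrable_bound)
    show "integrable M (\<lambda>\<omega>. 2 * (?X n \<omega>)\<^sup>2 + 2 * (Z \<omega>)\<^sup>2)"
      using X[of n] Z_int by (auto simp: has_bochner_integral_iff)
    have "(u - v)\<^sup>2 \<le> 2 * u\<^sup>2 + 2 * v\<^sup>2" for u v :: real
      using zero_le_power2[of "u + v"] by (simp add: power2_sum power2_diff)
    then show "AE \<omega> in M. norm ((?X n \<omega> - Z \<omega>)\<^sup>2) \<le> norm (2 * (?X n \<omega>)\<^sup>2 + 2 * (Z \<omega>)\<^sup>2)"
      by (intro AE_I2) simp
  qed measurable
  have diff: "(\<integral>\<^sup>+\<omega>. ennreal ((?X n \<omega> - Z \<omega>)\<^sup>2) \<partial>M) = ennreal ((L2_norm M (\<lambda>\<omega>. ?X n \<omega> - Z \<omega>))\<^sup>2)" for n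
    using nn_integral_eq_integral[OF diff_int[of n]] by (simp add: L2_norm_def)
  have X_sq: "(\<integral>\<^sup>+\<omega>. ennreal ((?X n \<omega>)\<^sup>2) \<partial>M) \<le> 2 * fbm_norm_sq H ?F + e n" for n
  proof -
    have "(\<integral>\<^sup>+\<omega>. ennreal ((?X n \<omega>)\<^sup>2) \<partial>M) = ennreal (increment_form H (ps n))"
      using nn_integral_eq_integral[of M "\<lambda>\<omega>. (?X n \<omega>)\<^sup>2"] X[of n] by (simp add: has_bochner_integral_iff)
    also have "\<dots> \<le> fbm_norm_sq H (step_fun (ps n))"
      by (rule increment_form_le_fbm_norm_sq[OF H ps'])
    finally show ?thesis using e(2)[of n] by simp
  qed
  have bound: "(\<integral>\<^sup>+\<omega>. ennreal ((Z \<omega>)\<^sup>2) \<partial>M) \<le>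
      2 * ennreal ((L2_norm M (\<lambda>\<omega>. ?X n \<omega> - Z \<omega>))\<^sup>2) + 2 * (2 * fbm_norm_sq H ?F + e n)" for n
  proof -
    have sq: "v\<^sup>2 \<le> 2 * (u - v)\<^sup>2 + 2 * u\<^sup>2" for u v :: real
      using zero_le_power2[of "2 * u - v"] by (simp add: power2_diff power2_eq_square algebra_simps)
    have "ennreal (v\<^sup>2) \<le> 2 * ennreal ((u - v)\<^sup>2) + 2 * ennreal (u\<^sup>2)" for u v :: real
      using ennreal_leI[OF sq[of v u]] by (simp add: ennreal_plus ennreal_mult'')
    then have "(\<integral>\<^sup>+\<omega>. ennreal ((Z \<omega>)\<^sup>2) \<partial>M) \<le> (\<integral>\<^sup>+\<omega>. 2 * ennreal ((?X n \<omega> - Z \<omega>)\<^sup>2) + 2 * ennreal ((?X n \<omega>)\<^sup>2) \<partial>M)"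
      by (intro nn_integral_mono)
    also have "\<dots> = 2 * (\<integral>\<^sup>+\<omega>. ennreal ((?X n \<omega> - Z \<omega>)\<^sup>2) \<partial>M) + 2 * (\<integral>\<^sup>+\<omega>. ennreal ((?X n \<omega>)\<^sup>2) \<partial>M)"
      by (simp add: nn_integral_add nn_integral_cmult)
    also have "\<dots> \<le> 2 * ennreal ((L2_norm M (\<lambda>\<omega>. ?X n \<omega> - Z \<omega>))\<^sup>2) + 2 * (2 * fbm_norm_sq H ?F + e n)"
      unfolding diff by (intro add_left_mono mult_left_mono X_sq) simp
    finally show ?thesis .
  qed
  have "(\<lambda>n. 2 * ennreal ((L2_norm M (\<lambda>\<omega>. ?X n \<omega> - Z \<omega>))\<^sup>2) + 2 * (2 * fbm_norm_sq H ?F + e n)) \<longlonglongrightarrow>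
      2 * ennreal (0\<^sup>2) + 2 * (2 * fbm_norm_sq H ?F + 0)"
    by (intro tendsto_add ennreal_tendsto_cmult tendsto_ennrealI tendsto_power lim_Z e tendsto_const) auto
  then have "(\<integral>\<^sup>+\<omega>. ennreal ((Z \<omega>)\<^sup>2) \<partial>M) \<le> 2 * ennreal (0\<^sup>2) + 2 * (2 * fbm_norm_sq H ?F + 0)"
    by (rule LIMSEQ_le_const) (use bound in blast)
  then show ?thesis by (simp add: mult.assoc[symmetric])
qed


section \<open>The norm of a kernel with a power singularity\<close>

lemma nn_integral_cmult_powr_near:
  fixes b t K :: real
  assumes "-1 < b" "0 < t" "0 \<le> K"
  shows "(\<integral>\<^sup>+u. ennreal (indicator {0..t} u * (K * u powr b)) \<partial>lborel) = ennreal (K * (t powr (b + 1) / (b + 1)))"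
proof -
  have "(\<integral>\<^sup>+u. ennreal (indicator {0..t} u * (K * u powr b)) \<partial>lborel) =
      (\<integral>\<^sup>+u. ennreal K * ennreal (indicator {0..t} u * u powr b) \<partial>lborel)"
    using assms by (intro nn_integral_cong) (simp add: ennreal_mult'[symmetric] mult_ac)
  also have "\<dots> = ennreal K * (\<integral>\<^sup>+u. ennreal (indicator {0..t} u * u powr b) \<partial>lborel)"
    by (rule nn_integral_cmult) measurable
  also have "\<dots> = ennreal (K * (t powr (b + 1) / (b + 1)))"
    unfolding nn_integral_powr_near[OF assms(1) less_imp_le[OF assms(2)]]
    using assms by (intro ennreal_mult'[symmetric]) auto
  finally show ?thesis .
qed

text \<open>The double integral is dominated by the symmetrisation of \<open>\<Psi>(u, v)\<close>, where \<open>u\<close> is a point of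
\<open>(0, t)\<close> that carries the singular factor \<open>u\<^bsup>-2a\<^esup>\<close>. The four parts of \<open>\<Psi>\<close> correspond to the
position of \<open>v\<close>: close to \<open>u\<close>, where the increment bound compensates the singularity of the kernel
on the diagonal; further right, where the crude bound suffices; beyond \<open>t\<close> and below \<open>0\<close>, where the
extension by zero jumps. After integration in \<open>v\<close> there remain \<open>u\<^bsup>2H - 1 - 2a\<^esup>\<close>, integrable at the
origin since \<open>a < H\<close>, and a Beta integral from the jump at \<open>t\<close>.\<close>

lemma fbm_norm_sq_singular_rough:
  fixes H a B t :: real
  assumes H: "0 < H" "H < 1/2" and a: "0 \<le> a" "a < H" and t: "0 < t"
    and [measurable]: "p \<in> borel_measurable borel"
    and p: "\<And>r. 0 < r \<Longrightarrow> 0 \<le> p r" "\<And>r. 0 < r \<Longrightarrow> p r \<le> B * r powr (- a)"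
    and anti: "\<And>y x. 0 < y \<Longrightarrow> y < x \<Longrightarrow> p x \<le> p y"
    and lip: "\<And>y x. 0 < y \<Longrightarrow> y < x \<Longrightarrow> p y - p x \<le> B * y powr (- a) * ((x - y) / y)"
  shows "fbm_norm_sq H (\<lambda>r. indicator {0..t} r * p r) \<le>
    ennreal (H * (1 - 2 * H) * ((1 / (2 * H + 1) + 2 / (1 - 2 * H)) / (2 * H - 2 * a) + Beta (1 - 2 * a) (2 * H) / (1 - 2 * H))
      * B\<^sup>2 * t powr (2 * H - 2 * a))"
proof -
  let ?G = "\<lambda>r. indicator {0..t} r * p r" and ?e = "2 * H - 2"
  let ?J = "\<lambda>u v. indicator {u..2*u} v * (v - u) powr (2 * H) / u\<^sup>2 + indicator {2*u..} v * (v - u) powr ?e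
      + indicator {t..} v * (v - u) powr ?e + indicator {..0} v * (u - v) powr ?e :: real"
  define \<Psi> where "\<Psi> u v = B\<^sup>2 * u powr (- 2 * a) * indicator {0<..<t} u * ?J u v" for u v
  have [measurable]: "Measurable.pred (borel \<Otimes>\<^sub>M borel) (\<lambda>x :: real \<times> real. snd x \<in> {fst x..2 * fst x})"
    unfolding atLeastAtMost_iff by measurable
  have [measurable]: "Measurable.pred (borel \<Otimes>\<^sub>M borel) (\<lambda>x :: real \<times> real. snd x \<in> {2 * fst x..})"
    unfolding atLeast_iff by measurable
  have [measurable]: "(\<lambda>(u, v). \<Psi> u v) \<in> borel_measurable (borel \<Otimes>\<^sub>M borel)"
    unfolding \<Psi>_def by measurable
  have J_nonneg: "0 \<le> ?J u v" for u v by (auto intro!: add_nonneg_nonneg)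
  have \<Psi>_nonneg: "0 \<le> \<Psi> u v" for u v
    unfolding \<Psi>_def using J_nonneg[of u v] by (auto intro!: mult_nonneg_nonneg)
  have B: "0 \<le> B" using p(1)[of 1] p(2)[of 1] by simp
  have AE_generic: "AE x in lborel. x \<noteq> 0 \<and> x \<noteq> t"
    using AE_lborel_singleton[of 0] AE_lborel_singleton[of t] by eventually_elim simp
  have sq_bound: "(B * y powr (- a) * q)\<^sup>2 = B\<^sup>2 * y powr (- 2 * a) * q\<^sup>2" if "0 < y" for y q
  proof -
    have "(y powr (- a))\<^sup>2 = y powr (- 2 * a)" by (simp add: power2_eq_square powr_add[symmetric])
    then show ?thesis by (simp add: power_mult_distrib)
  qed
  have p_sq: "(p y)\<^sup>2 \<le> B\<^sup>2 * y powr (- 2 * a)" if "0 < y" for y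
    using power_mono[OF p(2)[OF that] p(1)[OF that], of 2] sq_bound[OF that, of 1] by simp
  have half: "(?G x - ?G y)\<^sup>2 * \<bar>x - y\<bar> powr ?e \<le> \<Psi> x y + \<Psi> y x"
    if "y < x" "y \<noteq> 0" "x \<noteq> 0" "x \<noteq> t" "y \<noteq> t" for x y
  proof -
    have "(x \<le> 0 \<or> t < y \<or> (y < 0 \<and> t < x)) \<or> (y < 0 \<and> 0 < x \<and> x < t) \<or> (0 < y \<and> y < t \<and> t < x)
      \<or> (0 < y \<and> y < t \<and> x < t \<and> 2 * y \<le> x) \<or> (0 < y \<and> y < t \<and> x < t \<and> x < 2 * y)"
      using that by linarith
    then consider "x \<le> 0 \<or> t < y \<or> (y < 0 \<and> t < x)" | "y < 0" "0 < x" "x < t" | "0 < y" "y < t" "t < x"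
      | "0 < y" "y < t" "x < t" "2 * y \<le> x" | "0 < y" "y < t" "x < t" "x < 2 * y"
      by blast
    then show ?thesis
    proof cases
      case 1
      then have "?G x - ?G y = 0" using that t by (auto simp: indicator_def)
      then show ?thesis using \<Psi>_nonneg[of x y] \<Psi>_nonneg[of y x] by simp
    next
      case 2
      have "(?G x - ?G y)\<^sup>2 * \<bar>x - y\<bar> powr ?e = (p x)\<^sup>2 * (x - y) powr ?e" using 2 by simp
      also have "\<dots> \<le> B\<^sup>2 * x powr (- 2 * a) * (x - y) powr ?e" using p_sq[of x] 2 by (intro mult_right_mono) auto
      also have "\<dots> \<le> \<Psi> x y" unfolding \<Psi>_def using 2 by (auto intro!: mult_left_mono add_nonneg_nonneg)
      finally show ?thesis using \<Psi>_nonneg[of y x] by simp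
    next
      case 3
      have "(?G x - ?G y)\<^sup>2 * \<bar>x - y\<bar> powr ?e = (p y)\<^sup>2 * (x - y) powr ?e" using 3 by simp
      also have "\<dots> \<le> B\<^sup>2 * y powr (- 2 * a) * (x - y) powr ?e" using p_sq[of y] 3 by (intro mult_right_mono) auto
      also have "\<dots> \<le> \<Psi> y x" unfolding \<Psi>_def using 3 by (auto intro!: mult_left_mono add_nonneg_nonneg)
      finally show ?thesis using \<Psi>_nonneg[of x y] by simp
    next
      case 4
      have "p y - p x \<le> p y" "0 \<le> p y - p x" using p(1)[of x] anti[of y x] 4 that by auto
      then have "(p y - p x)\<^sup>2 \<le> (p y)\<^sup>2" by (intro power_mono) auto
      then have le: "(p x - p y)\<^sup>2 \<le> B\<^sup>2 * y powr (- 2 * a)" using p_sq[of y] 4 by (simp add: power2_commute)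
      have "(?G x - ?G y)\<^sup>2 * \<bar>x - y\<bar> powr ?e = (p x - p y)\<^sup>2 * (x - y) powr ?e" using 4 that by simp
      also have "\<dots> \<le> B\<^sup>2 * y powr (- 2 * a) * (x - y) powr ?e" using le by (intro mult_right_mono) auto
      also have "\<dots> \<le> \<Psi> y x" unfolding \<Psi>_def using 4 by (auto intro!: mult_left_mono add_nonneg_nonneg)
      finally show ?thesis using \<Psi>_nonneg[of x y] by simp
    next
      case 5
      have "p y - p x \<le> B * y powr (- a) * ((x - y) / y)" "0 \<le> p y - p x" using lip[of y x] anti[of y x] 5 that by auto
      then have "(p y - p x)\<^sup>2 \<le> (B * y powr (- a) * ((x - y) / y))\<^sup>2" by (intro power_mono) auto
      then have le: "(p x - p y)\<^sup>2 \<le> B\<^sup>2 * y powr (- 2 * a) * ((x - y) / y)\<^sup>2" 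
        by (simp only: sq_bound[OF 5(1)] power2_commute[of "p x" "p y"])
      have "(?G x - ?G y)\<^sup>2 * \<bar>x - y\<bar> powr ?e = (p x - p y)\<^sup>2 * (x - y) powr ?e" using 5 that by simp
      also have "\<dots> \<le> B\<^sup>2 * y powr (- 2 * a) * ((x - y) / y)\<^sup>2 * (x - y) powr ?e" using le by (intro mult_right_mono) auto
      also have "\<dots> = B\<^sup>2 * y powr (- 2 * a) * ((x - y) powr (2 * H) / y\<^sup>2)"
      proof -
        have "(x - y)\<^sup>2 * (x - y) powr ?e = (x - y) powr (2 * H)"
          using that powr_add[of "x - y" 2 ?e] by (simp add: powr_numeral)
        then have "((x - y) / y)\<^sup>2 * (x - y) powr ?e = (x - y) powr (2 * H) / y\<^sup>2"
          by (simp add: power_divide)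
        then show ?thesis by (simp add: mult.assoc)
      qed
      also have "\<dots> \<le> \<Psi> y x" unfolding \<Psi>_def using 5 that by (auto intro!: mult_left_mono add_nonneg_nonneg)
      finally show ?thesis using \<Psi>_nonneg[of x y] by simp
    qed
  qed
  have full: "ennreal ((?G x - ?G y)\<^sup>2 * \<bar>x - y\<bar> powr ?e) \<le> ennreal (\<Psi> x y) + ennreal (\<Psi> y x)"
    if "y \<noteq> 0" "x \<noteq> 0" "x \<noteq> t" "y \<noteq> t" for x y
  proof -
    have "(?G x - ?G y)\<^sup>2 * \<bar>x - y\<bar> powr ?e \<le> \<Psi> x y + \<Psi> y x"
    proof (cases x y rule: linorder_cases)
      case less
      then show ?thesis using half[of x y] that by (simp add: power2_commute abs_minus_commute add.commute)
    next
      case equal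
      then show ?thesis using \<Psi>_nonneg[of x y] by simp
    next
      case greater
      then show ?thesis using half[of y x] that by simp
    qed
    then show ?thesis using \<Psi>_nonneg by (simp add: ennreal_plus[symmetric] ennreal_leI del: ennreal_plus)
  qed
  let ?K1 = "1 / (2 * H + 1) + 2 / (1 - 2 * H)" and ?K2 = "1 / (1 - 2 * H)"
  have inner: "(\<integral>\<^sup>+v. ennreal (\<Psi> u v) \<partial>lborel) =
      ennreal (indicator {0..t} u * (B\<^sup>2 * ?K1 * u powr (2 * H - 1 - 2 * a))) +
      ennreal (B\<^sup>2 * ?K2) * ennreal (indicator {0..t} u * (u powr ((1 - 2 * a) - 1) * (t - u) powr (2 * H - 1)))"
    if "u \<noteq> 0" "u \<noteq> t" for u
  proof (cases "u \<in> {0<..<t}")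
    case True
    then have u: "0 < u" "u < t" by auto
    have "(\<integral>\<^sup>+v. ennreal (?J u v) \<partial>lborel) =
       (\<integral>\<^sup>+v. ennreal (1 / u\<^sup>2) * ennreal (indicator {u..2*u} v * (v - u) powr (2 * H)) + ennreal (indicator {2*u..} v * (v - u) powr ?e)
         + ennreal (indicator {t..} v * (v - u) powr ?e) + ennreal (indicator {..0} v * (u - v) powr ?e) \<partial>lborel)"
      by (intro nn_integral_cong) (simp add: ennreal_plus[symmetric] ennreal_mult'[symmetric] del: ennreal_plus)
    also have "\<dots> = ennreal (1 / u\<^sup>2) * ennreal ((2 * u - u) powr (2 * H + 1) / (2 * H + 1)) + ennreal ((2 * u - u) powr (?e + 1) / (- 1 - ?e))
         + ennreal ((t - u) powr (?e + 1) / (- 1 - ?e)) + ennreal ((u - 0) powr (?e + 1) / (- 1 - ?e))"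
      using u H by (simp add: nn_integral_add nn_integral_cmult nn_integral_powr_near_right nn_integral_powr_far_right nn_integral_powr_far_left
          del: diff_0_right diff_zero)
    also have "\<dots> = ennreal (?K1 * u powr (2 * H - 1) + ?K2 * (t - u) powr (2 * H - 1))"
    proof -
      have "u powr (2 * H + 1) = u\<^sup>2 * u powr (2 * H - 1)"
        using u powr_add[of u 2 "2 * H - 1"] by (simp add: powr_numeral add.commute)
      then have "1 / u\<^sup>2 * ((2 * u - u) powr (2 * H + 1) / (2 * H + 1)) + (2 * u - u) powr (?e + 1) / (- 1 - ?e)
         + (t - u) powr (?e + 1) / (- 1 - ?e) + (u - 0) powr (?e + 1) / (- 1 - ?e) = ?K1 * u powr (2 * H - 1) + ?K2 * (t - u) powr (2 * H - 1)"
        using u by (simp add: distrib_right add_divide_distrib)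
      then show ?thesis
        using u H by (simp only: ennreal_mult'[symmetric] ennreal_plus[symmetric] divide_nonneg_nonneg add_nonneg_nonneg mult_nonneg_nonneg powr_ge_zero zero_le_power2)
    qed
    finally have J: "(\<integral>\<^sup>+v. ennreal (?J u v) \<partial>lborel) = ennreal (?K1 * u powr (2 * H - 1) + ?K2 * (t - u) powr (2 * H - 1))" .
    have "(\<integral>\<^sup>+v. ennreal (\<Psi> u v) \<partial>lborel) = (\<integral>\<^sup>+v. ennreal (B\<^sup>2 * u powr (- 2 * a)) * ennreal (?J u v) \<partial>lborel)"
    proof (rule nn_integral_cong)
      fix v
      have "\<Psi> u v = B\<^sup>2 * u powr (- 2 * a) * ?J u v"
        unfolding \<Psi>_def by (simp only: indicator_simps(1)[OF True] mult_1_right)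
      then show "ennreal (\<Psi> u v) = ennreal (B\<^sup>2 * u powr (- 2 * a)) * ennreal (?J u v)"
        by (simp only: ennreal_mult[OF mult_nonneg_nonneg[OF zero_le_power2 powr_ge_zero] J_nonneg])
    qed
    also have "\<dots> = ennreal (B\<^sup>2 * u powr (- 2 * a)) * (\<integral>\<^sup>+v. ennreal (?J u v) \<partial>lborel)"
      by (rule nn_integral_cmult) measurable
    also have "\<dots> = ennreal (B\<^sup>2 * u powr (- 2 * a)) * ennreal (?K1 * u powr (2 * H - 1) + ?K2 * (t - u) powr (2 * H - 1))"
      by (simp only: J)
    also have "\<dots> = ennreal (B\<^sup>2 * ?K1 * u powr (2 * H - 1 - 2 * a) + B\<^sup>2 * ?K2 * (u powr ((1 - 2 * a) - 1) * (t - u) powr (2 * H - 1)))"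
    proof -
      have p: "u powr (- 2 * a) * u powr (2 * H - 1) = u powr (2 * H - 1 - 2 * a)" by (simp add: powr_add[symmetric])
      have g: "B\<^sup>2 * U * (k1 * V + k2 * X) = B\<^sup>2 * k1 * (U * V) + B\<^sup>2 * k2 * (U * X)" for U V X k1 k2 :: real
        by (simp add: algebra_simps)
      have q: "(1 - 2 * a) - 1 = - 2 * a" by simp
      have "B\<^sup>2 * u powr (- 2 * a) * (?K1 * u powr (2 * H - 1) + ?K2 * (t - u) powr (2 * H - 1)) =
          B\<^sup>2 * ?K1 * u powr (2 * H - 1 - 2 * a) + B\<^sup>2 * ?K2 * (u powr ((1 - 2 * a) - 1) * (t - u) powr (2 * H - 1))"
        unfolding g[of "u powr (- 2 * a)" ?K1 "u powr (2 * H - 1)" ?K2] p q ..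
      then show ?thesis
        by (simp only: ennreal_mult'[symmetric] mult_nonneg_nonneg zero_le_power2 powr_ge_zero)
    qed
    also have "\<dots> = ennreal (B\<^sup>2 * ?K1 * u powr (2 * H - 1 - 2 * a)) + ennreal (B\<^sup>2 * ?K2) * ennreal (u powr ((1 - 2 * a) - 1) * (t - u) powr (2 * H - 1))"
      using H by (simp add: ennreal_plus ennreal_mult'[symmetric])
    finally show ?thesis using True by simp
  next
    case False
    then have "u \<notin> {0..t}" using that by auto
    then show ?thesis using False by (simp add: \<Psi>_def)
  qed
  have "(\<integral>\<^sup>+u. \<integral>\<^sup>+v. ennreal (\<Psi> u v) \<partial>lborel \<partial>lborel) =
     (\<integral>\<^sup>+u. ennreal (indicator {0..t} u * (B\<^sup>2 * ?K1 * u powr (2 * H - 1 - 2 * a))) +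
      ennreal (B\<^sup>2 * ?K2) * ennreal (indicator {0..t} u * (u powr ((1 - 2 * a) - 1) * (t - u) powr (2 * H - 1))) \<partial>lborel)"
    by (rule nn_integral_cong_AE, rule eventually_mono[OF AE_generic], rule inner) auto
  also have "\<dots> = ennreal (B\<^sup>2 * ?K1 * (t powr (2 * H - 1 - 2 * a + 1) / (2 * H - 1 - 2 * a + 1))) +
      ennreal (B\<^sup>2 * ?K2) * ennreal (t powr ((1 - 2 * a) + 2 * H - 1) * Beta (1 - 2 * a) (2 * H))"
  proof -
    have "(\<integral>\<^sup>+u. ennreal (indicator {0..t} u * (B\<^sup>2 * ?K1 * u powr (2 * H - 1 - 2 * a))) \<partial>lborel) =
        ennreal (B\<^sup>2 * ?K1 * (t powr (2 * H - 1 - 2 * a + 1) / (2 * H - 1 - 2 * a + 1)))"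
      using H a t by (intro nn_integral_cmult_powr_near) auto
    moreover have "(\<integral>\<^sup>+u. ennreal (indicator {0..t} u * (u powr ((1 - 2 * a) - 1) * (t - u) powr (2 * H - 1))) \<partial>lborel) =
        ennreal (t powr ((1 - 2 * a) + 2 * H - 1) * Beta (1 - 2 * a) (2 * H))"
      using H a t by (intro nn_integral_Beta_scaled) auto
    ultimately show ?thesis by (subst nn_integral_add) (auto simp: nn_integral_cmult)
  qed
  also have "\<dots> = ennreal ((?K1 / (2 * H - 2 * a) + Beta (1 - 2 * a) (2 * H) / (1 - 2 * H)) * B\<^sup>2 * t powr (2 * H - 2 * a))"
  proof -
    have "0 \<le> Beta (1 - 2 * a) (2 * H)"
      unfolding Beta_def using H a by (intro divide_nonneg_pos mult_nonneg_nonneg Gamma_real_nonneg Gamma_real_pos) auto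
    then show ?thesis using H a
      by (simp add: ennreal_mult'[symmetric] ennreal_plus[symmetric] del: ennreal_plus) (simp add: algebra_simps)
  qed
  finally have \<Psi>_int: "(\<integral>\<^sup>+u. \<integral>\<^sup>+v. ennreal (\<Psi> u v) \<partial>lborel \<partial>lborel) =
      ennreal ((?K1 / (2 * H - 2 * a) + Beta (1 - 2 * a) (2 * H) / (1 - 2 * H)) * B\<^sup>2 * t powr (2 * H - 2 * a))" .
  have "(\<integral>\<^sup>+x. \<integral>\<^sup>+y. ennreal ((?G x - ?G y)\<^sup>2 * \<bar>x - y\<bar> powr ?e) \<partial>lborel \<partial>lborel) \<le>
      (\<integral>\<^sup>+x. \<integral>\<^sup>+y. ennreal (\<Psi> x y) + ennreal (\<Psi> y x) \<partial>lborel \<partial>lborel)"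
  proof (rule nn_integral_mono_AE, rule eventually_mono[OF AE_generic])
    fix x :: real assume x: "x \<noteq> 0 \<and> x \<noteq> t"
    show "(\<integral>\<^sup>+y. ennreal ((?G x - ?G y)\<^sup>2 * \<bar>x - y\<bar> powr ?e) \<partial>lborel) \<le> (\<integral>\<^sup>+y. ennreal (\<Psi> x y) + ennreal (\<Psi> y x) \<partial>lborel)"
      by (rule nn_integral_mono_AE, rule eventually_mono[OF AE_generic], rule full) (use x in auto)
  qed
  also have "\<dots> = 2 * (\<integral>\<^sup>+x. \<integral>\<^sup>+y. ennreal (\<Psi> x y) \<partial>lborel \<partial>lborel)"
    by (rule nn_integral_symmetrize) measurable
  finally have "fbm_norm_sq H ?G \<le> ennreal (H * (1 - 2 * H) / 2) * (2 * (\<integral>\<^sup>+x. \<integral>\<^sup>+y. ennreal (\<Psi> x y) \<partial>lborel \<partial>lborel))"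
    unfolding fbm_norm_sq_def using H by (simp add: mult_left_mono)
  also have "\<dots> = ennreal (H * (1 - 2 * H)) * (\<integral>\<^sup>+x. \<integral>\<^sup>+y. ennreal (\<Psi> x y) \<partial>lborel \<partial>lborel)"
  proof -
    have "ennreal (H * (1 - 2 * H) / 2) * 2 = ennreal (H * (1 - 2 * H))"
      using H by (simp add: ennreal_numeral[symmetric] ennreal_mult'[symmetric] del: ennreal_numeral)
    then show ?thesis by (simp only: mult.assoc[symmetric])
  qed
  also have "\<dots> = ennreal (H * (1 - 2 * H) * ((?K1 / (2 * H - 2 * a) + Beta (1 - 2 * a) (2 * H) / (1 - 2 * H)) * B\<^sup>2 * t powr (2 * H - 2 * a)))"
    unfolding \<Psi>_int using H by (simp add: ennreal_mult'[symmetric])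
  finally show ?thesis by (simp only: mult.assoc)
qed

text \<open>The double integral of \<open>x\<^bsup>-a\<^esup> y\<^bsup>-a\<^esup> \<bar>x - y\<bar>\<^bsup>2H - 2\<^esup>\<close> over the part below the diagonal is a Beta
integral in the smaller variable, followed by the integral of \<open>u\<^bsup>2H - 1 - 2a\<^esup>\<close>.\<close>

lemma fbm_norm_sq_singular_smooth:
  fixes H a B t :: real
  assumes H: "1/2 < H" "H < 1" and a: "0 \<le> a" "a < H" and t: "0 < t"
    and [measurable]: "p \<in> borel_measurable borel"
    and p: "\<And>r. 0 < r \<Longrightarrow> 0 \<le> p r" "\<And>r. 0 < r \<Longrightarrow> p r \<le> B * r powr (- a)"
  shows "fbm_norm_sq H (\<lambda>r. indicator {0..t} r * p r) \<le>
    ennreal (2 * H * (2 * H - 1) * (Beta (1 - a) (2 * H - 1) / (2 * H - 2 * a)) * B\<^sup>2 * t powr (2 * H - 2 * a))"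
proof -
  let ?G = "\<lambda>r. indicator {0..t} r * p r" and ?e = "2 * H - 2" and ?\<beta> = "Beta (1 - a) (2 * H - 1)"
  have \<beta>: "0 \<le> ?\<beta>"
    unfolding Beta_def using H a by (intro divide_nonneg_pos mult_nonneg_nonneg Gamma_real_nonneg Gamma_real_pos) auto
  have B: "0 \<le> B" using p(1)[of 1] p(2)[of 1] by simp
  define \<Psi> where "\<Psi> u v = B\<^sup>2 * u powr (- a) * indicator {0<..t} u * (indicator {0..u} v * (v powr (1 - a - 1) * (u - v) powr (2 * H - 1 - 1)))" for u v
  have [measurable]: "Measurable.pred (borel \<Otimes>\<^sub>M borel) (\<lambda>x :: real \<times> real. snd x \<in> {0..fst x})"
    unfolding atLeastAtMost_iff by measurable
  have [measurable]: "(\<lambda>(u, v). \<Psi> u v) \<in> borel_measurable (borel \<Otimes>\<^sub>M borel)"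
    unfolding \<Psi>_def by measurable
  have \<Psi>_nonneg: "0 \<le> \<Psi> u v" for u v unfolding \<Psi>_def by (auto intro!: mult_nonneg_nonneg)
  have half: "\<bar>?G x\<bar> * \<bar>?G y\<bar> * \<bar>x - y\<bar> powr ?e \<le> \<Psi> x y + \<Psi> y x" if "y \<le> x" "x \<noteq> 0" "y \<noteq> 0" for x y
  proof (cases "0 < y \<and> x \<le> t")
    case True
    then have "0 < x" using that by linarith
    have "\<bar>?G x\<bar> * \<bar>?G y\<bar> * \<bar>x - y\<bar> powr ?e = p x * p y * (x - y) powr ?e"
      using True that p(1)[of x] p(1)[of y] by simp
    also have "\<dots> \<le> (B * x powr (- a)) * (B * y powr (- a)) * (x - y) powr ?e"
      using True \<open>0 < x\<close> p B by (intro mult_right_mono mult_mono) auto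
    also have "\<dots> = \<Psi> x y"
      unfolding \<Psi>_def using True that \<open>0 < x\<close> by (simp add: power2_eq_square mult_ac)
    finally show ?thesis using \<Psi>_nonneg[of y x] by simp
  next
    case False
    then have "?G x = 0 \<or> ?G y = 0" using that by (auto simp: indicator_def)
    then show ?thesis using \<Psi>_nonneg[of x y] \<Psi>_nonneg[of y x] by auto
  qed
  have full: "ennreal (\<bar>?G x\<bar> * \<bar>?G y\<bar> * \<bar>x - y\<bar> powr ?e) \<le> ennreal (\<Psi> x y) + ennreal (\<Psi> y x)"
    if "x \<noteq> 0" "y \<noteq> 0" for x y
  proof -
    have "\<bar>?G x\<bar> * \<bar>?G y\<bar> * \<bar>x - y\<bar> powr ?e \<le> \<Psi> x y + \<Psi> y x"
    proof (cases "y \<le> x")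
      case False
      then show ?thesis using half[of x y] that by (simp add: abs_minus_commute add.commute mult.commute)
    qed (use half that in blast)
    then show ?thesis using \<Psi>_nonneg by (simp add: ennreal_plus[symmetric] ennreal_leI del: ennreal_plus)
  qed
  have inner: "(\<integral>\<^sup>+v. ennreal (\<Psi> u v) \<partial>lborel) = ennreal (indicator {0..t} u * (B\<^sup>2 * ?\<beta> * u powr (2 * H - 1 - 2 * a)))"
    if "u \<noteq> 0" for u
  proof (cases "u \<in> {0<..t}")
    case True
    have "(\<integral>\<^sup>+v. ennreal (\<Psi> u v) \<partial>lborel) = (\<integral>\<^sup>+v. ennreal (B\<^sup>2 * u powr (- a)) * ennreal (indicator {0..u} v * (v powr (1 - a - 1) * (u - v) powr (2 * H - 1 - 1))) \<partial>lborel)"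
      unfolding \<Psi>_def using True by (intro nn_integral_cong) (simp add: ennreal_mult'[symmetric])
    also have "\<dots> = ennreal (B\<^sup>2 * u powr (- a)) * ennreal (u powr (1 - a + (2 * H - 1) - 1) * ?\<beta>)"
    proof -
      have "(\<integral>\<^sup>+v. ennreal (indicator {0..u} v * (v powr (1 - a - 1) * (u - v) powr (2 * H - 1 - 1))) \<partial>lborel) = ennreal (u powr (1 - a + (2 * H - 1) - 1) * ?\<beta>)"
        using True H a by (intro nn_integral_Beta_scaled) auto
      then show ?thesis by (subst nn_integral_cmult) auto
    qed
    also have "\<dots> = ennreal (B\<^sup>2 * ?\<beta> * u powr (2 * H - 1 - 2 * a))"
    proof -
      have p: "u powr (- a) * u powr (1 - a + (2 * H - 1) - 1) = u powr (2 * H - 1 - 2 * a)"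
        by (simp add: powr_add[symmetric])
      have g: "B\<^sup>2 * U * (V * k) = B\<^sup>2 * k * (U * V)" for U V k :: real by simp
      have "B\<^sup>2 * u powr (- a) * (u powr (1 - a + (2 * H - 1) - 1) * ?\<beta>) = B\<^sup>2 * ?\<beta> * u powr (2 * H - 1 - 2 * a)"
        unfolding g[of "u powr (- a)" "u powr (1 - a + (2 * H - 1) - 1)" ?\<beta>] p ..
      then show ?thesis by (simp only: ennreal_mult'[symmetric] zero_le_power2 mult_nonneg_nonneg powr_ge_zero)
    qed
    finally show ?thesis using True by simp
  next
    case False
    then have "u \<notin> {0..t}" using that by auto
    then show ?thesis using False by (simp add: \<Psi>_def)
  qed
  have "(\<integral>\<^sup>+u. \<integral>\<^sup>+v. ennreal (\<Psi> u v) \<partial>lborel \<partial>lborel) =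
     (\<integral>\<^sup>+u. ennreal (indicator {0..t} u * (B\<^sup>2 * ?\<beta> * u powr (2 * H - 1 - 2 * a))) \<partial>lborel)"
    by (intro nn_integral_cong_AE eventually_mono[OF AE_lborel_singleton[of 0]] inner)
  also have "\<dots> = ennreal (B\<^sup>2 * ?\<beta> * (t powr (2 * H - 1 - 2 * a + 1) / (2 * H - 1 - 2 * a + 1)))"
    using H a t \<beta> by (intro nn_integral_cmult_powr_near) auto
  finally have \<Psi>_int: "(\<integral>\<^sup>+u. \<integral>\<^sup>+v. ennreal (\<Psi> u v) \<partial>lborel \<partial>lborel) = ennreal (?\<beta> / (2 * H - 2 * a) * B\<^sup>2 * t powr (2 * H - 2 * a))"
    by (simp add: algebra_simps)
  have "(\<integral>\<^sup>+x. \<integral>\<^sup>+y. ennreal (\<bar>?G x\<bar> * \<bar>?G y\<bar> * \<bar>x - y\<bar> powr ?e) \<partial>lborel \<partial>lborel) \<le>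
      (\<integral>\<^sup>+x. \<integral>\<^sup>+y. ennreal (\<Psi> x y) + ennreal (\<Psi> y x) \<partial>lborel \<partial>lborel)"
    by (intro nn_integral_mono_AE eventually_mono[OF AE_lborel_singleton[of 0]] full)
  also have "\<dots> = 2 * (\<integral>\<^sup>+x. \<integral>\<^sup>+y. ennreal (\<Psi> x y) \<partial>lborel \<partial>lborel)"
    by (rule nn_integral_symmetrize) measurable
  finally have "fbm_norm_sq H ?G \<le> ennreal (H * (2 * H - 1)) * (2 * (\<integral>\<^sup>+x. \<integral>\<^sup>+y. ennreal (\<Psi> x y) \<partial>lborel \<partial>lborel))"
    unfolding fbm_norm_sq_def using H by (simp add: mult_left_mono)
  also have "\<dots> = ennreal (2 * H * (2 * H - 1)) * (\<integral>\<^sup>+x. \<integral>\<^sup>+y. ennreal (\<Psi> x y) \<partial>lborel \<partial>lborel)"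
  proof -
    have "ennreal (H * (2 * H - 1)) * 2 = ennreal (H * (2 * H - 1) * 2)"
      using H by (simp add: ennreal_numeral[symmetric] ennreal_mult'[symmetric] del: ennreal_numeral)
    also have "H * (2 * H - 1) * 2 = 2 * H * (2 * H - 1)" by simp
    finally show ?thesis by (simp only: mult.assoc[symmetric])
  qed
  also have "\<dots> = ennreal (2 * H * (2 * H - 1) * (?\<beta> / (2 * H - 2 * a) * B\<^sup>2 * t powr (2 * H - 2 * a)))"
    unfolding \<Psi>_int using H by (simp add: ennreal_mult'[symmetric])
  finally show ?thesis by (simp only: mult.assoc)
qed

text \<open>The constant is uniform over all kernels with the same exponent \<open>a\<close>; later the kernels are the
weighted relaxation functions of the different eigenvalues. The power of \<open>t\<close> is dictated by
scaling.\<close>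

definition singular_kernel_const :: "real \<Rightarrow> real \<Rightarrow> real \<Rightarrow> bool" where
  "singular_kernel_const H a C \<longleftrightarrow> 0 \<le> C \<and> (
     \<forall>B t p. 0 < t \<longrightarrow> p \<in> borel_measurable borel \<longrightarrow> (\<forall>r>0. 0 \<le> p r \<and> p r \<le> B * r powr (- a)) \<longrightarrow>
     (\<forall>y x. 0 < y \<longrightarrow> y < x \<longrightarrow> p x \<le> p y \<and> p y - p x \<le> B * y powr (- a) * ((x - y) / y)) \<longrightarrow>
     fbm_norm_sq H (\<lambda>r. indicator {0..t} r * p (t - r)) \<le> ennreal (C * B\<^sup>2 * t powr (2 * H - 2 * a)))"

lemma fbm_norm_sq_singular:
  fixes H a :: real
  assumes H: "0 < H" "H < 1" and a: "0 \<le> a" "a < H"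
  shows "\<exists>C. singular_kernel_const H a C"
proof -
  have refl: "fbm_norm_sq H (\<lambda>r. indicator {0..t} r * p (t - r)) = fbm_norm_sq H (\<lambda>r. indicator {0..t} r * p r)"
    if [measurable]: "p \<in> borel_measurable borel" for t :: real and p :: "real \<Rightarrow> real"
  proof -
    have "(\<lambda>r. indicator {0..t} (t - r) * p (t - r)) = (\<lambda>r. indicator {0..t} r * p (t - r))"
      by (auto simp: indicator_def fun_eq_iff)
    then show ?thesis
      using fbm_norm_sq_reflect[of "\<lambda>r. indicator {0..t} r * p r" H t] by simp
  qed
  have Beta_nonneg: "0 \<le> Beta b c" if "0 < b" "0 < c" for b c :: real
    unfolding Beta_def using that by (intro divide_nonneg_pos mult_nonneg_nonneg Gamma_real_nonneg Gamma_real_pos) auto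
  show ?thesis
  proof (cases H "1/2 :: real" rule: linorder_cases)
    case less
    let ?C = "H * (1 - 2 * H) * ((1 / (2 * H + 1) + 2 / (1 - 2 * H)) / (2 * H - 2 * a) + Beta (1 - 2 * a) (2 * H) / (1 - 2 * H))"
    have "0 \<le> ?C"
      using less H a Beta_nonneg[of "1 - 2 * a" "2 * H"] by simp
    moreover have "fbm_norm_sq H (\<lambda>r. indicator {0..t} r * p (t - r)) \<le> ennreal (?C * B\<^sup>2 * t powr (2 * H - 2 * a))"
      if "0 < t" "p \<in> borel_measurable borel" "\<forall>r>0. 0 \<le> p r \<and> p r \<le> B * r powr (- a)"
        "\<forall>y x. 0 < y \<longrightarrow> y < x \<longrightarrow> p x \<le> p y \<and> p y - p x \<le> B * y powr (- a) * ((x - y) / y)" for B t p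
      unfolding refl[OF that(2)] using that
      by (intro fbm_norm_sq_singular_rough[OF H(1) less a]) auto
    ultimately show ?thesis unfolding singular_kernel_const_def by blast
  next
    case greater
    let ?C = "2 * H * (2 * H - 1) * (Beta (1 - a) (2 * H - 1) / (2 * H - 2 * a))"
    have "0 \<le> ?C"
      using greater H a Beta_nonneg[of "1 - a" "2 * H - 1"] by simp
    moreover have "fbm_norm_sq H (\<lambda>r. indicator {0..t} r * p (t - r)) \<le> ennreal (?C * B\<^sup>2 * t powr (2 * H - 2 * a))"
      if "0 < t" "p \<in> borel_measurable borel" "\<forall>r>0. 0 \<le> p r \<and> p r \<le> B * r powr (- a)"
        "\<forall>y x. 0 < y \<longrightarrow> y < x \<longrightarrow> p x \<le> p y \<and> p y - p x \<le> B * y powr (- a) * ((x - y) / y)" for B t p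
      unfolding refl[OF that(2)] using that
      by (intro fbm_norm_sq_singular_smooth[OF greater H(2) a]) auto
    ultimately show ?thesis unfolding singular_kernel_const_def by blast
  next
    case equal
    have "fbm_norm_sq H (\<lambda>r. indicator {0..t} r * p r) \<le> ennreal (1 / (1 - 2 * a) * B\<^sup>2 * t powr (2 * H - 2 * a))"
      if t: "0 < t" and [measurable]: "p \<in> borel_measurable borel" and p: "\<forall>r>0. 0 \<le> p r \<and> p r \<le> B * r powr (- a)" for B t :: real and p
    proof -
      have "fbm_norm_sq H (\<lambda>r. indicator {0..t} r * p r) \<le> (\<integral>\<^sup>+x. ennreal (indicator {0..t} x * (B\<^sup>2 * x powr (- 2 * a))) \<partial>lborel)"
        unfolding fbm_norm_sq_def using equal
      proof (simp, intro nn_integral_mono_AE eventually_mono[OF AE_lborel_singleton[of 0]] ennreal_leI)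
        fix x :: real assume "x \<noteq> 0"
        show "(indicator {0..t} x * p x)\<^sup>2 \<le> indicator {0..t} x * (B\<^sup>2 * x powr (- (2 * a)))"
        proof (cases "x \<in> {0..t}")
          case True
          then have "(p x)\<^sup>2 \<le> (B * x powr (- a))\<^sup>2" using p \<open>x \<noteq> 0\<close> by (intro power_mono) auto
          also have "\<dots> = B\<^sup>2 * x powr (- (2 * a))" by (simp add: power_mult_distrib power2_eq_square[of "x powr _"] powr_add[symmetric])
          finally show ?thesis using True by simp
        qed simp
      qed
      also have "\<dots> = ennreal (B\<^sup>2 * (t powr (- 2 * a + 1) / (- 2 * a + 1)))"
        using equal a t by (intro nn_integral_cmult_powr_near) auto
      also have "B\<^sup>2 * (t powr (- 2 * a + 1) / (- 2 * a + 1)) = 1 / (1 - 2 * a) * B\<^sup>2 * t powr (2 * H - 2 * a)"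
        unfolding equal by (simp add: add.commute)
      finally show ?thesis .
    qed
    note bound = this
    have "fbm_norm_sq H (\<lambda>r. indicator {0..t} r * p (t - r)) \<le> ennreal (1 / (1 - 2 * a) * B\<^sup>2 * t powr (2 * H - 2 * a))"
      if "0 < t" "p \<in> borel_measurable borel" "\<forall>r>0. 0 \<le> p r \<and> p r \<le> B * r powr (- a)" for B t p
      unfolding refl[OF that(2)] by (rule bound[OF that])
    moreover have "0 \<le> 1 / (1 - 2 * a)" using a equal by simp
    ultimately show ?thesis unfolding singular_kernel_const_def by blast
  qed
qed


section \<open>Orthonormal expansions in mean square\<close>

lemma L2_real_iff:
  "v \<in> L2 \<mu> \<longleftrightarrow> v \<in> borel_measurable \<mu> \<and> integrable \<mu> (\<lambda>x. (v x)\<^sup>2 :: real)"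
  by (simp add: L2_def)

lemma L2_norm_sq: "(L2_norm \<mu> v)\<^sup>2 = (\<integral>x. (v x)\<^sup>2 \<partial>\<mu>)" for v :: "'x \<Rightarrow> real"
  by (simp add: L2_norm_def)

lemma L2_mult_integrable:
  fixes v w :: "'x \<Rightarrow> real"
  assumes "v \<in> L2 \<mu>" "w \<in> L2 \<mu>"
  shows "integrable \<mu> (\<lambda>x. v x * w x)"
proof (rule Bochner_Integration.integrable_bound)
  show "integrable \<mu> (\<lambda>x. (v x)\<^sup>2 + (w x)\<^sup>2)" using assms by (auto simp: L2_real_iff)
  show "(\<lambda>x. v x * w x) \<in> borel_measurable \<mu>" using assms by (auto simp: L2_real_iff)
  have "norm (a * b) \<le> norm (a\<^sup>2 + b\<^sup>2)" for a b :: real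
  proof -
    have "2 * (\<bar>a\<bar> * \<bar>b\<bar>) \<le> a\<^sup>2 + b\<^sup>2"
      using sum_squares_bound[of "\<bar>a\<bar>" "\<bar>b\<bar>"] by (simp add: mult.assoc)
    moreover have "0 \<le> \<bar>a\<bar> * \<bar>b\<bar>" by simp
    ultimately show ?thesis unfolding real_norm_def abs_mult by linarith
  qed
  then show "AE x in \<mu>. norm (v x * w x) \<le> norm ((v x)\<^sup>2 + (w x)\<^sup>2)"
    by (intro AE_I2)
qed

lemma L2_add:
  fixes v w :: "'x \<Rightarrow> real"
  assumes "v \<in> L2 \<mu>" "w \<in> L2 \<mu>"
  shows "(\<lambda>x. v x + w x) \<in> L2 \<mu>"
  using assms L2_mult_integrable[OF assms] by (auto simp: L2_real_iff power2_sum mult.assoc)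

lemma L2_cmult:
  fixes v :: "'x \<Rightarrow> real"
  assumes "v \<in> L2 \<mu>"
  shows "(\<lambda>x. c * v x) \<in> L2 \<mu>"
  using assms by (auto simp: L2_real_iff power_mult_distrib)

lemma L2_diff:
  fixes v w :: "'x \<Rightarrow> real"
  assumes "v \<in> L2 \<mu>" "w \<in> L2 \<mu>"
  shows "(\<lambda>x. v x - w x) \<in> L2 \<mu>"
  using L2_add[OF assms(1) L2_cmult[OF assms(2), of "-1"]] by simp

lemma L2_sum:
  fixes f :: "'i \<Rightarrow> 'x \<Rightarrow> real"
  assumes "\<And>i. i \<in> I \<Longrightarrow> f i \<in> L2 \<mu>"
  shows "(\<lambda>x. \<Sum>i\<in>I. f i x) \<in> L2 \<mu>"
  using assms
proof (induction I rule: infinite_finite_induct)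
  case (insert i I)
  then show ?case using L2_add[of "f i" \<mu> "\<lambda>x. \<Sum>i\<in>I. f i x"] by simp
qed (auto simp: L2_real_iff)

lemma summand_le:
  fixes f :: "nat \<Rightarrow> real"
  assumes "(\<Sum>i. ennreal (f i)) = ennreal c" "0 \<le> c"
  shows "f i \<le> c"
proof -
  have "ennreal (f i) \<le> ennreal c"
    using sum_le_suminf[of "\<lambda>i. ennreal (f i)" "{i}"] assms(1) by simp
  then show ?thesis using assms(2) by simp
qed

text \<open>Along a subsequence whose increments have squared norm at most \<open>4\<^bsup>-i\<^esup>\<close>, the sum of the squared
increments with weights \<open>2\<^sup>i\<close> is integrable, hence finite almost everywhere, so that the increments
decay geometrically at almost every point. Fatou's lemma shows that the pointwise limit is also the
limit in mean square.\<close>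

lemma L2_complete:
  fixes S :: "nat \<Rightarrow> 'x \<Rightarrow> real"
  assumes S: "\<And>n. S n \<in> L2 \<mu>"
    and cauchy: "\<And>\<epsilon>. 0 < \<epsilon> \<Longrightarrow> \<exists>N. \<forall>m\<ge>N. \<forall>n\<ge>N. (\<integral>x. (S m x - S n x)\<^sup>2 \<partial>\<mu>) \<le> \<epsilon>"
  shows "\<exists>w\<in>L2 \<mu>. (\<lambda>n. \<integral>x. (S n x - w x)\<^sup>2 \<partial>\<mu>) \<longlonglongrightarrow> 0"
proof -
  have [measurable]: "S n \<in> borel_measurable \<mu>" for n using S by (simp add: L2_def)
  have int: "integrable \<mu> (\<lambda>x. (S m x - S n x)\<^sup>2)" for m n
    using L2_diff[OF S S, of m n] by (simp add: L2_real_iff)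
  have nn: "(\<integral>\<^sup>+x. ennreal ((S m x - S n x)\<^sup>2) \<partial>\<mu>) = ennreal (\<integral>x. (S m x - S n x)\<^sup>2 \<partial>\<mu>)" for m n
    by (rule nn_integral_eq_integral[OF int]) simp
  have "\<forall>i. \<exists>N. \<forall>m\<ge>N. \<forall>n\<ge>N. (\<integral>x. (S m x - S n x)\<^sup>2 \<partial>\<mu>) \<le> (1 / 4) ^ i"
    using cauchy by simp
  then obtain N where N: "\<And>i m n. m \<ge> N i \<Longrightarrow> n \<ge> N i \<Longrightarrow> (\<integral>x. (S m x - S n x)\<^sup>2 \<partial>\<mu>) \<le> (1 / 4) ^ i"
    by metis
  \<comment> \<open>one index beyond \<open>N i\<close> and beyond \<open>i\<close>, so that \<open>S (r i)\<close> runs through a tail of the sequence\<close>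
  define r where "r i = (\<Sum>j\<le>i. N j) + i" for i
  have r: "N i \<le> r i" "i \<le> r i" "N i \<le> r (Suc i)" for i
  proof -
    have "N i \<le> (\<Sum>j\<le>i. N j)" by (rule member_le_sum) auto
    then show "N i \<le> r i" "i \<le> r i" "N i \<le> r (Suc i)" by (simp_all add: r_def)
  qed
  let ?d = "\<lambda>i x. S (r (Suc i)) x - S (r i) x"
  have "(\<integral>\<^sup>+x. (\<Sum>i. ennreal (2 ^ i * (?d i x)\<^sup>2)) \<partial>\<mu>) = (\<Sum>i. (\<integral>\<^sup>+x. ennreal (2 ^ i * (?d i x)\<^sup>2) \<partial>\<mu>))"
    by (rule nn_integral_suminf) measurable
  also have "\<dots> \<le> (\<Sum>i. ennreal ((1 / 2) ^ i))"
  proof (intro suminf_le)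
    fix i
    have "(\<integral>\<^sup>+x. ennreal (2 ^ i * (?d i x)\<^sup>2) \<partial>\<mu>) = ennreal (2 ^ i) * (\<integral>\<^sup>+x. ennreal ((?d i x)\<^sup>2) \<partial>\<mu>)"
      by (subst nn_integral_cmult[symmetric]) (auto simp: ennreal_mult')
    also have "\<dots> \<le> ennreal (2 ^ i) * ennreal ((1 / 4) ^ i)"
      unfolding nn using r by (intro mult_left_mono ennreal_leI N) auto
    also have "\<dots> = ennreal ((1 / 2) ^ i)"
      by (simp only: ennreal_mult'[symmetric] zero_le_power zero_le_numeral power_mult_distrib[symmetric]) simp
    finally show "(\<integral>\<^sup>+x. ennreal (2 ^ i * (?d i x)\<^sup>2) \<partial>\<mu>) \<le> ennreal ((1 / 2) ^ i)" .
  qed auto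
  also have "\<dots> = ennreal (\<Sum>i. (1 / 2) ^ i)"
    by (intro suminf_ennreal2 summable_geometric) auto
  finally have "(\<integral>\<^sup>+x. (\<Sum>i. ennreal (2 ^ i * (?d i x)\<^sup>2)) \<partial>\<mu>) \<noteq> \<infinity>"
    by (auto simp: top_unique)
  then have "AE x in \<mu>. (\<Sum>i. ennreal (2 ^ i * (?d i x)\<^sup>2)) \<noteq> \<infinity>"
    by (intro nn_integral_noteq_infinite) auto
  moreover have "convergent (\<lambda>i. S (r i) x)" if "(\<Sum>i. ennreal (2 ^ i * (?d i x)\<^sup>2)) \<noteq> \<infinity>" for x
  proof -
    have "\<exists>c\<ge>0. X = ennreal c" if "X \<noteq> \<infinity>" for X using that by (cases X) auto
    from this[OF that] obtain c where c: "0 \<le> c" "(\<Sum>i. ennreal (2 ^ i * (?d i x)\<^sup>2)) = ennreal c"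
      by (elim exE conjE)
    have bd: "\<bar>?d i x\<bar> \<le> sqrt c * sqrt (1 / 2) ^ i" for i
    proof -
      have "2 ^ i * (?d i x)\<^sup>2 \<le> c"
        by (rule summand_le[OF c(2) c(1)])
      then have "(?d i x)\<^sup>2 \<le> c * (1 / 2) ^ i" by (simp add: field_simps power_one_over)
      then have "sqrt ((?d i x)\<^sup>2) \<le> sqrt (c * (1 / 2) ^ i)" by (rule real_sqrt_le_mono)
      then show ?thesis unfolding real_sqrt_abs by (simp add: real_sqrt_mult real_sqrt_power)
    qed
    have "summable (\<lambda>i. sqrt c * sqrt (1 / 2) ^ i)"
      by (intro summable_mult summable_geometric) (simp add: real_sqrt_divide)
    then have "summable (\<lambda>i. ?d i x)"
      by (rule summable_comparison_test') (use bd in simp)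
    then obtain l where "(\<lambda>n. \<Sum>i<n. ?d i x) \<longlonglongrightarrow> l"
      by (auto simp: summable_def sums_def)
    then have "(\<lambda>n. S (r n) x - S (r 0) x) \<longlonglongrightarrow> l"
      by (simp only: sum_lessThan_telescope[of "\<lambda>i. S (r i) x"])
    then have "(\<lambda>n. S (r n) x - S (r 0) x + S (r 0) x) \<longlonglongrightarrow> l + S (r 0) x"
      by (intro tendsto_add tendsto_const)
    then show ?thesis by (auto simp: convergent_def)
  qed
  ultimately have conv: "AE x in \<mu>. (\<lambda>i. S (r i) x) \<longlonglongrightarrow> lim (\<lambda>i. S (r i) x)"
    by (auto simp: convergent_LIMSEQ_iff)
  define w where "w x = lim (\<lambda>i. S (r i) x)" for x
  have [measurable]: "w \<in> borel_measurable \<mu>" unfolding w_def by measurable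
  have fatou: "(\<integral>\<^sup>+x. ennreal ((S n x - w x)\<^sup>2) \<partial>\<mu>) \<le> ennreal \<epsilon>"
    if "\<forall>m\<ge>K. \<forall>n\<ge>K. (\<integral>x. (S m x - S n x)\<^sup>2 \<partial>\<mu>) \<le> \<epsilon>" "n \<ge> K" for n K \<epsilon>
  proof -
    have "AE x in \<mu>. ennreal ((S n x - w x)\<^sup>2) = liminf (\<lambda>i. ennreal ((S n x - S (r i) x)\<^sup>2))"
      using conv
    proof eventually_elim
      case (elim x)
      then have "(\<lambda>i. ennreal ((S n x - S (r i) x)\<^sup>2)) \<longlonglongrightarrow> ennreal ((S n x - w x)\<^sup>2)"
        unfolding w_def by (intro tendsto_ennrealI tendsto_intros)
      then show ?case using lim_imp_Liminf[OF trivial_limit_sequentially] by metis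
    qed
    then have "(\<integral>\<^sup>+x. ennreal ((S n x - w x)\<^sup>2) \<partial>\<mu>) = (\<integral>\<^sup>+x. liminf (\<lambda>i. ennreal ((S n x - S (r i) x)\<^sup>2)) \<partial>\<mu>)"
      by (rule nn_integral_cong_AE)
    also have "\<dots> \<le> liminf (\<lambda>i. \<integral>\<^sup>+x. ennreal ((S n x - S (r i) x)\<^sup>2) \<partial>\<mu>)"
      by (rule nn_integral_liminf) measurable
    also have "\<dots> \<le> ennreal \<epsilon>"
    proof (rule Liminf_le)
      show "\<forall>\<^sub>F i in sequentially. (\<integral>\<^sup>+x. ennreal ((S n x - S (r i) x)\<^sup>2) \<partial>\<mu>) \<le> ennreal \<epsilon>"
        using eventually_ge_at_top[of K]
      proof eventually_elim
        case (elim i)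
        then have "K \<le> r i" using r(2)[of i] by simp
        then show ?case unfolding nn using that by (intro ennreal_leI) auto
      qed
    qed simp
    finally show ?thesis .
  qed
  have diff_L2: "(\<lambda>x. S n x - w x) \<in> L2 \<mu>" if "n \<ge> N 0" for n
  proof -
    have "(\<integral>\<^sup>+x. ennreal ((S n x - w x)\<^sup>2) \<partial>\<mu>) < \<infinity>"
      using fatou[of "N 0" 1 n] N[of 0] that by (auto intro: le_less_trans[of _ "ennreal 1"])
    then show ?thesis by (simp add: L2_real_iff integrable_iff_bounded)
  qed
  have "w \<in> L2 \<mu>"
    using L2_diff[OF S[of "N 0"] diff_L2[of "N 0"]] by simp
  moreover have "(\<lambda>n. \<integral>x. (S n x - w x)\<^sup>2 \<partial>\<mu>) \<longlonglongrightarrow> 0"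
  proof (rule LIMSEQ_I)
    fix \<epsilon> :: real assume "0 < \<epsilon>"
    obtain K where K: "\<forall>m\<ge>K. \<forall>n\<ge>K. (\<integral>x. (S m x - S n x)\<^sup>2 \<partial>\<mu>) \<le> \<epsilon> / 2"
      using cauchy[of "\<epsilon> / 2"] \<open>0 < \<epsilon>\<close> by auto
    have "norm ((\<integral>x. (S n x - w x)\<^sup>2 \<partial>\<mu>) - 0) < \<epsilon>" if "n \<ge> max K (N 0)" for n
    proof -
      have "integrable \<mu> (\<lambda>x. (S n x - w x)\<^sup>2)" using diff_L2[of n] that by (simp add: L2_real_iff)
      then have "ennreal (\<integral>x. (S n x - w x)\<^sup>2 \<partial>\<mu>) = (\<integral>\<^sup>+x. ennreal ((S n x - w x)\<^sup>2) \<partial>\<mu>)"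
        by (intro nn_integral_eq_integral[symmetric]) auto
      also have "\<dots> \<le> ennreal (\<epsilon> / 2)" using K that by (intro fatou) auto
      finally have "(\<integral>x. (S n x - w x)\<^sup>2 \<partial>\<mu>) \<le> \<epsilon> / 2" using \<open>0 < \<epsilon>\<close> by simp
      then show ?thesis using \<open>0 < \<epsilon>\<close> by simp
    qed
    then show "\<exists>K. \<forall>n\<ge>K. norm ((\<integral>x. (S n x - w x)\<^sup>2 \<partial>\<mu>) - 0) < \<epsilon>" by blast
  qed
  ultimately show ?thesis by blast
qed

locale orthonormal_sequence =
  fixes \<mu> :: "'x measure" and \<phi> :: "nat \<Rightarrow> 'x \<Rightarrow> real"
  assumes in_L2: "\<phi> k \<in> L2 \<mu>"
    and ortho: "L2_inner \<mu> (\<phi> j) (\<phi> k) = (if j = k then 1 else 0)"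
begin

lemma inner_ortho: "(\<integral>x. \<phi> j x * \<phi> k x \<partial>\<mu>) = (if j = k then 1 else 0)"
  using ortho[of j k] by (simp add: L2_inner_def)

lemma partial_sum_in_L2: "(\<lambda>x. \<Sum>k\<in>K. c k * \<phi> k x) \<in> L2 \<mu>"
  by (intro L2_sum L2_cmult in_L2)

lemma integral_partial_sum_sq:
  assumes "finite K"
  shows "(\<integral>x. (\<Sum>k\<in>K. c k * \<phi> k x)\<^sup>2 \<partial>\<mu>) = (\<Sum>k\<in>K. (c k)\<^sup>2)"
proof -
  have "(\<integral>x. (\<Sum>k\<in>K. c k * \<phi> k x)\<^sup>2 \<partial>\<mu>) = (\<integral>x. (\<Sum>j\<in>K. \<Sum>k\<in>K. c j * c k * (\<phi> j x * \<phi> k x)) \<partial>\<mu>)"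
    by (simp add: power2_eq_square sum_product mult_ac)
  also have "\<dots> = (\<Sum>j\<in>K. \<Sum>k\<in>K. c j * c k * (\<integral>x. \<phi> j x * \<phi> k x \<partial>\<mu>))"
    using L2_mult_integrable[OF in_L2 in_L2] by (simp add: Bochner_Integration.integral_sum)
  also have "\<dots> = (\<Sum>k\<in>K. (c k)\<^sup>2)"
    using assms by (simp add: inner_ortho sum.delta if_distrib power2_eq_square cong: if_cong)
  finally show ?thesis .
qed

lemma inner_partial_sum:
  assumes "v \<in> L2 \<mu>"
  shows "(\<integral>x. v x * (\<Sum>k\<in>K. c k * \<phi> k x) \<partial>\<mu>) = (\<Sum>k\<in>K. c k * L2_inner \<mu> v (\<phi> k))"
proof -
  have "(\<integral>x. v x * (\<Sum>k\<in>K. c k * \<phi> k x) \<partial>\<mu>) = (\<integral>x. (\<Sum>k\<in>K. c k * (v x * \<phi> k x)) \<partial>\<mu>)"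
    by (simp add: sum_distrib_left mult_ac)
  then show ?thesis
    using L2_mult_integrable[OF assms in_L2] by (simp add: Bochner_Integration.integral_sum L2_inner_def)
qed

lemma approximation_error:
  assumes v: "v \<in> L2 \<mu>" and K: "finite K"
  shows "(\<integral>x. (v x - (\<Sum>k\<in>K. c k * \<phi> k x))\<^sup>2 \<partial>\<mu>) =
    (\<integral>x. (v x)\<^sup>2 \<partial>\<mu>) - 2 * (\<Sum>k\<in>K. c k * L2_inner \<mu> v (\<phi> k)) + (\<Sum>k\<in>K. (c k)\<^sup>2)"
proof -
  let ?P = "\<lambda>x. \<Sum>k\<in>K. c k * \<phi> k x"
  have int: "integrable \<mu> (\<lambda>x. (v x)\<^sup>2)" "integrable \<mu> (\<lambda>x. v x * ?P x)" "integrable \<mu> (\<lambda>x. (?P x)\<^sup>2)"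
    using v partial_sum_in_L2[of c K] L2_mult_integrable[OF v partial_sum_in_L2[of c K]] by (auto simp: L2_real_iff)
  have "(\<integral>x. (v x - ?P x)\<^sup>2 \<partial>\<mu>) = (\<integral>x. (v x)\<^sup>2 - 2 * (v x * ?P x) + (?P x)\<^sup>2 \<partial>\<mu>)"
    by (simp add: power2_diff algebra_simps)
  also have "\<dots> = (\<integral>x. (v x)\<^sup>2 \<partial>\<mu>) - 2 * (\<integral>x. v x * ?P x \<partial>\<mu>) + (\<integral>x. (?P x)\<^sup>2 \<partial>\<mu>)"
    using int by simp
  finally show ?thesis unfolding inner_partial_sum[OF v] integral_partial_sum_sq[OF K] .
qed

lemma bessel:
  assumes "v \<in> L2 \<mu>" "finite K"
  shows "(\<Sum>k\<in>K. (L2_inner \<mu> v (\<phi> k))\<^sup>2) \<le> (\<integral>x. (v x)\<^sup>2 \<partial>\<mu>)"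
proof -
  have "0 \<le> (\<integral>x. (v x - (\<Sum>k\<in>K. L2_inner \<mu> v (\<phi> k) * \<phi> k x))\<^sup>2 \<partial>\<mu>)" by simp
  then show ?thesis
    unfolding approximation_error[OF assms] by (simp add: power2_eq_square)
qed

text \<open>Bessel's inequality for the single index \<open>k\<close>, applied to \<open>w\<close> minus a partial sum, shows that the
\<open>k\<close>-th coefficients converge. Given the coefficients, the second claim is the formula for the
approximation error.\<close>

lemma limit_coefficients:
  assumes w: "w \<in> L2 \<mu>" and lim: "(\<lambda>n. \<integral>x. ((\<Sum>k<n. c k * \<phi> k x) - w x)\<^sup>2 \<partial>\<mu>) \<longlonglongrightarrow> 0"
  shows "L2_inner \<mu> w (\<phi> k) = c k" and "(\<lambda>k. (c k)\<^sup>2) sums (\<integral>x. (w x)\<^sup>2 \<partial>\<mu>)"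
proof -
  let ?P = "\<lambda>n x. \<Sum>k<n. c k * \<phi> k x"
  have lim': "(\<lambda>n. \<integral>x. (w x - ?P n x)\<^sup>2 \<partial>\<mu>) \<longlonglongrightarrow> 0"
    using lim by (simp add: power2_commute)
  have coef: "L2_inner \<mu> w (\<phi> k) = c k" for k
  proof -
    have "(L2_inner \<mu> w (\<phi> k) - c k)\<^sup>2 \<le> (\<integral>x. (w x - ?P n x)\<^sup>2 \<partial>\<mu>)" if "n > k" for n
    proof -
      have "(w x - ?P n x) * \<phi> k x = w x * \<phi> k x - \<phi> k x * ?P n x" for x
      proof -
        have "(a - b) * p = a * p - p * b" for a b p :: real by (simp add: algebra_simps)
        then show ?thesis .
      qed
      then have "L2_inner \<mu> (\<lambda>x. w x - ?P n x) (\<phi> k) = L2_inner \<mu> w (\<phi> k) - (\<integral>x. \<phi> k x * ?P n x \<partial>\<mu>)"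
        using L2_mult_integrable[OF w in_L2[of k]] L2_mult_integrable[OF in_L2[of k] partial_sum_in_L2[of c "{..<n}"]]
        by (simp add: L2_inner_def)
      also have "(\<integral>x. \<phi> k x * ?P n x \<partial>\<mu>) = c k"
        unfolding inner_partial_sum[OF in_L2] using that
        by (simp add: ortho if_distrib cong: if_cong)
      finally show ?thesis
        using bessel[OF L2_diff[OF w partial_sum_in_L2[of c "{..<n}"]], of "{k}"] by simp
    qed
    then have "(L2_inner \<mu> w (\<phi> k) - c k)\<^sup>2 \<le> 0"
      by (intro LIMSEQ_le_const[OF lim']) (auto intro!: exI[of _ "Suc k"])
    then show ?thesis by simp
  qed
  then show "L2_inner \<mu> w (\<phi> k) = c k" .
  have "(\<integral>x. (w x - ?P n x)\<^sup>2 \<partial>\<mu>) = (\<integral>x. (w x)\<^sup>2 \<partial>\<mu>) - (\<Sum>k<n. (c k)\<^sup>2)" for n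
    unfolding approximation_error[OF w finite_lessThan] coef by (simp add: power2_eq_square)
  then have "(\<lambda>n. (\<integral>x. (w x)\<^sup>2 \<partial>\<mu>) - ((\<integral>x. (w x)\<^sup>2 \<partial>\<mu>) - (\<Sum>k<n. (c k)\<^sup>2))) \<longlonglongrightarrow> (\<integral>x. (w x)\<^sup>2 \<partial>\<mu>) - 0"
    using lim' by (intro tendsto_diff tendsto_const) simp
  then show "(\<lambda>k. (c k)\<^sup>2) sums (\<integral>x. (w x)\<^sup>2 \<partial>\<mu>)" by (simp add: sums_def)
qed

lemma riesz_fischer:
  assumes c: "summable (\<lambda>k. (c k)\<^sup>2)"
  shows "\<exists>w\<in>L2 \<mu>. (\<lambda>n. \<integral>x. ((\<Sum>k<n. c k * \<phi> k x) - w x)\<^sup>2 \<partial>\<mu>) \<longlonglongrightarrow> 0"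
proof (rule L2_complete)
  show "(\<lambda>x. \<Sum>k<n. c k * \<phi> k x) \<in> L2 \<mu>" for n by (rule partial_sum_in_L2)
  fix \<epsilon> :: real assume "0 < \<epsilon>"
  then obtain N where N: "\<And>m n. m \<ge> N \<Longrightarrow> norm (sum (\<lambda>k. (c k)\<^sup>2) {m..<n}) < \<epsilon>"
    using c unfolding summable_Cauchy by blast
  have dist: "(\<integral>x. ((\<Sum>k<m. c k * \<phi> k x) - (\<Sum>k<n. c k * \<phi> k x))\<^sup>2 \<partial>\<mu>) \<le> \<epsilon>" if "n \<ge> N" "n \<le> m" for m n
  proof -
    have "(\<Sum>k<m. c k * \<phi> k x) - (\<Sum>k<n. c k * \<phi> k x) = (\<Sum>k\<in>{n..<m}. c k * \<phi> k x)" for x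
      using that sum_diff_nat_ivl[of 0 n m "\<lambda>k. c k * \<phi> k x"] by (simp add: atLeast0LessThan)
    then show ?thesis
      using N[OF that(1), of m] by (simp add: integral_partial_sum_sq)
  qed
  have "(\<integral>x. ((\<Sum>k<m. c k * \<phi> k x) - (\<Sum>k<n. c k * \<phi> k x))\<^sup>2 \<partial>\<mu>) \<le> \<epsilon>" if "n \<ge> N" "m \<ge> N" for m n
    using dist[of n m] dist[of m n] that by (cases "n \<le> m") (auto simp: power2_commute)
  then show "\<exists>N. \<forall>m\<ge>N. \<forall>n\<ge>N. (\<integral>x. ((\<Sum>k<m. c k * \<phi> k x) - (\<Sum>k<n. c k * \<phi> k x))\<^sup>2 \<partial>\<mu>) \<le> \<epsilon>" by blast
qed

text \<open>The sum of the Fourier series exists by Bessel's inequality and the Riesz-Fischer theorem. It has the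
same coefficients as \<open>v\<close>, so completeness identifies the two.\<close>

lemma parseval:
  assumes complete: "\<forall>v\<in>L2 \<mu>. (\<forall>k. L2_inner \<mu> v (\<phi> k) = 0) \<longrightarrow> (AE x in \<mu>. v x = 0)"
    and v: "v \<in> L2 \<mu>"
  shows "(\<lambda>k. (L2_inner \<mu> v (\<phi> k))\<^sup>2) sums (\<integral>x. (v x)\<^sup>2 \<partial>\<mu>)"
proof -
  have "summable (\<lambda>k. (L2_inner \<mu> v (\<phi> k))\<^sup>2)"
    by (rule summableI_nonneg_bounded[where x = "\<integral>x. (v x)\<^sup>2 \<partial>\<mu>"]) (auto intro: bessel v)
  from riesz_fischer[OF this] obtain w where w: "w \<in> L2 \<mu>"
    and lim: "(\<lambda>n. \<integral>x. ((\<Sum>k<n. L2_inner \<mu> v (\<phi> k) * \<phi> k x) - w x)\<^sup>2 \<partial>\<mu>) \<longlonglongrightarrow> 0"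
    by (elim bexE)
  note wc = limit_coefficients[OF w lim]
  have "AE x in \<mu>. v x - w x = 0"
  proof (rule complete[rule_format])
    show "(\<lambda>x. v x - w x) \<in> L2 \<mu>" by (rule L2_diff[OF v w])
    show "L2_inner \<mu> (\<lambda>x. v x - w x) (\<phi> k) = 0" for k
    proof -
      have "L2_inner \<mu> (\<lambda>x. v x - w x) (\<phi> k) = L2_inner \<mu> v (\<phi> k) - L2_inner \<mu> w (\<phi> k)"
        using L2_mult_integrable[OF v in_L2[of k]] L2_mult_integrable[OF w in_L2[of k]]
        by (simp add: L2_inner_def left_diff_distrib)
      then show ?thesis using wc(1)[of k] by simp
    qed
  qed
  then have "AE x in \<mu>. (v x)\<^sup>2 = (w x)\<^sup>2" by eventually_elim simp
  then have "(\<integral>x. (v x)\<^sup>2 \<partial>\<mu>) = (\<integral>x. (w x)\<^sup>2 \<partial>\<mu>)"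
    using v w by (intro integral_cong_AE) (auto simp: L2_real_iff)
  then show ?thesis using wc(2) by simp
qed

end


section \<open>Relaxation functions\<close>

lemma mittag_leffler_measurable [measurable]: "mittag_leffler \<alpha> \<beta> \<in> borel_measurable borel"
  unfolding mittag_leffler_def[abs_def] by measurable

lemma mittag_leffler_neg_le:
  assumes "0 < \<alpha>" "\<alpha> \<le> 1" "0 \<le> x"
  shows "mittag_leffler \<alpha> 1 (- x) \<le> max 1 (Gamma (\<alpha> + 1)) / (1 + x)"
proof -
  let ?c = "Gamma (\<alpha> + 1)"
  have c: "0 < ?c" using assms by simp
  have "1 / (1 + x / ?c) \<le> max 1 ?c / (1 + x)"
  proof (cases "?c \<le> 1")
    case True
    have "x * ?c \<le> x" using True assms mult_left_mono[of ?c 1 x] by simp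
    then have "x \<le> x / ?c" using c by (simp add: pos_le_divide_eq)
    then show ?thesis using True assms by (simp add: max_def frac_le)
  next
    case False
    have "1 + x / ?c = (?c + x) / ?c" using c by (simp add: add_divide_distrib)
    then have "1 / (1 + x / ?c) = ?c / (?c + x)" by simp
    also have "\<dots> \<le> ?c / (1 + x)" using False assms c by (intro divide_left_mono) auto
    finally show ?thesis using False by (simp add: max_def)
  qed
  then show ?thesis using mittag_leffler_neg_decay[OF assms] by linarith
qed

text \<open>This is \<open>X\<^sup>\<sigma> \<le> 1 + X\<close> for \<open>X = L r\<^sup>\<alpha>\<close>.\<close>

lemma relaxation_weight:
  fixes L \<sigma> \<alpha> r :: real
  assumes "0 \<le> L" "0 \<le> \<sigma>" "\<sigma> \<le> 1" "0 < r"
  shows "L powr \<sigma> \<le> (1 + L * r powr \<alpha>) * r powr (- (\<sigma> * \<alpha>))"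
proof (cases "L = 0")
  case True
  then show ?thesis using assms by simp
next
  case False
  define X where "X = L * r powr \<alpha>"
  have X: "0 < X" using assms False by (simp add: X_def)
  have "X powr \<sigma> \<le> 1 + X"
  proof (cases "X \<le> 1")
    case True
    then have "X powr \<sigma> \<le> 1" using X assms by (simp add: powr_le1)
    then show ?thesis using X by simp
  next
    case False
    then have "X powr \<sigma> \<le> X powr 1" using assms by (intro powr_mono) auto
    then show ?thesis using X by simp
  qed
  then have "X powr \<sigma> * r powr (- (\<sigma> * \<alpha>)) \<le> (1 + X) * r powr (- (\<sigma> * \<alpha>))"
    by (rule mult_right_mono) simp
  moreover have "X powr \<sigma> * r powr (- (\<sigma> * \<alpha>)) = L powr \<sigma>"
    using assms by (simp add: X_def powr_mult powr_powr powr_add[symmetric] mult.commute[of \<alpha>])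
  ultimately show ?thesis by (simp add: X_def)
qed

locale relaxation =
  fixes \<alpha> L :: real
  assumes \<alpha>: "0 < \<alpha>" "\<alpha> \<le> 1" and L: "0 \<le> L"
begin

definition relax :: "real \<Rightarrow> real" where
  "relax r = mittag_leffler \<alpha> 1 (- L * r powr \<alpha>)"

lemma relax_measurable [measurable]: "relax \<in> borel_measurable borel"
  unfolding relax_def[abs_def] by measurable

lemma relax_nonneg: "0 \<le> relax r"
  using mittag_leffler_neg_nonneg[of \<alpha> "L * r powr \<alpha>"] \<alpha> L by (simp add: relax_def)

lemma relax_le_1: "relax r \<le> 1"
  using mittag_leffler_neg_antimono[of \<alpha> 0 "L * r powr \<alpha>"] \<alpha> L by (simp add: relax_def mittag_leffler_0)

lemma relax_antimono: "0 \<le> y \<Longrightarrow> y \<le> x \<Longrightarrow> relax x \<le> relax y"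
  using mittag_leffler_neg_antimono[of \<alpha> "L * y powr \<alpha>" "L * x powr \<alpha>"] \<alpha> L
  by (simp add: relax_def mult_left_mono powr_mono2)

text \<open>The assumption on the weight \<open>w\<close> trades the decay \<open>1 / (1 + L r\<^sup>\<alpha>)\<close> of the relaxation function for a
power of \<open>r\<close>. In both conclusions \<open>L\<close> has disappeared, which makes all later constants uniform over
the eigenvalues. The factor four comes from the increments: the relative Lipschitz bound brings one
factor two, and the evaluation at half of the argument another.\<close>

lemma weighted_relax_bounds:
  assumes w: "0 \<le> w" and weight: "\<forall>r>0. w \<le> (1 + L * r powr \<alpha>) * r powr (- a)"
  defines "K \<equiv> 4 * max 1 (Gamma (\<alpha> + 1))"
  shows "0 < r \<Longrightarrow> w * relax r \<le> K * r powr (- a)"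
    and "0 < y \<Longrightarrow> y < x \<Longrightarrow> w * (relax y - relax x) \<le> K * y powr (- a) * ((x - y) / y)"
proof -
  let ?c = "max 1 (Gamma (\<alpha> + 1))"
  have c: "1 \<le> ?c" by simp
  have wc: "w * (?c / (1 + L * r powr \<alpha>)) \<le> ?c * r powr (- a)" if "0 < r" for r
  proof -
    have pos: "0 < 1 + L * r powr \<alpha>" using L by (simp add: add_pos_nonneg)
    have "w / (1 + L * r powr \<alpha>) \<le> r powr (- a)"
      using weight[rule_format, OF that] pos by (simp add: pos_divide_le_eq mult.commute)
    then have "?c * (w / (1 + L * r powr \<alpha>)) \<le> ?c * r powr (- a)" using c by (intro mult_left_mono) auto
    then show ?thesis by (simp add: mult.commute)
  qed
  show "w * relax r \<le> K * r powr (- a)" if "0 < r"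
  proof -
    have "relax r \<le> ?c / (1 + L * r powr \<alpha>)"
      using mittag_leffler_neg_le[of \<alpha> "L * r powr \<alpha>"] \<alpha> L by (simp add: relax_def)
    then have "w * relax r \<le> w * (?c / (1 + L * r powr \<alpha>))" using w by (rule mult_left_mono)
    also have "\<dots> \<le> 1 * (?c * r powr (- a))" using wc[OF that] by simp
    also have "\<dots> \<le> 4 * (?c * r powr (- a))" using c by (intro mult_right_mono) auto
    finally show ?thesis by (simp add: K_def)
  qed
  show "w * (relax y - relax x) \<le> K * y powr (- a) * ((x - y) / y)" if xy: "0 < y" "y < x"
  proof (cases "L = 0")
    case True
    then have "relax y = relax x" unfolding relax_def by simp
    then show ?thesis using xy by (simp add: K_def)
  next
    case False
    define X Y where "X = L * x powr \<alpha>" and "Y = L * y powr \<alpha>"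
    have Y: "0 < Y" using False L xy by (simp add: Y_def)
    have "x powr \<alpha> / y powr \<alpha> \<le> x / y"
    proof -
      have "(x / y) powr \<alpha> \<le> (x / y) powr 1" using xy \<alpha> by (intro powr_mono) auto
      then show ?thesis using xy by (simp add: powr_divide)
    qed
    then have "X / Y - 1 \<le> x / y - 1" using False by (simp add: X_def Y_def)
    then have ratio: "(X - Y) / Y \<le> (x - y) / y" using Y xy by (simp add: diff_divide_distrib)
    have XY: "Y \<le> X" using L xy \<alpha> by (simp add: X_def Y_def mult_left_mono powr_mono2)
    have rx: "relax x = mittag_leffler \<alpha> 1 (- X)" "relax y = mittag_leffler \<alpha> 1 (- Y)"
      by (simp_all add: relax_def X_def Y_def)
    have "Y * (relax y - relax x) \<le> 2 * (X - Y) * mittag_leffler \<alpha> 1 (- (Y / 2))"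
      unfolding rx using mittag_leffler_neg_relative_lipschitz[of \<alpha> Y X] \<alpha> Y XY by simp
    then have "relax y - relax x \<le> 2 * ((X - Y) / Y) * mittag_leffler \<alpha> 1 (- (Y / 2))"
      using Y by (simp add: field_simps)
    also have "\<dots> \<le> 2 * ((x - y) / y) * (?c / (1 + Y / 2))"
      using ratio Y xy \<alpha> XY mittag_leffler_neg_le[of \<alpha> "Y / 2"] mittag_leffler_neg_nonneg[of \<alpha> "Y / 2"]
      by (intro mult_mono) auto
    also have "\<dots> \<le> 2 * ((x - y) / y) * (2 * (?c / (1 + Y)))"
    proof -
      have "1 / (1 + Y / 2) \<le> 2 / (1 + Y)" using Y by (simp add: field_simps)
      then have "?c * (1 / (1 + Y / 2)) \<le> ?c * (2 / (1 + Y))" using c by (intro mult_left_mono) auto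
      then show ?thesis using xy by (intro mult_left_mono) (auto simp: mult.commute)
    qed
    finally have "w * (relax y - relax x) \<le> w * (2 * ((x - y) / y) * (2 * (?c / (1 + Y))))"
      using w by (rule mult_left_mono)
    also have "\<dots> = 4 * ((x - y) / y) * (w * (?c / (1 + Y)))" by simp
    also have "\<dots> \<le> 4 * ((x - y) / y) * (?c * y powr (- a))"
      using wc[OF xy(1)] xy unfolding Y_def by (intro mult_left_mono) auto
    finally show ?thesis by (simp only: K_def mult_ac)
  qed
qed

text \<open>The relaxation function itself is bounded by one, as the second moment estimate requires, while its
kernel bounds hold with \<open>K / w\<close>; the weight is therefore put back only after squaring.\<close>

lemma wiener_relax_second_moment:
  assumes fbm: "fractional_brownian_motion M H W" and H: "0 < H" "H < 1" and t: "0 < t"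
    and wi: "has_wiener_integral M H W t (\<lambda>r. relax (t - r)) Z"
    and w: "0 \<le> w" and weight: "\<forall>r>0. w \<le> (1 + L * r powr \<alpha>) * r powr (- a)"
    and C: "singular_kernel_const H a C"
  shows "(\<integral>\<^sup>+\<omega>. ennreal ((w * Z \<omega>)\<^sup>2) \<partial>M) \<le> ennreal (4 * C * (4 * max 1 (Gamma (\<alpha> + 1)))\<^sup>2 * t powr (2 * H - 2 * a))"
proof (cases "w = 0")
  case False
  then have w0: "0 < w" using w by simp
  define K where "K = 4 * max 1 (Gamma (\<alpha> + 1))"
  note bounds = weighted_relax_bounds[where a = a, OF w weight, folded K_def]
  have [measurable]: "Z \<in> borel_measurable M" using wi by (simp add: has_wiener_integral_def L2_def)
  have "fbm_norm_sq H (\<lambda>r. indicator {0..t} r * relax (t - r)) \<le> ennreal (C * (K / w)\<^sup>2 * t powr (2 * H - 2 * a))"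
  proof (rule C[unfolded singular_kernel_const_def, THEN conjunct2, rule_format, OF t relax_measurable])
    show "0 \<le> relax r \<and> relax r \<le> K / w * r powr (- a)" if "0 < r" for r
      using bounds(1)[OF that] relax_nonneg w0 by (simp add: field_simps)
    show "relax x \<le> relax y \<and> relax y - relax x \<le> K / w * y powr (- a) * ((x - y) / y)" if "0 < y" "y < x" for x y
    proof
      have "relax y - relax x \<le> (K * y powr (- a) * ((x - y) / y)) / w"
        using bounds(2)[OF that] by (simp only: pos_le_divide_eq[OF w0] mult.commute[of _ w])
      then show "relax y - relax x \<le> K / w * y powr (- a) * ((x - y) / y)" by (simp add: mult_ac)
    qed (use relax_antimono[of y x] that in simp)
  qed
  moreover have "(\<integral>\<^sup>+\<omega>. ennreal ((Z \<omega>)\<^sup>2) \<partial>M) \<le> 4 * fbm_norm_sq H (\<lambda>r. indicator {0..t} r * relax (t - r))"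
    using t relax_nonneg relax_le_1 by (intro wiener_integral_second_moment[OF fbm H _ wi]) auto
  ultimately have Z: "(\<integral>\<^sup>+\<omega>. ennreal ((Z \<omega>)\<^sup>2) \<partial>M) \<le> 4 * ennreal (C * (K / w)\<^sup>2 * t powr (2 * H - 2 * a))"
    by (meson mult_left_mono order_trans zero_le)
  have "(\<integral>\<^sup>+\<omega>. ennreal ((w * Z \<omega>)\<^sup>2) \<partial>M) = ennreal (w\<^sup>2) * (\<integral>\<^sup>+\<omega>. ennreal ((Z \<omega>)\<^sup>2) \<partial>M)"
    by (subst nn_integral_cmult[symmetric]) (auto simp: power_mult_distrib ennreal_mult')
  also have "\<dots> \<le> ennreal (w\<^sup>2) * (4 * ennreal (C * (K / w)\<^sup>2 * t powr (2 * H - 2 * a)))"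
    by (intro mult_left_mono Z) simp
  also have "\<dots> = ennreal (w\<^sup>2 * (4 * (C * (K / w)\<^sup>2 * t powr (2 * H - 2 * a))))"
    using C by (simp add: singular_kernel_const_def ennreal_mult')
  also have "w\<^sup>2 * (4 * (C * (K / w)\<^sup>2 * t powr (2 * H - 2 * a))) = 4 * C * K\<^sup>2 * t powr (2 * H - 2 * a)"
    using w0 by (simp add: power_divide)
  finally show ?thesis by (simp add: K_def)
qed simp

lemma relax_convolution_bound:
  assumes t: "0 < t" "t \<le> T" and h: "h \<in> Linf (lebesgue_on {0..T})" and a: "a < 1"
    and w: "0 \<le> w" and weight: "\<forall>r>0. w \<le> (1 + L * r powr \<alpha>) * r powr (- a)"
  shows "\<bar>w * (\<integral>r. relax (t - r) * h r \<partial>lebesgue_on {0..t})\<bar> \<le>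
    4 * max 1 (Gamma (\<alpha> + 1)) * (T powr (1 - a) / (1 - a)) * Linf_norm (lebesgue_on {0..T}) h"
proof -
  define K where "K = 4 * max 1 (Gamma (\<alpha> + 1))"
  have K: "0 \<le> K" by (simp add: K_def)
  let ?N = "Linf_norm (lebesgue_on {0..T}) h"
  let ?E = "esssup (lebesgue_on {0..T}) (\<lambda>x. ereal \<bar>h x\<bar>)"
  have E: "?E < \<infinity>" using h by (simp add: Linf_def)
  have h_le: "\<bar>y\<bar> \<le> ?N" if "ereal \<bar>y\<bar> \<le> ?E" for y
    using that E unfolding Linf_norm_def by (cases ?E) auto
  have "AE x in lebesgue_on {0..T}. \<bar>h x\<bar> \<le> ?N"
    using esssup_AE[of "\<lambda>x. ereal \<bar>h x\<bar>" "lebesgue_on {0..T}"] by eventually_elim (rule h_le)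
  then have AE_T: "AE x in lebesgue. x \<in> {0..T} \<longrightarrow> \<bar>h x\<bar> \<le> ?N"
    by (subst (asm) AE_restrict_space_iff) auto
  have N: "0 \<le> ?N"
  proof (rule ccontr)
    assume "\<not> 0 \<le> ?N"
    with AE_T have "AE x in lebesgue. x \<notin> {0..T}" by (auto elim!: eventually_mono)
    then have "emeasure lebesgue {0..T} = 0" by (subst (asm) AE_iff_measurable[of "{0..T}"]) auto
    then show False using t by simp
  qed
  have AE_t: "AE r in lebesgue_on {0..t}. norm (w * (relax (t - r) * h r)) \<le> K * ?N * (t - r) powr (- a)"
  proof -
    have "AE r in lebesgue. r \<noteq> t" by (intro AE_I'[of "{t}"]) auto
    with AE_T have "AE r in lebesgue. r \<in> {0..t} \<longrightarrow> norm (w * (relax (t - r) * h r)) \<le> K * ?N * (t - r) powr (- a)"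
    proof eventually_elim
      case (elim r)
      show ?case
      proof
        assume r: "r \<in> {0..t}"
        then have "\<bar>h r\<bar> \<le> ?N" using elim t by simp
        moreover have "w * relax (t - r) \<le> K * (t - r) powr (- a)"
          using weighted_relax_bounds(1)[OF w weight, folded K_def, of "t - r"] elim r by simp
        ultimately have "(w * relax (t - r)) * \<bar>h r\<bar> \<le> (K * (t - r) powr (- a)) * ?N"
          using K by (intro mult_mono[of "w * relax (t - r)"]) auto
        then show "norm (w * (relax (t - r) * h r)) \<le> K * ?N * (t - r) powr (- a)"
          using w relax_nonneg by (simp add: abs_mult mult_ac)
      qed
    qed
    then show ?thesis by (subst AE_restrict_space_iff) auto
  qed
  have "ennreal \<bar>w * (\<integral>r. relax (t - r) * h r \<partial>lebesgue_on {0..t})\<bar> = ennreal (norm (\<integral>r. w * (relax (t - r) * h r) \<partial>lebesgue_on {0..t}))"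
    by simp
  also have "\<dots> \<le> (\<integral>\<^sup>+r. ennreal (norm (w * (relax (t - r) * h r))) \<partial>lebesgue_on {0..t})"
  proof (cases "integrable (lebesgue_on {0..t}) (\<lambda>r. w * (relax (t - r) * h r))")
    case True
    then show ?thesis by (rule integral_norm_bound_ennreal)
  next
    case False
    then show ?thesis by (simp add: not_integrable_integral_eq)
  qed
  also have "\<dots> \<le> (\<integral>\<^sup>+r. ennreal (K * ?N * (t - r) powr (- a)) \<partial>lebesgue_on {0..t})"
    using AE_t by (intro nn_integral_mono_AE) (auto elim!: eventually_mono intro!: ennreal_leI)
  also have "\<dots> = (\<integral>\<^sup>+r. ennreal (K * ?N) * ennreal (indicator {0..t} r * (t - r) powr (- a)) \<partial>lborel)"
    using K N by (simp add: nn_integral_restrict_space nn_integral_completion)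
      (intro nn_integral_cong, auto simp: ennreal_mult'[symmetric] indicator_def)
  also have "\<dots> = ennreal (K * ?N) * ennreal ((t - 0) powr (- a + 1) / (- a + 1))"
    using nn_integral_powr_near_left[of "- a" 0 t] a t by (subst nn_integral_cmult) auto
  also have "\<dots> = ennreal (K * ?N * (t powr (1 - a) / (1 - a)))"
    using K N a by (simp add: ennreal_mult'[symmetric] add.commute)
  also have "\<dots> \<le> ennreal (K * ?N * (T powr (1 - a) / (1 - a)))"
    using K N a t by (intro ennreal_leI mult_left_mono divide_right_mono powr_mono2) auto
  finally have "\<bar>w * (\<integral>r. relax (t - r) * h r \<partial>lebesgue_on {0..t})\<bar> \<le> K * ?N * (T powr (1 - a) / (1 - a))"
    using K N a by (subst (asm) ennreal_le_iff) auto
  then show ?thesis by (simp add: K_def mult_ac)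
qed

end


section \<open>The coefficients of the mild solution\<close>

lemma (in complete_measure) borel_measurable_AE_eq:
  assumes g: "g \<in> borel_measurable M" and eq: "AE x in M. f x = g x"
  shows "f \<in> borel_measurable M"
proof (rule measurableI)
  fix A :: "'b set" assume "A \<in> sets borel"
  then have A: "g -` A \<inter> space M \<in> sets M" using g by (rule measurable_sets[rotated])
  show "f -` A \<inter> space M \<in> sets M"
    by (rule in_sets_AE[OF _ A]) (use eq in \<open>auto elim!: eventually_mono\<close>)
qed simp

lemma integrable_of_nn_integral_bound:
  assumes f: "f \<in> borel_measurable M" "\<And>x. 0 \<le> f x" and le: "(\<integral>\<^sup>+x. ennreal (f x) \<partial>M) \<le> ennreal R" and R: "0 \<le> R"
  shows "integrable M f \<and> (\<integral>x. f x \<partial>M) \<le> R"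
proof
  show int: "integrable M f"
    using f le by (intro integrableI_nonneg) (auto intro: le_less_trans[OF le])
  then have "ennreal (\<integral>x. f x \<partial>M) \<le> ennreal R"
    using le f(2) by (subst (asm) nn_integral_eq_integral) auto
  then show "(\<integral>x. f x \<partial>M) \<le> R" using R by simp
qed

text \<open>The function \<open>frac_power\<close> is a choice among all limits of the series; each of them has the squared
norm stated here.\<close>

lemma frac_power_of_summable:
  fixes lam :: "nat \<Rightarrow> real" and \<rho> :: real
  assumes ortho: "orthonormal_sequence (lebesgue_on D) \<phi>"
    and v: "v \<in> L2 (lebesgue_on D)"
  defines "c \<equiv> \<lambda>k. lam k powr \<rho> * L2_inner (lebesgue_on D) v (\<phi> k)"
  assumes summable: "summable (\<lambda>k. (c k)\<^sup>2)"
  shows "v \<in> frac_power_domain D lam \<phi> \<rho>"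
    and "(L2_norm (lebesgue_on D) (frac_power D lam \<phi> \<rho> v))\<^sup>2 = (\<Sum>k. (c k)\<^sup>2)"
proof -
  interpret orthonormal_sequence "lebesgue_on D" \<phi> by (rule ortho)
  have limit_iff: "(\<lambda>n. L2_norm (lebesgue_on D) (\<lambda>x. (\<Sum>k<n. lam k powr \<rho> * L2_inner (lebesgue_on D) v (\<phi> k) * \<phi> k x) - w x)) \<longlonglongrightarrow> 0
      \<longleftrightarrow> (\<lambda>n. \<integral>x. ((\<Sum>k<n. c k * \<phi> k x) - w x)\<^sup>2 \<partial>lebesgue_on D) \<longlonglongrightarrow> 0" (is "?f \<longlonglongrightarrow> 0 \<longleftrightarrow> ?g \<longlonglongrightarrow> 0") for w
  proof -
    have sq: "?g = (\<lambda>n. (?f n)\<^sup>2)" by (simp add: L2_norm_sq c_def)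
    show ?thesis
    proof
      assume "?f \<longlonglongrightarrow> 0"
      then show "?g \<longlonglongrightarrow> 0" unfolding sq using tendsto_power[of ?f 0 sequentially 2] by simp
    next
      assume "?g \<longlonglongrightarrow> 0"
      then have "(\<lambda>n. sqrt ((?f n)\<^sup>2)) \<longlonglongrightarrow> sqrt 0" unfolding sq by (rule tendsto_real_sqrt)
      then show "?f \<longlonglongrightarrow> 0" by (simp add: L2_norm_def)
    qed
  qed
  have ex: "\<exists>w. has_frac_power D lam \<phi> \<rho> v w"
    using riesz_fischer[OF summable] v unfolding has_frac_power_def limit_iff by blast
  then show "v \<in> frac_power_domain D lam \<phi> \<rho>" by (simp add: frac_power_domain_def)
  have "has_frac_power D lam \<phi> \<rho> v (frac_power D lam \<phi> \<rho> v)"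
    unfolding frac_power_def by (rule someI_ex[OF ex])
  then have "(\<lambda>k. (c k)\<^sup>2) sums (\<integral>x. (frac_power D lam \<phi> \<rho> v x)\<^sup>2 \<partial>lebesgue_on D)"
    unfolding has_frac_power_def limit_iff by (intro limit_coefficients(2)) auto
  then show "(L2_norm (lebesgue_on D) (frac_power D lam \<phi> \<rho> v))\<^sup>2 = (\<Sum>k. (c k)\<^sup>2)"
    by (simp add: L2_norm_sq sums_iff)
qed

text \<open>The estimate for all modes at once. The random variables \<open>Y k\<close> are measurable versions of the
coefficients of \<open>u t\<close>; in the bound, the weighted deterministic and stochastic integrals are
estimated uniformly in \<open>k\<close>, and the sum over \<open>k\<close> is Parseval's identity for \<open>f\<close> and \<open>g\<close>.\<close>

lemma mild_solution_coefficients: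
  fixes lam :: "nat \<Rightarrow> real" and a H \<alpha> s T :: real
  assumes M: "prob_space M" and ortho: "orthonormal_sequence (lebesgue_on D) \<phi>"
    and complete: "\<forall>v\<in>L2 (lebesgue_on D). (\<forall>k. L2_inner (lebesgue_on D) v (\<phi> k) = 0) \<longrightarrow> (AE x in lebesgue_on D. v x = 0)"
    and fbm: "fractional_brownian_motion M H W" and H: "0 < H" "H < 1"
    and \<alpha>: "0 < \<alpha>" "\<alpha> \<le> 1" and a: "0 \<le> a" "a < H"
    and w: "\<And>k. 0 \<le> w k" "\<And>k. \<forall>r>0. w k \<le> (1 + lam k powr s * r powr \<alpha>) * r powr (- a)"
  shows "\<exists>C>0. \<forall>f\<in>L2 (lebesgue_on D). \<forall>g\<in>L2 (lebesgue_on D). \<forall>h\<in>Linf (lebesgue_on {0..T}). \<forall>u t.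
      mild_solution M H W D lam \<phi> T \<alpha> s f g h u \<longrightarrow> 0 < t \<longrightarrow> t \<le> T \<longrightarrow>
      (\<exists>Y. (\<forall>k. Y k \<in> borel_measurable M) \<and> (AE \<omega> in M. \<forall>k. L2_inner (lebesgue_on D) (u t \<omega>) (\<phi> k) = Y k \<omega>) \<and>
        (\<integral>\<^sup>+\<omega>. (\<Sum>k. ennreal ((w k * Y k \<omega>)\<^sup>2)) \<partial>M) \<le>
          ennreal (C * (Linf_norm (lebesgue_on {0..T}) h)\<^sup>2 * (L2_norm (lebesgue_on D) f)\<^sup>2
            + C * t powr (2 * H - 2 * a) * (L2_norm (lebesgue_on D) g)\<^sup>2))"
proof -
  interpret orthonormal_sequence "lebesgue_on D" \<phi> by (rule ortho)
  have relax: "relaxation \<alpha> (lam k powr s)" for k using \<alpha> by unfold_locales auto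
  obtain C0 where C0: "singular_kernel_const H a C0"
    using fbm_norm_sq_singular[OF H a] by (elim exE)
  define K where "K = 4 * max 1 (Gamma (\<alpha> + 1))"
  define A where "A = K * (T powr (1 - a) / (1 - a))"
  define B where "B = 4 * C0 * K\<^sup>2"
  define C where "C = 2 * A\<^sup>2 + 2 * B + 1"
  have B0: "0 \<le> B" using C0 by (simp add: B_def singular_kernel_const_def)
  then have C: "0 < C" "2 * A\<^sup>2 \<le> C" "2 * B \<le> C" by (simp_all add: C_def add_nonneg_pos)
  show ?thesis
  proof (intro exI[of _ C] conjI[OF C(1)] ballI allI impI)
    fix f g h u t
    assume f: "f \<in> L2 (lebesgue_on D)" and g: "g \<in> L2 (lebesgue_on D)" and h: "h \<in> Linf (lebesgue_on {0..T})"
      and u: "mild_solution M H W D lam \<phi> T \<alpha> s f g h u" and t: "0 < t" "t \<le> T"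
    let ?N = "Linf_norm (lebesgue_on {0..T}) h" and ?e = "\<lambda>k. relaxation.relax \<alpha> (lam k powr s)"
    let ?f = "\<lambda>k. L2_inner (lebesgue_on D) f (\<phi> k)" and ?g = "\<lambda>k. L2_inner (lebesgue_on D) g (\<phi> k)"
    let ?h = "\<lambda>k. \<integral>r. ?e k (t - r) * h r \<partial>lebesgue_on {0..t}"
    have "\<forall>k. \<exists>Z. has_wiener_integral M H W t (\<lambda>r. ?e k (t - r)) Z \<and>
        (AE \<omega> in M. L2_inner (lebesgue_on D) (u t \<omega>) (\<phi> k) = ?f k * ?h k + ?g k * Z \<omega>)"
      using u t unfolding mild_solution_def relaxation.relax_def[OF relax] by auto
    from choice[OF this] obtain Z where Z_spec: "\<forall>k. has_wiener_integral M H W t (\<lambda>r. ?e k (t - r)) (Z k) \<and>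
        (AE \<omega> in M. L2_inner (lebesgue_on D) (u t \<omega>) (\<phi> k) = ?f k * ?h k + ?g k * Z k \<omega>)"
      by (elim exE)
    have Z: "has_wiener_integral M H W t (\<lambda>r. ?e k (t - r)) (Z k)"
      and Z_eq: "AE \<omega> in M. L2_inner (lebesgue_on D) (u t \<omega>) (\<phi> k) = ?f k * ?h k + ?g k * Z k \<omega>" for k
      using Z_spec[rule_format, of k] by (rule conjunct1, rule conjunct2)
    have Z_meas[measurable]: "Z k \<in> borel_measurable M" for k
      using Z[of k] by (simp add: has_wiener_integral_def L2_def)
    define Y where "Y k \<omega> = ?f k * ?h k + ?g k * Z k \<omega>" for k \<omega>
    have Y_meas[measurable]: "Y k \<in> borel_measurable M" for k unfolding Y_def by measurable
    have h_bound: "(w k * ?h k)\<^sup>2 \<le> (A * ?N)\<^sup>2" for k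
    proof -
      have "\<bar>w k * ?h k\<bar> \<le> A * ?N"
        unfolding A_def K_def using H a by (intro relaxation.relax_convolution_bound[OF relax t h _ w]) simp
      then show ?thesis by (metis abs_ge_zero power2_abs power_mono)
    qed
    have Z_bound: "(\<integral>\<^sup>+\<omega>. ennreal ((w k * Z k \<omega>)\<^sup>2) \<partial>M) \<le> ennreal (B * t powr (2 * H - 2 * a))" for k
      unfolding B_def K_def by (rule relaxation.wiener_relax_second_moment[OF relax fbm H t(1) Z w C0])
    have term_bound: "(\<integral>\<^sup>+\<omega>. ennreal ((w k * Y k \<omega>)\<^sup>2) \<partial>M) \<le>
        ennreal ((?f k)\<^sup>2 * (2 * (A * ?N)\<^sup>2) + (?g k)\<^sup>2 * (2 * (B * t powr (2 * H - 2 * a))))" for k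
    proof -
      have sq: "(x + y)\<^sup>2 \<le> 2 * x\<^sup>2 + 2 * y\<^sup>2" for x y :: real
        using zero_le_power2[of "x - y"] by (simp add: power2_sum power2_diff)
      have "(w k * Y k \<omega>)\<^sup>2 \<le> (?f k)\<^sup>2 * (2 * (A * ?N)\<^sup>2) + 2 * (?g k)\<^sup>2 * (w k * Z k \<omega>)\<^sup>2" for \<omega>
      proof -
        have "w k * Y k \<omega> = ?f k * (w k * ?h k) + ?g k * (w k * Z k \<omega>)"
          unfolding Y_def by (simp only: distrib_left mult.left_commute)
        then have "(w k * Y k \<omega>)\<^sup>2 \<le> 2 * (?f k * (w k * ?h k))\<^sup>2 + 2 * (?g k * (w k * Z k \<omega>))\<^sup>2"
          using sq[of "?f k * (w k * ?h k)" "?g k * (w k * Z k \<omega>)"] by (simp only:)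
        also have "(?f k * (w k * ?h k))\<^sup>2 = (?f k)\<^sup>2 * (w k * ?h k)\<^sup>2" by (rule power_mult_distrib)
        also have "(?g k * (w k * Z k \<omega>))\<^sup>2 = (?g k)\<^sup>2 * (w k * Z k \<omega>)\<^sup>2" by (rule power_mult_distrib)
        finally have "(w k * Y k \<omega>)\<^sup>2 \<le> 2 * ((?f k)\<^sup>2 * (w k * ?h k)\<^sup>2) + 2 * ((?g k)\<^sup>2 * (w k * Z k \<omega>)\<^sup>2)" .
        moreover have "(?f k)\<^sup>2 * (w k * ?h k)\<^sup>2 \<le> (?f k)\<^sup>2 * (A * ?N)\<^sup>2"
          by (rule mult_left_mono[OF h_bound]) simp
        moreover have "(?f k)\<^sup>2 * (2 * (A * ?N)\<^sup>2) = 2 * ((?f k)\<^sup>2 * (A * ?N)\<^sup>2)"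
          by (rule mult.left_commute)
        moreover have "2 * (?g k)\<^sup>2 * (w k * Z k \<omega>)\<^sup>2 = 2 * ((?g k)\<^sup>2 * (w k * Z k \<omega>)\<^sup>2)"
          by (rule mult.assoc)
        ultimately show ?thesis by linarith
      qed
      then have "ennreal ((w k * Y k \<omega>)\<^sup>2) \<le> ennreal ((?f k)\<^sup>2 * (2 * (A * ?N)\<^sup>2)) + ennreal (2 * (?g k)\<^sup>2) * ennreal ((w k * Z k \<omega>)\<^sup>2)" for \<omega>
        by (simp add: ennreal_mult'[symmetric] ennreal_plus[symmetric] ennreal_leI del: ennreal_plus)
      then have "(\<integral>\<^sup>+\<omega>. ennreal ((w k * Y k \<omega>)\<^sup>2) \<partial>M) \<le>
          (\<integral>\<^sup>+\<omega>. ennreal ((?f k)\<^sup>2 * (2 * (A * ?N)\<^sup>2)) + ennreal (2 * (?g k)\<^sup>2) * ennreal ((w k * Z k \<omega>)\<^sup>2) \<partial>M)"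
        by (intro nn_integral_mono)
      also have "\<dots> = ennreal ((?f k)\<^sup>2 * (2 * (A * ?N)\<^sup>2)) + ennreal (2 * (?g k)\<^sup>2) * (\<integral>\<^sup>+\<omega>. ennreal ((w k * Z k \<omega>)\<^sup>2) \<partial>M)"
        using prob_space.emeasure_space_1[OF M] by (simp add: nn_integral_add nn_integral_cmult)
      also have "\<dots> \<le> ennreal ((?f k)\<^sup>2 * (2 * (A * ?N)\<^sup>2)) + ennreal (2 * (?g k)\<^sup>2) * ennreal (B * t powr (2 * H - 2 * a))"
        by (intro add_left_mono mult_left_mono Z_bound) simp
      also have "\<dots> = ennreal ((?f k)\<^sup>2 * (2 * (A * ?N)\<^sup>2) + (?g k)\<^sup>2 * (2 * (B * t powr (2 * H - 2 * a))))"
        using B0 by (simp add: ennreal_mult'[symmetric] ennreal_plus[symmetric] mult_ac del: ennreal_plus)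
      finally show ?thesis .
    qed
    have sums: "(\<lambda>k. (?f k)\<^sup>2 * (2 * (A * ?N)\<^sup>2) + (?g k)\<^sup>2 * (2 * (B * t powr (2 * H - 2 * a)))) sums
        ((L2_norm (lebesgue_on D) f)\<^sup>2 * (2 * (A * ?N)\<^sup>2) + (L2_norm (lebesgue_on D) g)\<^sup>2 * (2 * (B * t powr (2 * H - 2 * a))))"
      unfolding L2_norm_sq by (intro sums_add sums_mult2 parseval f g complete)
    have "(\<integral>\<^sup>+\<omega>. (\<Sum>k. ennreal ((w k * Y k \<omega>)\<^sup>2)) \<partial>M) = (\<Sum>k. \<integral>\<^sup>+\<omega>. ennreal ((w k * Y k \<omega>)\<^sup>2) \<partial>M)"
      by (rule nn_integral_suminf) measurable
    also have "\<dots> \<le> (\<Sum>k. ennreal ((?f k)\<^sup>2 * (2 * (A * ?N)\<^sup>2) + (?g k)\<^sup>2 * (2 * (B * t powr (2 * H - 2 * a)))))"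
      by (intro suminf_le term_bound summableI)
    also have "\<dots> = ennreal ((L2_norm (lebesgue_on D) f)\<^sup>2 * (2 * (A * ?N)\<^sup>2) + (L2_norm (lebesgue_on D) g)\<^sup>2 * (2 * (B * t powr (2 * H - 2 * a))))"
      using B0 sums by (subst suminf_ennreal2) (auto simp: sums_iff)
    also have "\<dots> \<le> ennreal (C * ?N\<^sup>2 * (L2_norm (lebesgue_on D) f)\<^sup>2 + C * t powr (2 * H - 2 * a) * (L2_norm (lebesgue_on D) g)\<^sup>2)"
    proof (intro ennreal_leI add_mono)
      have "(L2_norm (lebesgue_on D) f)\<^sup>2 * (2 * (A * ?N)\<^sup>2) = 2 * A\<^sup>2 * (?N\<^sup>2 * (L2_norm (lebesgue_on D) f)\<^sup>2)"
        by (simp add: power_mult_distrib mult_ac)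
      also have "\<dots> \<le> C * (?N\<^sup>2 * (L2_norm (lebesgue_on D) f)\<^sup>2)" using C(2) by (rule mult_right_mono) simp
      finally show "(L2_norm (lebesgue_on D) f)\<^sup>2 * (2 * (A * ?N)\<^sup>2) \<le> C * ?N\<^sup>2 * (L2_norm (lebesgue_on D) f)\<^sup>2"
        by (simp only: mult.assoc)
      have "(L2_norm (lebesgue_on D) g)\<^sup>2 * (2 * (B * t powr (2 * H - 2 * a))) = 2 * B * (t powr (2 * H - 2 * a) * (L2_norm (lebesgue_on D) g)\<^sup>2)"
        by (simp only: mult_ac)
      also have "\<dots> \<le> C * (t powr (2 * H - 2 * a) * (L2_norm (lebesgue_on D) g)\<^sup>2)" using C(3) by (rule mult_right_mono) simp
      finally show "(L2_norm (lebesgue_on D) g)\<^sup>2 * (2 * (B * t powr (2 * H - 2 * a))) \<le> C * t powr (2 * H - 2 * a) * (L2_norm (lebesgue_on D) g)\<^sup>2"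
        by (simp only: mult.assoc)
    qed
    finally show "\<exists>Y. (\<forall>k. Y k \<in> borel_measurable M) \<and> (AE \<omega> in M. \<forall>k. L2_inner (lebesgue_on D) (u t \<omega>) (\<phi> k) = Y k \<omega>) \<and>
        (\<integral>\<^sup>+\<omega>. (\<Sum>k. ennreal ((w k * Y k \<omega>)\<^sup>2)) \<partial>M) \<le>
          ennreal (C * ?N\<^sup>2 * (L2_norm (lebesgue_on D) f)\<^sup>2 + C * t powr (2 * H - 2 * a) * (L2_norm (lebesgue_on D) g)\<^sup>2)"
      using Z_eq by (intro exI[of _ Y] conjI allI Y_meas) (auto simp: AE_all_countable Y_def)
  qed
qed


section \<open>From time slices to space-time\<close>

lemma nn_integral_time_slices:
  assumes M: "sigma_finite_measure M" and X: "sigma_finite_measure X" and S: "sigma_finite_measure S"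
    and G: "G \<in> borel_measurable (M \<Otimes>\<^sub>M (X \<Otimes>\<^sub>M S))"
  shows "(\<integral>\<^sup>+\<omega>. \<integral>\<^sup>+p. G (\<omega>, p) \<partial>(X \<Otimes>\<^sub>M S) \<partial>M) = (\<integral>\<^sup>+t. \<integral>\<^sup>+\<omega>. \<integral>\<^sup>+x. G (\<omega>, x, t) \<partial>X \<partial>M \<partial>S)"
proof -
  interpret XS: pair_sigma_finite X S using X S by (simp add: pair_sigma_finite_def)
  interpret MS: pair_sigma_finite M S using M S by (simp add: pair_sigma_finite_def)
  have "(\<integral>\<^sup>+\<omega>. \<integral>\<^sup>+p. G (\<omega>, p) \<partial>(X \<Otimes>\<^sub>M S) \<partial>M) = (\<integral>\<^sup>+\<omega>. \<integral>\<^sup>+t. \<integral>\<^sup>+x. G (\<omega>, x, t) \<partial>X \<partial>S \<partial>M)"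
  proof (intro nn_integral_cong)
    fix \<omega> assume "\<omega> \<in> space M"
    then have "(\<lambda>p. G (\<omega>, p)) \<in> borel_measurable (X \<Otimes>\<^sub>M S)" using measurable_Pair2[OF G] by simp
    then show "(\<integral>\<^sup>+p. G (\<omega>, p) \<partial>(X \<Otimes>\<^sub>M S)) = (\<integral>\<^sup>+t. \<integral>\<^sup>+x. G (\<omega>, x, t) \<partial>X \<partial>S)"
      by (rule XS.nn_integral_snd[symmetric])
  qed
  also have "\<dots> = (\<integral>\<^sup>+t. \<integral>\<^sup>+\<omega>. \<integral>\<^sup>+x. G (\<omega>, x, t) \<partial>X \<partial>M \<partial>S)"
  proof (rule MS.Fubini'[symmetric])
    have "(\<lambda>q. (fst (fst q), snd q, snd (fst q))) \<in> (M \<Otimes>\<^sub>M S) \<Otimes>\<^sub>M X \<rightarrow>\<^sub>M M \<Otimes>\<^sub>M (X \<Otimes>\<^sub>M S)"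
      by measurable
    from measurable_compose[OF this G]
    have "(\<lambda>(z, x). G (fst z, x, snd z)) \<in> borel_measurable ((M \<Otimes>\<^sub>M S) \<Otimes>\<^sub>M X)"
      by (simp add: split_beta)
    then have "(\<lambda>z. \<integral>\<^sup>+x. G (fst z, x, snd z) \<partial>X) \<in> borel_measurable (M \<Otimes>\<^sub>M S)"
      by (rule sigma_finite_measure.borel_measurable_nn_integral[OF X])
    then show "(\<lambda>(\<omega>, t). \<integral>\<^sup>+x. G (\<omega>, x, t) \<partial>X) \<in> borel_measurable (M \<Otimes>\<^sub>M S)"
      by (simp add: split_beta)
  qed
  finally show ?thesis .
qed

lemma second_moment_space_time:
  fixes u :: "real \<Rightarrow> 'w \<Rightarrow> 'a::euclidean_space \<Rightarrow> real" and X :: "'a measure"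
  assumes M: "sigma_finite_measure M" and X: "sigma_finite_measure X" and T: "0 \<le> T" and R: "0 \<le> R"
    and meas: "(\<lambda>(\<omega>, x, t). u t \<omega> x) \<in> borel_measurable (M \<Otimes>\<^sub>M (X \<Otimes>\<^sub>M lebesgue_on {0..T}))"
    and slice: "\<And>t. 0 < t \<Longrightarrow> t \<le> T \<Longrightarrow> (\<integral>\<^sup>+\<omega>. \<integral>\<^sup>+x. ennreal ((u t \<omega> x)\<^sup>2) \<partial>X \<partial>M) \<le> ennreal R"
  shows "AE \<omega> in M. (\<lambda>(x, t). u t \<omega> x) \<in> L2 (X \<Otimes>\<^sub>M lebesgue_on {0..T})"
    and "integrable M (\<lambda>\<omega>. (L2_norm (X \<Otimes>\<^sub>M lebesgue_on {0..T}) (\<lambda>(x, t). u t \<omega> x))\<^sup>2)"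
    and "(\<integral>\<omega>. (L2_norm (X \<Otimes>\<^sub>M lebesgue_on {0..T}) (\<lambda>(x, t). u t \<omega> x))\<^sup>2 \<partial>M) \<le> R * T"
proof -
  let ?S = "lebesgue_on {0..T}"
  have S: "sigma_finite_measure ?S"
    by (intro finite_measure.axioms(1) finite_measure_lebesgue_on) simp
  interpret XS: sigma_finite_measure "X \<Otimes>\<^sub>M ?S" by (rule sigma_finite_pair_measure[OF X S])
  define G where "G = (\<lambda>(\<omega>, x, t). ennreal ((u t \<omega> x)\<^sup>2))"
  have real_meas: "(\<lambda>(\<omega>, p). (case p of (x, t) \<Rightarrow> u t \<omega> x)\<^sup>2) \<in> borel_measurable (M \<Otimes>\<^sub>M (X \<Otimes>\<^sub>M ?S))"
    using borel_measurable_power[OF meas, of 2] by (simp add: split_beta)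
  then have G: "G \<in> borel_measurable (M \<Otimes>\<^sub>M (X \<Otimes>\<^sub>M ?S))"
    using measurable_compose[OF real_meas measurable_ennreal] by (simp add: G_def split_beta)
  have slice_meas: "(\<lambda>(x, t). u t \<omega> x) \<in> borel_measurable (X \<Otimes>\<^sub>M ?S)" if "\<omega> \<in> space M" for \<omega>
    using measurable_Pair2[OF meas that] by (simp add: split_beta)
  have "(\<integral>\<^sup>+\<omega>. \<integral>\<^sup>+p. G (\<omega>, p) \<partial>(X \<Otimes>\<^sub>M ?S) \<partial>M) = (\<integral>\<^sup>+t. \<integral>\<^sup>+\<omega>. \<integral>\<^sup>+x. G (\<omega>, x, t) \<partial>X \<partial>M \<partial>?S)"
    by (rule nn_integral_time_slices[OF M X S G])
  also have "\<dots> \<le> (\<integral>\<^sup>+t. ennreal R \<partial>?S)"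
  proof (rule nn_integral_mono_AE)
    have "AE t in lebesgue. t \<noteq> (0::real)" by (intro AE_I'[of "{0}"]) auto
    then have "AE t in lebesgue. t \<in> {0..T} \<longrightarrow> 0 < t \<and> t \<le> T" by eventually_elim auto
    then have "AE t in ?S. 0 < t \<and> t \<le> T" by (subst AE_restrict_space_iff) auto
    then show "AE t in ?S. (\<integral>\<^sup>+\<omega>. \<integral>\<^sup>+x. G (\<omega>, x, t) \<partial>X \<partial>M) \<le> ennreal R"
      by eventually_elim (use slice in \<open>simp add: G_def\<close>)
  qed
  also have "\<dots> = ennreal (R * T)"
    using T R by (simp add: emeasure_restrict_space ennreal_mult')
  finally have bound: "(\<integral>\<^sup>+\<omega>. \<integral>\<^sup>+p. G (\<omega>, p) \<partial>(X \<Otimes>\<^sub>M ?S) \<partial>M) \<le> ennreal (R * T)" .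
  have inner_meas: "(\<lambda>\<omega>. \<integral>\<^sup>+p. G (\<omega>, p) \<partial>(X \<Otimes>\<^sub>M ?S)) \<in> borel_measurable M"
    using G by (intro XS.borel_measurable_nn_integral) (simp add: split_beta')
  have finite: "AE \<omega> in M. (\<integral>\<^sup>+p. G (\<omega>, p) \<partial>(X \<Otimes>\<^sub>M ?S)) \<noteq> \<infinity>"
    using bound by (intro nn_integral_noteq_infinite inner_meas) (auto simp: top_unique)
  show in_L2: "AE \<omega> in M. (\<lambda>(x, t). u t \<omega> x) \<in> L2 (X \<Otimes>\<^sub>M ?S)"
    using finite AE_space
  proof eventually_elim
    case (elim \<omega>)
    have "(\<integral>\<^sup>+p. ennreal ((case p of (x, t) \<Rightarrow> u t \<omega> x)\<^sup>2) \<partial>(X \<Otimes>\<^sub>M ?S)) < \<infinity>"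
      using elim(1) by (simp add: G_def split_beta less_top)
    then show ?case
      using slice_meas[OF elim(2)] by (simp add: L2_real_iff integrable_iff_bounded)
  qed
  let ?N = "\<lambda>\<omega>. (L2_norm (X \<Otimes>\<^sub>M ?S) (\<lambda>(x, t). u t \<omega> x))\<^sup>2"
  have N_meas: "?N \<in> borel_measurable M"
    unfolding L2_norm_sq by (rule XS.borel_measurable_lebesgue_integral[OF real_meas])
  have "(\<integral>\<^sup>+\<omega>. ennreal (?N \<omega>) \<partial>M) = (\<integral>\<^sup>+\<omega>. \<integral>\<^sup>+p. G (\<omega>, p) \<partial>(X \<Otimes>\<^sub>M ?S) \<partial>M)"
  proof (rule nn_integral_cong_AE)
    show "AE \<omega> in M. ennreal (?N \<omega>) = (\<integral>\<^sup>+p. G (\<omega>, p) \<partial>(X \<Otimes>\<^sub>M ?S))"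
      using in_L2
    proof eventually_elim
      case (elim \<omega>)
      then have "integrable (X \<Otimes>\<^sub>M ?S) (\<lambda>p. (case p of (x, t) \<Rightarrow> u t \<omega> x)\<^sup>2)" by (simp add: L2_real_iff)
      from nn_integral_eq_integral[OF this] show ?case
        by (simp add: L2_norm_sq G_def split_beta)
    qed
  qed
  then have "(\<integral>\<^sup>+\<omega>. ennreal (?N \<omega>) \<partial>M) \<le> ennreal (R * T)" using bound by simp
  from integrable_of_nn_integral_bound[OF N_meas _ this] R T
  show "integrable M ?N" "(\<integral>\<omega>. ?N \<omega> \<partial>M) \<le> R * T" by simp_all
qed


section \<open>The regularity estimate\<close>

theorem lemma3p1:
  fixes M :: "'w measure" and W :: "real \<Rightarrow> 'w \<Rightarrow> real"
    and D :: "'a::euclidean_space set" and lam :: "nat \<Rightarrow> real" and \<phi> :: "nat \<Rightarrow> 'a \<Rightarrow> real"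
    and T \<alpha> s H :: real
  assumes "prob_space M" and "complete_measure M"
    and "0 < T" and "0 < \<alpha>" and "\<alpha> < 1" and "0 < s" and "s < 1" and "0 < H" and "H < 1"
    and "fractional_brownian_motion M H W"
    and "bounded_lipschitz_domain D"
    and "dirichlet_eigensystem D lam \<phi>"
  shows
    "(\<exists>C>0. \<forall>f\<in>L2 (lebesgue_on D). \<forall>g\<in>L2 (lebesgue_on D). \<forall>h\<in>Linf (lebesgue_on {0..T}). \<forall>u.
        mild_solution M H W D lam \<phi> T \<alpha> s f g h u \<longrightarrow>
        (AE \<omega> in M. (\<lambda>(x, t). u t \<omega> x) \<in> L2 (lebesgue_on D \<Otimes>\<^sub>M lebesgue_on {0..T})) \<and>
        integrable M (\<lambda>\<omega>. (L2_norm (lebesgue_on D \<Otimes>\<^sub>M lebesgue_on {0..T}) (\<lambda>(x, t). u t \<omega> x))\<^sup>2) \<and>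
        (\<integral>\<omega>. (L2_norm (lebesgue_on D \<Otimes>\<^sub>M lebesgue_on {0..T}) (\<lambda>(x, t). u t \<omega> x))\<^sup>2 \<partial>M)
          \<le> C * (Linf_norm (lebesgue_on {0..T}) h)\<^sup>2 * (L2_norm (lebesgue_on D) f)\<^sup>2
            + C * T powr (2 * H + 1) * (L2_norm (lebesgue_on D) g)\<^sup>2)
     \<and>
     (\<forall>\<epsilon>>0. \<forall>\<sigma>\<in>{0..min 1 (H / \<alpha> - \<epsilon>)}.
      \<exists>C>0. \<forall>f\<in>L2 (lebesgue_on D). \<forall>g\<in>L2 (lebesgue_on D). \<forall>h\<in>Linf (lebesgue_on {0..T}). \<forall>u.
        mild_solution M H W D lam \<phi> T \<alpha> s f g h u \<longrightarrow>
        (\<forall>t\<in>{0<..T}.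
          (AE \<omega> in M. u t \<omega> \<in> frac_power_domain D lam \<phi> (\<sigma> * s)) \<and>
          integrable M (\<lambda>\<omega>. (L2_norm (lebesgue_on D) (frac_power D lam \<phi> (\<sigma> * s) (u t \<omega>)))\<^sup>2) \<and>
          (\<integral>\<omega>. (L2_norm (lebesgue_on D) (frac_power D lam \<phi> (\<sigma> * s) (u t \<omega>)))\<^sup>2 \<partial>M)
            \<le> C * (Linf_norm (lebesgue_on {0..T}) h)\<^sup>2 * (L2_norm (lebesgue_on D) f)\<^sup>2
              + C * t powr (2 * H - 2 * \<sigma> * \<alpha>) * (L2_norm (lebesgue_on D) g)\<^sup>2))"
proof -
  interpret prob_space M by fact
  let ?D = "lebesgue_on D" and ?T = "lebesgue_on {0..T}"
  let ?N = "Linf_norm ?T"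
  have \<alpha>: "0 < \<alpha>" "\<alpha> \<le> 1" and H: "0 < H" "H < 1" and T: "0 < T" using assms by auto
  have D: "open D" "bounded D" using \<open>bounded_lipschitz_domain D\<close> by (auto simp: bounded_lipschitz_domain_def)
  have sf_D: "sigma_finite_measure ?D"
    using D by (intro finite_measure.axioms(1) finite_measure_lebesgue_on lmeasurable_open)
  have eig: "dirichlet_eigenpair D (lam k) (\<phi> k)" "L2_inner ?D (\<phi> j) (\<phi> k) = (if j = k then 1 else 0)"
    and complete: "\<forall>v\<in>L2 ?D. (\<forall>k. L2_inner ?D v (\<phi> k) = 0) \<longrightarrow> (AE x in ?D. v x = 0)" for j k
    using \<open>dirichlet_eigensystem D lam \<phi>\<close> unfolding dirichlet_eigensystem_def by blast+
  have ortho: "orthonormal_sequence ?D \<phi>"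
    using eig by unfold_locales (auto simp: dirichlet_eigenpair_def H10_with_grad_def)
  note coefficients = mild_solution_coefficients[where T = T and s = s and lam = lam, OF \<open>prob_space M\<close> ortho complete
      \<open>fractional_brownian_motion M H W\<close> H \<alpha>]
  show ?thesis
  proof (intro conjI allI impI ballI)
    \<comment> \<open>weight one is the case \<open>a = 0\<close>\<close>
    have w: "\<forall>r>0. 1 \<le> (1 + lam k powr s * r powr \<alpha>) * r powr (- 0)" for k
      by simp
    obtain C where C: "0 < C" and est: "\<forall>f\<in>L2 ?D. \<forall>g\<in>L2 ?D. \<forall>h\<in>Linf ?T. \<forall>u t.
        mild_solution M H W D lam \<phi> T \<alpha> s f g h u \<longrightarrow> 0 < t \<longrightarrow> t \<le> T \<longrightarrow>
        (\<exists>Y. (\<forall>k. Y k \<in> borel_measurable M) \<and> (AE \<omega> in M. \<forall>k. L2_inner ?D (u t \<omega>) (\<phi> k) = Y k \<omega>) \<and>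
        (\<integral>\<^sup>+\<omega>. (\<Sum>k. ennreal ((1 * Y k \<omega>)\<^sup>2)) \<partial>M) \<le>
          ennreal (C * (?N h)\<^sup>2 * (L2_norm ?D f)\<^sup>2 + C * t powr (2 * H - 2 * 0) * (L2_norm ?D g)\<^sup>2))"
      using coefficients[where a = 0 and w = "\<lambda>_. 1", OF order_refl H(1) zero_le_one w] by (elim exE conjE)
    have "(AE \<omega> in M. (\<lambda>(x, t). u t \<omega> x) \<in> L2 (?D \<Otimes>\<^sub>M ?T)) \<and>
        integrable M (\<lambda>\<omega>. (L2_norm (?D \<Otimes>\<^sub>M ?T) (\<lambda>(x, t). u t \<omega> x))\<^sup>2) \<and>
        (\<integral>\<omega>. (L2_norm (?D \<Otimes>\<^sub>M ?T) (\<lambda>(x, t). u t \<omega> x))\<^sup>2 \<partial>M)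
          \<le> C * (T + 1) * (?N h)\<^sup>2 * (L2_norm ?D f)\<^sup>2 + C * (T + 1) * T powr (2 * H + 1) * (L2_norm ?D g)\<^sup>2"
      if f: "f \<in> L2 ?D" and g: "g \<in> L2 ?D" and h: "h \<in> Linf ?T" and u: "mild_solution M H W D lam \<phi> T \<alpha> s f g h u"
      for f g h u
    proof -
      define R where "R = C * (?N h)\<^sup>2 * (L2_norm ?D f)\<^sup>2 + C * T powr (2 * H) * (L2_norm ?D g)\<^sup>2"
      have R: "0 \<le> R" using C by (simp add: R_def)
      have slice: "(\<integral>\<^sup>+\<omega>. \<integral>\<^sup>+x. ennreal ((u t \<omega> x)\<^sup>2) \<partial>?D \<partial>M) \<le> ennreal R" if t: "0 < t" "t \<le> T" for t
      proof -
        obtain Y where Y: "AE \<omega> in M. \<forall>k. L2_inner ?D (u t \<omega>) (\<phi> k) = Y k \<omega>"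
          and le: "(\<integral>\<^sup>+\<omega>. (\<Sum>k. ennreal ((1 * Y k \<omega>)\<^sup>2)) \<partial>M) \<le>
            ennreal (C * (?N h)\<^sup>2 * (L2_norm ?D f)\<^sup>2 + C * t powr (2 * H - 2 * 0) * (L2_norm ?D g)\<^sup>2)"
          using est[rule_format, OF f g h u t] by (elim exE conjE)
        have u_L2: "AE \<omega> in M. u t \<omega> \<in> L2 ?D" using u t by (simp add: mild_solution_def)
        have "(\<integral>\<^sup>+\<omega>. \<integral>\<^sup>+x. ennreal ((u t \<omega> x)\<^sup>2) \<partial>?D \<partial>M) = (\<integral>\<^sup>+\<omega>. (\<Sum>k. ennreal ((1 * Y k \<omega>)\<^sup>2)) \<partial>M)"
        proof (rule nn_integral_cong_AE)
          show "AE \<omega> in M. (\<integral>\<^sup>+x. ennreal ((u t \<omega> x)\<^sup>2) \<partial>?D) = (\<Sum>k. ennreal ((1 * Y k \<omega>)\<^sup>2))"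
            using Y u_L2
          proof eventually_elim
            case (elim \<omega>)
            have "(\<lambda>k. (Y k \<omega>)\<^sup>2) sums (\<integral>x. (u t \<omega> x)\<^sup>2 \<partial>?D)"
              using orthonormal_sequence.parseval[OF ortho complete elim(2)] elim(1) by simp
            then have "(\<Sum>k. ennreal ((Y k \<omega>)\<^sup>2)) = ennreal (\<integral>x. (u t \<omega> x)\<^sup>2 \<partial>?D)"
              by (subst suminf_ennreal2) (auto simp: sums_iff)
            moreover have "(\<integral>\<^sup>+x. ennreal ((u t \<omega> x)\<^sup>2) \<partial>?D) = ennreal (\<integral>x. (u t \<omega> x)\<^sup>2 \<partial>?D)"
              using elim(2) by (intro nn_integral_eq_integral) (auto simp: L2_real_iff)
            ultimately show ?case by simp
          qed
        qed
        also note le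
        also have "ennreal (C * (?N h)\<^sup>2 * (L2_norm ?D f)\<^sup>2 + C * t powr (2 * H - 2 * 0) * (L2_norm ?D g)\<^sup>2) \<le> ennreal R"
          unfolding R_def using t H C
          by (intro ennreal_leI add_left_mono mult_right_mono mult_left_mono) (auto intro: powr_mono2)
        finally show ?thesis .
      qed
      have meas: "(\<lambda>(\<omega>, x, t). u t \<omega> x) \<in> borel_measurable (M \<Otimes>\<^sub>M (?D \<Otimes>\<^sub>M ?T))"
        using u by (simp add: mild_solution_def)
      note st = second_moment_space_time[OF sigma_finite_measure_axioms sf_D less_imp_le[OF T] R meas slice]
      \<comment> \<open>integration over time contributes a factor \<open>T\<close>, which the second term absorbs into \<open>T\<^bsup>2H + 1\<^esup>\<close> and the first one does not; \<open>T + 1\<close> serves both\<close>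
      have "R * T \<le> C * (T + 1) * (?N h)\<^sup>2 * (L2_norm ?D f)\<^sup>2 + C * (T + 1) * T powr (2 * H + 1) * (L2_norm ?D g)\<^sup>2"
      proof -
        have "R * T = C * T * (?N h)\<^sup>2 * (L2_norm ?D f)\<^sup>2 + C * 1 * T powr (2 * H + 1) * (L2_norm ?D g)\<^sup>2"
          using T by (simp add: R_def powr_add algebra_simps)
        also have "\<dots> \<le> C * (T + 1) * (?N h)\<^sup>2 * (L2_norm ?D f)\<^sup>2 + C * (T + 1) * T powr (2 * H + 1) * (L2_norm ?D g)\<^sup>2"
          using C T by (intro add_mono mult_right_mono mult_left_mono) auto
        finally show ?thesis .
      qed
      then show ?thesis using st by (auto intro: order_trans)
    qed
    moreover have "0 < C * (T + 1)" using C T by simp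
    ultimately show "\<exists>C>0. \<forall>f\<in>L2 ?D. \<forall>g\<in>L2 ?D. \<forall>h\<in>Linf ?T. \<forall>u.
        mild_solution M H W D lam \<phi> T \<alpha> s f g h u \<longrightarrow>
        (AE \<omega> in M. (\<lambda>(x, t). u t \<omega> x) \<in> L2 (?D \<Otimes>\<^sub>M ?T)) \<and>
        integrable M (\<lambda>\<omega>. (L2_norm (?D \<Otimes>\<^sub>M ?T) (\<lambda>(x, t). u t \<omega> x))\<^sup>2) \<and>
        (\<integral>\<omega>. (L2_norm (?D \<Otimes>\<^sub>M ?T) (\<lambda>(x, t). u t \<omega> x))\<^sup>2 \<partial>M)
          \<le> C * (?N h)\<^sup>2 * (L2_norm ?D f)\<^sup>2 + C * T powr (2 * H + 1) * (L2_norm ?D g)\<^sup>2"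
      by (intro exI[of _ "C * (T + 1)"] conjI[of "0 < _"] ballI allI impI)
  next
    fix \<epsilon> \<sigma> :: real assume \<epsilon>: "0 < \<epsilon>" and \<sigma>: "\<sigma> \<in> {0..min 1 (H / \<alpha> - \<epsilon>)}"
    define a where "a = \<sigma> * \<alpha>"
    have "\<sigma> < H / \<alpha>" using \<epsilon> \<sigma> by simp
    then have a: "0 \<le> a" "a < H" using \<sigma> \<alpha> by (simp_all add: a_def pos_less_divide_eq)
    let ?w = "\<lambda>k. lam k powr (\<sigma> * s)"
    have w: "0 \<le> ?w k" "\<forall>r>0. ?w k \<le> (1 + lam k powr s * r powr \<alpha>) * r powr (- a)" for k
    proof -
      \<comment> \<open>the weight is the power \<open>\<sigma>\<close> of the relaxation rate \<open>\<lambda>\<^sub>k\<^sup>s\<close>\<close>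
      have "?w k = (lam k powr s) powr \<sigma>" by (simp add: powr_powr mult.commute)
      then show "\<forall>r>0. ?w k \<le> (1 + lam k powr s * r powr \<alpha>) * r powr (- a)"
        using relaxation_weight[of "lam k powr s" \<sigma>] \<sigma> by (simp add: a_def)
    qed simp
    obtain C where C: "0 < C" and est: "\<forall>f\<in>L2 ?D. \<forall>g\<in>L2 ?D. \<forall>h\<in>Linf ?T. \<forall>u t.
        mild_solution M H W D lam \<phi> T \<alpha> s f g h u \<longrightarrow> 0 < t \<longrightarrow> t \<le> T \<longrightarrow>
        (\<exists>Y. (\<forall>k. Y k \<in> borel_measurable M) \<and> (AE \<omega> in M. \<forall>k. L2_inner ?D (u t \<omega>) (\<phi> k) = Y k \<omega>) \<and>
        (\<integral>\<^sup>+\<omega>. (\<Sum>k. ennreal ((?w k * Y k \<omega>)\<^sup>2)) \<partial>M) \<le>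
          ennreal (C * (?N h)\<^sup>2 * (L2_norm ?D f)\<^sup>2 + C * t powr (2 * H - 2 * a) * (L2_norm ?D g)\<^sup>2))"
      using coefficients[OF a w] by (elim exE conjE)
    have "(AE \<omega> in M. u t \<omega> \<in> frac_power_domain D lam \<phi> (\<sigma> * s)) \<and>
          integrable M (\<lambda>\<omega>. (L2_norm ?D (frac_power D lam \<phi> (\<sigma> * s) (u t \<omega>)))\<^sup>2) \<and>
          (\<integral>\<omega>. (L2_norm ?D (frac_power D lam \<phi> (\<sigma> * s) (u t \<omega>)))\<^sup>2 \<partial>M)
            \<le> C * (?N h)\<^sup>2 * (L2_norm ?D f)\<^sup>2 + C * t powr (2 * H - 2 * \<sigma> * \<alpha>) * (L2_norm ?D g)\<^sup>2"
      if f: "f \<in> L2 ?D" and g: "g \<in> L2 ?D" and h: "h \<in> Linf ?T" and u: "mild_solution M H W D lam \<phi> T \<alpha> s f g h u"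
        and t: "t \<in> {0<..T}"
      for f g h u t
    proof -
      define R where "R = C * (?N h)\<^sup>2 * (L2_norm ?D f)\<^sup>2 + C * t powr (2 * H - 2 * a) * (L2_norm ?D g)\<^sup>2"
      have R: "0 \<le> R" using C by (simp add: R_def)
      have t': "0 < t" "t \<le> T" using t by auto
      obtain Y where Y_meas[measurable]: "\<And>k. Y k \<in> borel_measurable M"
        and Y: "AE \<omega> in M. \<forall>k. L2_inner ?D (u t \<omega>) (\<phi> k) = Y k \<omega>"
        and le: "(\<integral>\<^sup>+\<omega>. (\<Sum>k. ennreal ((?w k * Y k \<omega>)\<^sup>2)) \<partial>M) \<le> ennreal R"
        using est[rule_format, OF f g h u t', folded R_def] by blast
      have u_L2: "AE \<omega> in M. u t \<omega> \<in> L2 ?D" using u t by (simp add: mild_solution_def)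
      have fin: "AE \<omega> in M. (\<Sum>k. ennreal ((?w k * Y k \<omega>)\<^sup>2)) \<noteq> \<infinity>"
        using le by (intro nn_integral_noteq_infinite) (auto simp: top_unique)
      let ?F = "\<lambda>\<omega>. (L2_norm ?D (frac_power D lam \<phi> (\<sigma> * s) (u t \<omega>)))\<^sup>2"
      have key: "AE \<omega> in M. u t \<omega> \<in> frac_power_domain D lam \<phi> (\<sigma> * s) \<and> ?F \<omega> = (\<Sum>k. (?w k * Y k \<omega>)\<^sup>2) \<and>
          ennreal (?F \<omega>) = (\<Sum>k. ennreal ((?w k * Y k \<omega>)\<^sup>2))"
        using Y u_L2 fin
      proof eventually_elim
        case (elim \<omega>)
        have sm: "summable (\<lambda>k. (?w k * Y k \<omega>)\<^sup>2)"
          by (rule summable_suminf_not_top[OF zero_le_power2]) (rule elim(3)[unfolded infinity_ennreal_def])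
        then have sm': "summable (\<lambda>k. (?w k * L2_inner ?D (u t \<omega>) (\<phi> k))\<^sup>2)" using elim(1) by simp
        have F: "?F \<omega> = (\<Sum>k. (?w k * Y k \<omega>)\<^sup>2)"
          using frac_power_of_summable(2)[OF ortho elim(2) sm'] elim(1) by simp
        moreover have "ennreal (?F \<omega>) = (\<Sum>k. ennreal ((?w k * Y k \<omega>)\<^sup>2))"
          unfolding F by (rule suminf_ennreal2[OF zero_le_power2 sm, symmetric])
        ultimately show ?case
          by (intro conjI frac_power_of_summable(1)[OF ortho elim(2) sm'])
      qed
      \<comment> \<open>the norm agrees almost surely with a measurable sum, and on the exceptional null set, where it is arbitrary, completeness of \<open>M\<close> takes over\<close>
      have F_meas: "?F \<in> borel_measurable M"
        by (rule complete_measure.borel_measurable_AE_eq[OF \<open>complete_measure M\<close>, of "\<lambda>\<omega>. \<Sum>k. (?w k * Y k \<omega>)\<^sup>2"])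
          (use key in \<open>auto elim!: eventually_mono\<close>)
      have "(\<integral>\<^sup>+\<omega>. ennreal (?F \<omega>) \<partial>M) = (\<integral>\<^sup>+\<omega>. (\<Sum>k. ennreal ((?w k * Y k \<omega>)\<^sup>2)) \<partial>M)"
        by (rule nn_integral_cong_AE) (use key in \<open>auto elim!: eventually_mono\<close>)
      with le have "(\<integral>\<^sup>+\<omega>. ennreal (?F \<omega>) \<partial>M) \<le> ennreal R" by simp
      from integrable_of_nn_integral_bound[OF F_meas _ this R]
      have "integrable M ?F \<and> (\<integral>\<omega>. ?F \<omega> \<partial>M) \<le> R" by simp
      moreover have "AE \<omega> in M. u t \<omega> \<in> frac_power_domain D lam \<phi> (\<sigma> * s)" using key by eventually_elim simp
      ultimately show ?thesis by (simp add: R_def a_def mult.assoc)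
    qed
    then show "\<exists>C>0. \<forall>f\<in>L2 ?D. \<forall>g\<in>L2 ?D. \<forall>h\<in>Linf ?T. \<forall>u.
        mild_solution M H W D lam \<phi> T \<alpha> s f g h u \<longrightarrow>
        (\<forall>t\<in>{0<..T}.
          (AE \<omega> in M. u t \<omega> \<in> frac_power_domain D lam \<phi> (\<sigma> * s)) \<and>
          integrable M (\<lambda>\<omega>. (L2_norm ?D (frac_power D lam \<phi> (\<sigma> * s) (u t \<omega>)))\<^sup>2) \<and>
          (\<integral>\<omega>. (L2_norm ?D (frac_power D lam \<phi> (\<sigma> * s) (u t \<omega>)))\<^sup>2 \<partial>M)
            \<le> C * (?N h)\<^sup>2 * (L2_norm ?D f)\<^sup>2 + C * t powr (2 * H - 2 * \<sigma> * \<alpha>) * (L2_norm ?D g)\<^sup>2)"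
      using C by (intro exI[of _ C] conjI[of "0 < _"] ballI allI impI)
  qed
qed

end
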